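(* Let $\mathcal Q_1,\mathcal Q_2$ be two quadrics of the pencil of quadrics in $\mathbf P^{2d-1}$ with base locus $V$ (described in the context). A generalized Weyr chain of length $2n$ (for rulings of $\mathcal Q_1$ and $\mathcal Q_2$) projects, by $\pi^*$, into a Poncelet polygon of length $2n$ circumscribing the quadrics $\mathcal Q^p_{\alpha_1},\dots,\mathcal Q^p_{\alpha_{d-1}}$ and alternately inscribed into two fixed confocal quadrics (the projections of $\mathcal Q_1,\mathcal Q_2$). Conversely, any such Poncelet polygon of length $2n$ circumscribing the quadrics $\mathcal Q^p_{\alpha_1},\dots,\mathcal Q^p_{\alpha_{d-1}}$ and alternately inscribed into two fixed confocal quadrics can be lifted to a generalized Weyr chain of length $2n$.
   Context: Consider in $\mathbf E^d$ the confocal family $\mathcal Q_{\lambda}:\ \sum_{i=1}^d \frac{x_i^2}{a_i-\lambda}=1$ ($a_1,\dots,a_d$ distinct reals), the quadrics $\mathcal Q_{\alpha_1},\dots,\mathcal Q_{\alpha_{d-1}}$ of this family, and their projective closures $\mathcal Q^p_{\alpha_1},\dots,\mathcal Q^p_{\alpha_{d-1}}$ in $\mathbf P^d$. In $\mathbf P^{2d-1}$ with homogeneous coordinates $(x_0,\dots,x_d,y_1,\dots,y_{d-1})$ let $V$ be the intersection of the two quadrics $$x_1^2+\dots+x_d^2-y_1^2-\dots-y_{d-1}^2=0,\qquad a_1x_1^2+\dots+a_dx_d^2-\alpha_1y_1^2-\dots-\alpha_{d-1}y_{d-1}^2=x_0^2.$$ The pencil they span consists of the quadrics $\sum_i(a_i-\lambda)x_i^2-\sum_j(\alpha_j-\lambda)y_j^2=x_0^2$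 and the first quadric above; the projection of the member with parameter $\lambda$ is the confocal quadric $\mathcal Q_\lambda$. $F(V)$ is the set of $(d-2)$-dimensional linear subspaces of $V$. Let $\pi'(x,y)=x$ be the projection $\mathbf P^{2d-1}\setminus\{(x,y)\mid x=0\}\to\mathbf P^d$. For $L\in F(V)$, $\pi'(L)$ is a codimension $2$ subspace tangent to the duals of the quadrics $\mathcal Q^p_{\alpha_j}$, and $\pi^*(L)$ denotes the line dual to $\pi'(L)$; it is tangent to $\mathcal Q^p_{\alpha_1},\dots,\mathcal Q^p_{\alpha_{d-1}}$. A ruling of a quadric in $\mathbf P^{2d-1}$ is a unirational family of $(d-1)$-dimensional linear subspaces contained in it. A generalized Weyr chain of length $2n$ for rulings $\mathcal R_1$ of $\mathcal Q_1$ and $\mathcal R_2$ of $\mathcal Q_2$ is a closed chain $L_1,\dots,L_{2n},L_{2n+1}=L_1$ of distinct $(d-1)$-dimensional linear subspaces with $L_{2i-1}\in\mathcal R_1$, $L_{2i}\in\mathcal R_2$ ($1\le i\le n$) and $L_j\cap L_{j+1}\in F(V)$ ($1\le j\le 2n$). Its projection is the closed polygonal line with sides on the lines $\pi^*(L_j\cap L_{j+1})$, $1\le j\le 2n$. A Poncelet polygon circumscribing the quadrics $\mathcal Q^p_{\alpha_j}$ and alternately inscribed into two confocal quadrics is a closed polygonal line whose sides are all tangent to $\mathcal Q^p_{\alpha_1},\dots,\mathcal Q^p_{\alpha_{d-1}}$, whose vertices lie alternately on the two quadrics, and whose consecutive sides satisfy the billiard reflection law at the common vertex on the corresponding quadric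 (i.e. they are coplanar with the normal there and make congruent angles with it).
   Formalization: In the converse the polygon must also reflect off each quadric from one constant side, return its contact normals and repeat no side with the same normals; everything is real, n ≥ 2, the α's are distinct and not a_i, the two quadrics have parameters not a_i, and rulings are maximal families. *)

theory Defs
  imports "HOL-Analysis.Analysis"
begin

(* Homogeneous coordinates: a point of P^d is given by a nonzero vector (x0, x), and a point of
   P^(2d-1) by a nonzero vector (x0, x, y), where d = CARD('d) and d - 1 = CARD('c).  A projective
   k-dimensional subspace is a (k+1)-dimensional linear subspace of the coordinate space.
   An affine point x of E^d is the class of (1, x). *)

type_synonym 'd pspace = "real \<times> (real^'d)"
type_synonym ('d, 'c) bigspace = "real \<times> (real^'d) \<times> (real^'c)"


section \<open>The confocal family in \<open>P\<^sup>d\<close>\<close>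

definition confocal_bilinear ::
    "real^'d \<Rightarrow> real \<Rightarrow> 'd::finite pspace \<Rightarrow> 'd pspace \<Rightarrow> real" where
  "confocal_bilinear a \<mu> p z =
     (\<Sum>i\<in>UNIV. (snd p $ i) * (snd z $ i) / (a $ i - \<mu>)) - fst p * fst z"

definition confocal_quadric :: "real^'d \<Rightarrow> real \<Rightarrow> ('d::finite pspace) set" where
  "confocal_quadric a \<mu> = {p. (\<Sum>i\<in>UNIV. (snd p $ i)\<^sup>2 / (a $ i - \<mu>)) = (fst p)\<^sup>2}"

(* Half the gradient of the equation of Q_mu at the affine point; for p at infinity, the Euclidean
   normal vector of the (asymptotic) tangent hyperplane at p. *)
definition quadric_normal :: "real^'d \<Rightarrow> real \<Rightarrow> 'd::finite pspace \<Rightarrow> real^'d" where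
  "quadric_normal a \<mu> p = (\<chi> i. (snd p $ i) / (a $ i - \<mu>))"

definition euclidean_line :: "('d::finite pspace) set \<Rightarrow> bool" where
  "euclidean_line l \<longleftrightarrow> subspace l \<and> dim l = 2 \<and> (\<exists>z\<in>l. fst z \<noteq> 0)"

definition line_direction :: "('d::finite pspace) set \<Rightarrow> real^'d \<Rightarrow> bool" where
  "line_direction l u \<longleftrightarrow> u \<noteq> 0 \<and> (0, u) \<in> l"

definition contact_point ::
    "real^'d \<Rightarrow> real \<Rightarrow> ('d::finite pspace) set \<Rightarrow> 'd pspace \<Rightarrow> bool" where
  "contact_point a \<mu> l c \<longleftrightarrow>
     c \<noteq> 0 \<and> c \<in> l \<and> c \<in> confocal_quadric a \<mu> \<and> (\<forall>z\<in>l. confocal_bilinear a \<mu> c z = 0)"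

definition tangent_to :: "real^'d \<Rightarrow> real \<Rightarrow> ('d::finite pspace) set \<Rightarrow> bool" where
  "tangent_to a \<mu> l \<longleftrightarrow> (\<exists>c. contact_point a \<mu> l c)"


section \<open>The pencil, its base locus, and the projections\<close>

definition pencil_quadric ::
    "real^'d \<Rightarrow> real^'c \<Rightarrow> real \<Rightarrow> (('d::finite, 'c::finite) bigspace) set" where
  "pencil_quadric a \<alpha> \<mu> = {(x0, x, y).
     (\<Sum>i\<in>UNIV. (a $ i - \<mu>) * (x $ i)\<^sup>2) - (\<Sum>j\<in>UNIV. (\<alpha> $ j - \<mu>) * (y $ j)\<^sup>2) = x0\<^sup>2}"

definition base_locus ::
    "real^'d \<Rightarrow> real^'c \<Rightarrow> (('d::finite, 'c::finite) bigspace) set" where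
  "base_locus a \<alpha> = {(x0, x, y).
     (\<Sum>i\<in>UNIV. (x $ i)\<^sup>2) - (\<Sum>j\<in>UNIV. (y $ j)\<^sup>2) = 0 \<and>
     (\<Sum>i\<in>UNIV. a $ i * (x $ i)\<^sup>2) - (\<Sum>j\<in>UNIV. \<alpha> $ j * (y $ j)\<^sup>2) = x0\<^sup>2}"

definition FV ::
    "real^'d \<Rightarrow> real^'c \<Rightarrow> (('d::finite, 'c::finite) bigspace) set set" where
  "FV a \<alpha> = {M. subspace M \<and> dim M + 1 = CARD('d) \<and> M \<subseteq> base_locus a \<alpha>}"

definition drop_y :: "('d::finite, 'c::finite) bigspace \<Rightarrow> 'd pspace" where
  "drop_y z = (fst z, fst (snd z))"

(* The projected subspace is read in the dual space: h is the hyperplane {z. inner h z = 0}. *)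
definition dual_line :: "(('d::finite, 'c::finite) bigspace) set \<Rightarrow> ('d pspace) set" where
  "dual_line M = orthogonal_comp (drop_y ` M)"


section \<open>Rulings and generalized Weyr chains\<close>

definition frame_span ::
    "(('d::finite, 'c::finite) bigspace)^'d \<Rightarrow> (('d, 'c) bigspace) set" where
  "frame_span b = span (range (\<lambda>i. b $ i))"

(* A family of d-dimensional linear subspaces is unirational if it is the Zariski closure (within
   the family) of the image of a rational map from an affine space.  After clearing denominators
   such a map is given by a polynomial frame B(t).  The parameter space is a fixed affine space of
   dimension 2 d^2.  This is no restriction: over an infinite field, every dimension at least that
   of the family gives the same notion, and the Grassmannian here has dimension d^2.
   The Zariski closure is taken on frames, with respect to all bases of the subspaces in question. *)
definition unirational_family :: "(('d::finite, 'c::finite) bigspace) set set \<Rightarrow> bool" where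
  "unirational_family F \<longleftrightarrow>
     (\<forall>L\<in>F. subspace L \<and> dim L = CARD('d)) \<and>
     (\<exists>B :: (('d, 'c) bigspace)^'d \<Rightarrow> (('d, 'c) bigspace)^'d.
        polynomial_function B \<and>
        (\<exists>t. dim (frame_span (B t)) = CARD('d)) \<and>
        (\<forall>t. dim (frame_span (B t)) = CARD('d) \<longrightarrow> frame_span (B t) \<in> F) \<and>
        (\<forall>f. real_polynomial_function f \<longrightarrow>
             (\<forall>b t. dim (frame_span (B t)) = CARD('d) \<and> frame_span b = frame_span (B t)
                      \<longrightarrow> f b = 0) \<longrightarrow>
             (\<forall>b. frame_span b \<in> F \<longrightarrow> f b = 0)))"

(* Maximality makes a ruling the whole system of subspaces: without it a single subspace, or a
   rational curve of subspaces, would count as a ruling of its own. *)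
definition ruling ::
    "(('d::finite, 'c::finite) bigspace) set \<Rightarrow> (('d, 'c) bigspace) set set \<Rightarrow> bool" where
  "ruling Q R \<longleftrightarrow>
     unirational_family R \<and> (\<forall>L\<in>R. L \<subseteq> Q) \<and>
     (\<forall>R'. unirational_family R' \<and> (\<forall>L\<in>R'. L \<subseteq> Q) \<and> R \<subseteq> R' \<longrightarrow> R' = R)"

definition cyc_succ :: "nat \<Rightarrow> nat \<Rightarrow> nat" where
  "cyc_succ n j = (if j = 2 * n then 1 else j + 1)"

definition weyr_chain ::
    "real^'d \<Rightarrow> real^'c \<Rightarrow> (('d::finite, 'c::finite) bigspace) set set \<Rightarrow>
     (('d, 'c) bigspace) set set \<Rightarrow> nat \<Rightarrow> (nat \<Rightarrow> (('d, 'c) bigspace) set) \<Rightarrow> bool" where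
  "weyr_chain a \<alpha> R1 R2 n L \<longleftrightarrow>
     inj_on L {1..2*n} \<and>
     (\<forall>i\<in>{1..n}. L (2*i - 1) \<in> R1 \<and> L (2*i) \<in> R2) \<and>
     (\<forall>j\<in>{1..2*n}. L j \<inter> L (cyc_succ n j) \<in> FV a \<alpha>)"

definition chain_side ::
    "nat \<Rightarrow> (nat \<Rightarrow> (('d::finite, 'c::finite) bigspace) set) \<Rightarrow> nat \<Rightarrow> ('d pspace) set" where
  "chain_side n L j = dual_line (L j \<inter> L (cyc_succ n j))"


section \<open>Poncelet polygons\<close>

definition mirror :: "real^'d::finite \<Rightarrow> real^'d \<Rightarrow> real^'d" where
  "mirror N x = x - (2 * (x \<bullet> N) / (N \<bullet> N)) *\<^sub>R N"

(* At an affine vertex p the lines l and l' are coplanar with the normal and make congruent angles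
   with it.  This alone would be satisfied by every l' = l, so an unreflected line is admitted only
   if it is its own reflection, i.e. normal or tangent to the quadric.
   If the vertex is at infinity, then l and l' are parallel; the limit of the law says that they are
   mirror images in the tangent hyperplane, which passes through the centre. *)
definition reflection_law ::
    "real^'d \<Rightarrow> real \<Rightarrow> 'd::finite pspace \<Rightarrow> ('d pspace) set \<Rightarrow> ('d pspace) set \<Rightarrow> bool" where
  "reflection_law a \<mu> p l l' \<longleftrightarrow>
     (let N = quadric_normal a \<mu> p in
      if fst p \<noteq> 0 then
        (\<exists>u u'. line_direction l u \<and> line_direction l' u' \<and>
           dim {N, u, u'} \<le> 2 \<and>
           \<bar>u \<bullet> N\<bar> / norm u = \<bar>u' \<bullet> N\<bar> / norm u' \<and>
           (l = l' \<longrightarrow> u \<in> span {N} \<or> u \<bullet> N = 0))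
      else
        (\<exists>x x'. (1, x) \<in> l \<and> (1, x') \<in> l' \<and> x' = mirror N x))"

definition alternate :: "'a \<Rightarrow> 'a \<Rightarrow> nat \<Rightarrow> 'a" where
  "alternate s t j = (if odd j then s else t)"

(* Side l j joins the vertices p j and p (j+1). *)
definition poncelet_polygon ::
    "real^'d \<Rightarrow> real^'c \<Rightarrow> real \<Rightarrow> real \<Rightarrow> nat \<Rightarrow> (nat \<Rightarrow> ('d::finite pspace) set) \<Rightarrow>
     (nat \<Rightarrow> 'd pspace) \<Rightarrow> bool" where
  "poncelet_polygon a \<alpha> \<mu>1 \<mu>2 n l p \<longleftrightarrow>
     (\<forall>j\<in>{1..2*n}.
        euclidean_line (l j) \<and>
        (\<forall>k. tangent_to a (\<alpha> $ k) (l j)) \<and>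
        p j \<noteq> 0 \<and> p j \<in> confocal_quadric a (alternate \<mu>1 \<mu>2 j) \<and>
        p j \<in> l j \<and> p (cyc_succ n j) \<in> l j \<and>
        reflection_law a (alternate \<mu>1 \<mu>2 (cyc_succ n j)) (p (cyc_succ n j))
          (l j) (l (cyc_succ n j)))"

definition contact_normal ::
    "real^'d \<Rightarrow> real \<Rightarrow> ('d::finite pspace) set \<Rightarrow> real^'d \<Rightarrow> bool" where
  "contact_normal a \<mu> l \<nu> \<longleftrightarrow>
     norm \<nu> = 1 \<and> (\<exists>c. contact_point a \<mu> l c \<and> \<nu> \<in> span {quadric_normal a \<mu> c})"

(* The polygon closes up as a billiard motion, not only as a sequence of lines.  The sides carry unit
   directions w j and unit normals nu j k to the caustics at the points of contact; both are
   transported by the reflections at the vertices (cyclically, so also around the closed polygon),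
   and no side is run through twice with the same normals.
   The last condition says that all reflections in one of the two quadrics take place from the same
   side: at an affine vertex P it amounts to inner (w j) (quadric_normal at P) = c, where c depends
   only on the quadric, and its homogeneous form covers vertices at infinity.  By the Joachimsthal
   integral c^2 is determined by the quadric and the caustics, so only the sign of c matters. *)
definition coherent ::
    "real^'d \<Rightarrow> real^'c \<Rightarrow> real \<Rightarrow> real \<Rightarrow> nat \<Rightarrow> (nat \<Rightarrow> ('d::finite pspace) set) \<Rightarrow>
     (nat \<Rightarrow> 'd pspace) \<Rightarrow> bool" where
  "coherent a \<alpha> \<mu>1 \<mu>2 n l p \<longleftrightarrow>
     (\<exists>(w :: nat \<Rightarrow> real^'d) (\<nu> :: nat \<Rightarrow> 'c \<Rightarrow> real^'d) c1 c2.
        inj_on (\<lambda>j. (l j, \<nu> j)) {1..2*n} \<and>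
        (\<forall>j\<in>{1..2*n}.
           (let j' = cyc_succ n j; N' = quadric_normal a (alternate \<mu>1 \<mu>2 j') (p j') in
             norm (w j) = 1 \<and> line_direction (l j) (w j) \<and> w j' = mirror N' (w j) \<and>
             (\<forall>k. contact_normal a (\<alpha> $ k) (l j) (\<nu> j k) \<and> \<nu> j' k = mirror N' (\<nu> j k)) \<and>
             (\<forall>z\<in>l j. confocal_bilinear a (alternate \<mu>1 \<mu>2 j) (p j) z =
                alternate c1 c2 j * ((fst (p j) *\<^sub>R snd z - fst z *\<^sub>R snd (p j)) \<bullet> w j)))))"

end

theory Submission
  imports Defs
begin

text \<open>A \<open>(d-2)\<close>-dimensional projective subspace of the base locus projects injectively to the
  coordinates \<open>y\<close>, hence it is the image of \<open>y \<mapsto> (\<Sum> y\<^sub>k h\<^sub>k, \<Sum> y\<^sub>k \<nu>\<^sub>k, y)\<close> with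
  orthonormal \<open>\<nu>\<^sub>k\<close>.  The \<open>\<nu>\<^sub>k\<close> are unit contact normals of the dual line with the caustics, and
  the \<open>h\<^sub>k\<close> fix the tangent hyperplanes, so the subspace amounts to a common tangent line with a choice
  of contact normals.  A maximal isotropic subspace of the member \<open>\<mu>\<close> of the pencil that contains it is
  spanned by it and one vector \<open>(- p\<^sub>0, N, 0)\<close>, where \<open>p\<close> is an intersection point of the line with
  the confocal quadric \<open>\<mu>\<close> and \<open>N\<close> the normal at \<open>p\<close>.  Two such subspaces in one maximal isotropic
  subspace differ by the reflection in \<open>N\<close>: this is the billiard law.

  The rulings are separated by a sign.  The reflections of the form act transitively on the maximal
  isotropic subspaces, and each of them changes the sign of the ratio of the minors belonging to the
  coordinates \<open>x\<close> and \<open>(x\<^sub>0, y)\<close>.  On a unirational family this sign is constant, since a product of two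
  polynomials vanishes only if one of them does.  For the subspace belonging to a line with
  direction \<open>w\<close> and a vertex \<open>p\<close> the ratio is, up to sign, the product of the Joachimsthal constant and
  \<open>det (\<nu>, w)\<close>; the reflections of the billiard change the sign of this determinant, so a
  fixed ruling means a fixed Joachimsthal constant.\<close>


text \<open>Two exceptional cases shape the development. At a vertex at infinity both minors vanish
  and the ratio says nothing; such subspaces are compared only after further reflections into
  general position, whose number enters the sign. For \<open>\<mu> = \<alpha> $ k\<close> the form
  has a one-dimensional kernel, the minor in \<open>x\<close> vanishes throughout, all maximal
  isotropic subspaces form a single ruling, and the Joachimsthal constant is zero as well.
  Reflections are used with cleared denominators for two reasons. A product of \<open>d\<close> of
  them is a polynomial frame in the \<open>d\<close> reflecting vectors, as a unirational family
  requires. And a deformation may cross the null cone, where a true reflection is undefined while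
  images of isotropic subspaces stay isotropic. The absence of zero divisors among polynomials takes
  the place of connectedness. The sign of \<open>det (\<nu>, w)\<close> changes at each vertex;
  since the quadrics alternate and the length is even, it is constant on the subspaces that belong
  to one quadric, also after closing up.\<close>

section \<open>Polynomial functions\<close>

lemma real_polynomial_function_zero_product:
  fixes f g :: "'a::euclidean_space \<Rightarrow> real"
  assumes f: "real_polynomial_function f" and g: "real_polynomial_function g"
    and 0: "\<And>x. f x * g x = 0" and u: "f u \<noteq> 0"
  shows "g v = 0"
proof (rule ccontr)
  assume v: "g v \<noteq> 0"
  \<comment> \<open>On the line through \<open>u\<close> (at 0) and \<open>v\<close> (at 1) both
    functions become polynomials in one variable with finitely many roots, yet every parameter is a
    root of one of them.\<close>
  define \<gamma> where "\<gamma> = (\<lambda>s::real. u + s *\<^sub>R (v - u))"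
  have \<gamma>: "polynomial_function \<gamma>"
    unfolding \<gamma>_def by (intro polynomial_function_add polynomial_function_mult) auto
  have fin: "finite {s. h (\<gamma> s) = 0}"
    if h: "real_polynomial_function h" and ne: "h (\<gamma> s0) \<noteq> 0" for h :: "'a \<Rightarrow> real" and s0
  proof -
    have "real_polynomial_function (h \<circ> \<gamma>)"
      by (rule real_polynomial_function_compose[OF \<gamma> h])
    then obtain c m where c: "h \<circ> \<gamma> = (\<lambda>x. \<Sum>i\<le>m. c i * x ^ i)"
      by (auto simp: real_polynomial_function_iff_sum)
    have "\<exists>i\<le>m. c i \<noteq> 0"
    proof (rule ccontr)
      assume "\<not> (\<exists>i\<le>m. c i \<noteq> 0)"
      then have "(h \<circ> \<gamma>) s0 = 0" unfolding c by simp
      with ne show False by simp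
    qed
    then have "finite {x. (\<Sum>i\<le>m. c i * x ^ i) = 0}"
      using Transcendental.polyfun_finite_roots[where n=m and c=c] by blast
    moreover have "h (\<gamma> s) = (\<Sum>i\<le>m. c i * s ^ i)" for s using fun_cong[OF c, of s] by simp
    ultimately show ?thesis by simp
  qed
  have "finite ({s. f (\<gamma> s) = 0} \<union> {s. g (\<gamma> s) = 0})"
    using fin[OF f, of 0] fin[OF g, of 1] u v by (simp add: \<gamma>_def)
  moreover have "{s. f (\<gamma> s) = 0} \<union> {s. g (\<gamma> s) = 0} = UNIV"
    using 0 by auto
  ultimately show False
    using infinite_UNIV_char_0[where 'a=real] by simp
qed

lemma real_polynomial_function_det:
  fixes A :: "'a::real_normed_vector \<Rightarrow> real^'n^'n"
  assumes "\<And>i j. real_polynomial_function (\<lambda>t. A t $ i $ j)"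
  shows "real_polynomial_function (\<lambda>t. det (A t))"
proof -
  have "real_polynomial_function (\<lambda>t. of_int (sign p) * (\<Prod>i\<in>UNIV. A t $ i $ p i))" for p :: "'n \<Rightarrow> 'n"
    by (rule real_polynomial_function.intros(4))
      (simp_all add: real_polynomial_function.intros(2) real_polynomial_function_prod assms)
  then show ?thesis
    unfolding det_def by (simp add: real_polynomial_function_sum finite_permutations)
qed

lemma polynomial_function_linear:
  fixes h :: "'b::euclidean_space \<Rightarrow> 'c::real_normed_vector"
  assumes "linear h" and "polynomial_function f"
  shows "polynomial_function (\<lambda>t. h (f t))"
  using polynomial_function_compose[OF assms(2) polynomial_function_bounded_linear[of h]] assms(1)
  by (simp add: linear_conv_bounded_linear o_def)

lemma real_polynomial_function_linear:
  fixes h :: "'b::euclidean_space \<Rightarrow> real"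
  assumes "linear h" and "polynomial_function f"
  shows "real_polynomial_function (\<lambda>t. h (f t))"
  using polynomial_function_linear[OF assms] by (simp add: real_polynomial_function_eq)

lemma real_polynomial_function_inner:
  fixes f g :: "'a::real_normed_vector \<Rightarrow> 'b::euclidean_space"
  assumes "polynomial_function f" and "polynomial_function g"
  shows "real_polynomial_function (\<lambda>t. f t \<bullet> g t)"
proof -
  have "real_polynomial_function (\<lambda>t. \<Sum>b\<in>Basis. (f t \<bullet> b) * (g t \<bullet> b))"
    using assms unfolding polynomial_function_iff_Basis_inner
    by (intro real_polynomial_function_sum real_polynomial_function.intros(4)) auto
  then show ?thesis by (simp flip: euclidean_inner)
qed

lemma polynomial_function_vec:
  fixes f :: "'a::real_normed_vector \<Rightarrow> 'b::euclidean_space^'n"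
  assumes "\<And>i. polynomial_function (\<lambda>t. f t $ i)"
  shows "polynomial_function f"
  unfolding polynomial_function_iff_Basis_inner
proof
  fix b :: "'b^'n" assume "b \<in> Basis"
  then obtain i c where "b = axis i c" by (auto simp: Basis_vec_def)
  moreover have "real_polynomial_function (\<lambda>t. f t $ i \<bullet> c)"
    by (intro real_polynomial_function_inner assms polynomial_function_const)
  ultimately show "real_polynomial_function (\<lambda>x. f x \<bullet> b)"
    by (simp add: inner_axis)
qed

section \<open>Reflections in a symmetric bilinear form\<close>

text \<open>The reflection in a vector v with respect to the form S, multiplied by the
  value of the form at v; without the denominator it is polynomial in v.\<close>

definition scaled_refl :: "('v::euclidean_space \<Rightarrow> 'v) \<Rightarrow> 'v \<Rightarrow> 'v \<Rightarrow> 'v" where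
  "scaled_refl S v x = (S v \<bullet> v) *\<^sub>R x - (2 * (S v \<bullet> x)) *\<^sub>R v"

definition scaled_refls :: "('v::euclidean_space \<Rightarrow> 'v) \<Rightarrow> 'v list \<Rightarrow> 'v \<Rightarrow> 'v" where
  "scaled_refls S vs = foldr (scaled_refl S) vs"

definition isotropic :: "('v::euclidean_space \<Rightarrow> 'v) \<Rightarrow> 'v set \<Rightarrow> bool" where
  "isotropic S L \<longleftrightarrow> subspace L \<and> (\<forall>x\<in>L. \<forall>y\<in>L. S x \<bullet> y = 0)"

definition anisotropic :: "('v::euclidean_space \<Rightarrow> 'v) \<Rightarrow> 'v list \<Rightarrow> bool" where
  "anisotropic S vs \<longleftrightarrow> (\<forall>v\<in>set vs. S v \<bullet> v \<noteq> 0)"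

lemma anisotropic_simps [simp]:
  "anisotropic S []" "anisotropic S (v # vs) \<longleftrightarrow> S v \<bullet> v \<noteq> 0 \<and> anisotropic S vs"
  "anisotropic S (us @ vs) \<longleftrightarrow> anisotropic S us \<and> anisotropic S vs"
  "anisotropic S (rev vs) \<longleftrightarrow> anisotropic S vs"
  by (auto simp: anisotropic_def)

lemma scaled_refls_simps [simp]:
  "scaled_refls S [] = (\<lambda>x. x)"
  "scaled_refls S (v # vs) x = scaled_refl S v (scaled_refls S vs x)"
  "scaled_refls S (us @ vs) x = scaled_refls S us (scaled_refls S vs x)"
  by (auto simp: scaled_refls_def)

lemma scaled_refls_append_image:
  "scaled_refls S (us @ vs) ` L = scaled_refls S us ` scaled_refls S vs ` L"
  by (simp add: image_image)

lemma isotropicD: "isotropic S L \<Longrightarrow> x \<in> L \<Longrightarrow> y \<in> L \<Longrightarrow> S x \<bullet> y = 0"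
  by (simp add: isotropic_def)

locale symmetric_form =
  fixes S :: "'v::euclidean_space \<Rightarrow> 'v"
  assumes linear: "linear S" and sym: "S x \<bullet> y = S y \<bullet> x"
begin

lemmas S_simps = linear_add[OF linear] linear_diff[OF linear] linear_scale[OF linear]
  inner_simps

lemma linear_scaled_refl: "linear (scaled_refl S v)"
  by (rule linearI) (simp_all add: scaled_refl_def algebra_simps inner_simps)

lemma linear_scaled_refls: "linear (scaled_refls S vs)"
  by (induction vs) (simp_all add: linear_id linear_compose[OF _ linear_scaled_refl, unfolded o_def]
      scaled_refls_def o_def flip: id_def)

lemma scaled_refl_same: "scaled_refl S v v = (- (S v \<bullet> v)) *\<^sub>R v"
  by (simp add: scaled_refl_def algebra_simps flip: scaleR_add_left)

lemma scaled_refl_scaled_refl: "scaled_refl S v (scaled_refl S v x) = (S v \<bullet> v)\<^sup>2 *\<^sub>R x"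
proof -
  have "scaled_refl S v (scaled_refl S v x) =
      (S v \<bullet> v) *\<^sub>R scaled_refl S v x - (2 * (S v \<bullet> x)) *\<^sub>R scaled_refl S v v"
    using linear_scaled_refl[of v]
    by (subst (2) scaled_refl_def) (simp add: linear_diff linear_scale)
  then show ?thesis
    unfolding scaled_refl_same by (simp add: scaled_refl_def algebra_simps power2_eq_square)
qed

lemma form_scaled_refl:
  "S (scaled_refl S v x) \<bullet> scaled_refl S v y = (S v \<bullet> v)\<^sup>2 * (S x \<bullet> y)"
  by (simp add: scaled_refl_def S_simps sym algebra_simps power2_eq_square)

lemma form_scaled_refls:
  assumes "anisotropic S vs"
  shows "\<exists>s. s \<noteq> 0 \<and>
      (\<forall>x y. S (scaled_refls S vs x) \<bullet> scaled_refls S vs y = s * (S x \<bullet> y))"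
  using assms
proof (induction vs)
  case Nil
  show ?case by (intro exI[of _ 1]) simp
next
  case (Cons v vs)
  then obtain s where s: "s \<noteq> 0"
    "\<And>x y. S (scaled_refls S vs x) \<bullet> scaled_refls S vs y = s * (S x \<bullet> y)"
    by auto
  with Cons.prems show ?case
    by (intro exI[of _ "(S v \<bullet> v)\<^sup>2 * s"]) (simp add: form_scaled_refl)
qed

text \<open>Orthogonality survives even an isotropic factor, where the multiplier of the form is
  zero. Hence isotropy can be followed along polynomial paths that cross the null cone.\<close>

lemma form_zero_scaled_refls:
  "S x \<bullet> y = 0 \<Longrightarrow> S (scaled_refls S vs x) \<bullet> scaled_refls S vs y = 0"
  by (induction vs) (auto simp: form_scaled_refl)

lemma isotropic_scaled_refls: "isotropic S L \<Longrightarrow> isotropic S (scaled_refls S vs ` L)"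
  unfolding isotropic_def
  using linear_subspace_image[OF linear_scaled_refls[of vs]] form_zero_scaled_refls by auto

lemma scaled_refl_image_twice:
  assumes "subspace L" and "S v \<bullet> v \<noteq> 0"
  shows "scaled_refl S v ` scaled_refl S v ` L = L"
proof -
  have "scaled_refl S v ` scaled_refl S v ` L = (\<lambda>x. (S v \<bullet> v)\<^sup>2 *\<^sub>R x) ` L"
    by (simp add: image_image scaled_refl_scaled_refl)
  also have "\<dots> = L"
  proof
    show "(\<lambda>x. (S v \<bullet> v)\<^sup>2 *\<^sub>R x) ` L \<subseteq> L"
      using assms(1) by (auto intro: subspace_scale)
    show "L \<subseteq> (\<lambda>x. (S v \<bullet> v)\<^sup>2 *\<^sub>R x) ` L"
    proof
      fix x assume "x \<in> L"
      then show "x \<in> (\<lambda>x. (S v \<bullet> v)\<^sup>2 *\<^sub>R x) ` L"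
        using assms by (intro image_eqI[of _ _ "(1 / (S v \<bullet> v)\<^sup>2) *\<^sub>R x"])
          (auto intro: subspace_scale)
    qed
  qed
  finally show ?thesis .
qed

lemma subspace_scaled_refls: "subspace L \<Longrightarrow> subspace (scaled_refls S vs ` L)"
  by (rule linear_subspace_image[OF linear_scaled_refls])

lemma scaled_refls_image_rev:
  assumes "subspace L" and "anisotropic S vs"
  shows "scaled_refls S (rev vs) ` scaled_refls S vs ` L = L"
  using assms
proof (induction vs)
  case Nil
  then show ?case by simp
next
  case (Cons v vs)
  have "scaled_refls S (rev (v # vs)) ` scaled_refls S (v # vs) ` L
      = scaled_refls S (rev vs) ` scaled_refl S v ` scaled_refl S v ` scaled_refls S vs ` L"
    by (simp add: image_image)
  also have "\<dots> = scaled_refls S (rev vs) ` scaled_refls S vs ` L"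
    using Cons.prems by (simp add: scaled_refl_image_twice subspace_scaled_refls)
  finally show ?case using Cons by simp
qed

lemma inj_scaled_refls:
  assumes "anisotropic S vs"
  shows "inj (scaled_refls S vs)"
proof -
  have "x = 0" if "scaled_refls S vs x = 0" for x
  proof -
    have "scaled_refls S vs ` span {x} = {0}"
    proof -
      have "scaled_refls S vs ` span {x} = span (scaled_refls S vs ` {x})"
        by (rule linear_span_image[OF linear_scaled_refls, symmetric])
      then show ?thesis by (simp add: that)
    qed
    then have "span {x} = {0}"
      using scaled_refls_image_rev[OF subspace_span assms, of "{x}"]
        linear_0[OF linear_scaled_refls[of "rev vs"]] by simp
    then show ?thesis using span_base[of x "{x}"] by auto
  qed
  then show ?thesis
    by (simp add: linear_injective_0[OF linear_scaled_refls])
qed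

lemma dim_scaled_refls:
  assumes "anisotropic S vs"
  shows "dim (scaled_refls S vs ` L) = dim L"
  using dim_image_eq[OF linear_scaled_refls inj_on_subset[OF inj_scaled_refls[OF assms]]] by blast

text \<open>A conjugate of a reflection is the reflection in the image vector, up to a scalar. The
  number of factors is preserved, so parity statements can be moved to another position of the
  subspaces.\<close>

lemma scaled_refls_conjugate:
  assumes "anisotropic S gs" and "anisotropic S us"
  shows "\<exists>ws s. s \<noteq> 0 \<and> length ws = length us \<and> anisotropic S ws \<and>
    (\<forall>x. scaled_refls S ws (scaled_refls S gs x)
           = s *\<^sub>R scaled_refls S gs (scaled_refls S us x))"
proof -
  obtain c where c: "c \<noteq> 0"
    "\<And>x y. S (scaled_refls S gs x) \<bullet> scaled_refls S gs y = c * (S x \<bullet> y)"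
    using form_scaled_refls[OF assms(1)] by blast
  note lin = linear_scaled_refls[of gs]
  have step: "scaled_refl S (scaled_refls S gs u) (scaled_refls S gs x)
      = c *\<^sub>R scaled_refls S gs (scaled_refl S u x)" for u x
    using c(2) by (simp add: scaled_refl_def linear_diff[OF lin] linear_scale[OF lin] algebra_simps)
  have "\<exists>s. s \<noteq> 0 \<and> (\<forall>x. scaled_refls S (map (scaled_refls S gs) us) (scaled_refls S gs x)
           = s *\<^sub>R scaled_refls S gs (scaled_refls S us x))"
  proof (induction us)
    case Nil
    show ?case by (intro exI[of _ 1]) simp
  next
    case (Cons u us)
    then obtain s where "s \<noteq> 0"
      "\<And>x. scaled_refls S (map (scaled_refls S gs) us) (scaled_refls S gs x)
           = s *\<^sub>R scaled_refls S gs (scaled_refls S us x)" by blast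
    then show ?case using c(1)
      by (intro exI[of _ "s * c"]) (simp add: linear_scale[OF linear_scaled_refl] step)
  qed
  then obtain s where s: "s \<noteq> 0"
    "\<And>x. scaled_refls S (map (scaled_refls S gs) us) (scaled_refls S gs x)
           = s *\<^sub>R scaled_refls S gs (scaled_refls S us x)" by blast
  have "anisotropic S (map (scaled_refls S gs) us)"
    using assms(2) c(1) by (auto simp: anisotropic_def c(2))
  then show ?thesis using s by (intro exI[of _ "map (scaled_refls S gs) us"] exI[of _ s]) simp
qed

text \<open>With \<open>S w \<bullet> w = 0\<close> the scaled reflection becomes
  \<open>x \<mapsto> - 2 (S w \<bullet> x) w\<close>, of rank at most one. For frames of at least
  two vectors, full rank of the image thus certifies that all factors are genuine
  reflections.\<close>

lemma scaled_refls_degenerate: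
  assumes "v \<in> set vs" and "S v \<bullet> v = 0"
  shows "\<exists>u. \<forall>x. scaled_refls S vs x \<in> span {u}"
  using assms
proof (induction vs)
  case (Cons w vs)
  show ?case
  proof (cases "S w \<bullet> w = 0")
    case True
    have "scaled_refls S (w # vs) x \<in> span {w}" for x
      by (simp add: scaled_refl_def True span_neg span_scale span_base)
    then show ?thesis by blast
  next
    case False
    with Cons obtain u where "\<And>x. scaled_refls S vs x \<in> span {u}" by auto
    then have "scaled_refls S (w # vs) x \<in> span {scaled_refl S w u}" for x
      using linear_span_image[OF linear_scaled_refl[of w], of "{u}"] by auto
    then show ?thesis by blast
  qed
qed simp

lemma isotropic_insert:
  assumes L: "isotropic S L" and x: "S x \<bullet> x = 0" "\<And>z. z \<in> L \<Longrightarrow> S x \<bullet> z = 0"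
  shows "isotropic S (span (insert x L))"
proof -
  have form0: "S y \<bullet> z = 0" if "y \<in> insert x L" "z \<in> insert x L" for y z
    using that x isotropicD[OF L] by (auto simp: sym[of y x])
  have half: "S y \<bullet> z = 0" if "y \<in> insert x L" "z \<in> span (insert x L)" for y z
    using that(2) by (induction rule: span_induct) (simp_all add: subspace_def inner_simps form0[OF that(1)])
  have "S y \<bullet> z = 0" if y: "y \<in> span (insert x L)" and z: "z \<in> span (insert x L)" for y z
  proof -
    have "S z \<bullet> y = 0"
      using y
    proof (induction rule: span_induct)
      show "subspace {y. S z \<bullet> y = 0}" by (simp add: subspace_def inner_simps)
      show "S z \<bullet> y = 0" if "y \<in> insert x L" for y using half[OF that z] by (simp add: sym)
    qed
    then show ?thesis by (simp add: sym)
  qed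
  then show ?thesis by (simp add: isotropic_def)
qed

text \<open>If \<open>x \<in> L'\<close> and \<open>z \<in> L\<close> are not orthogonal, the reflection in \<open>x - z\<close> fixes
  \<open>L \<inter> L'\<close> and moves \<open>z\<close> to \<open>x\<close>, so it enlarges the intersection.\<close>

lemma isotropic_reachable:
  assumes "isotropic S L" and "isotropic S L'" and "dim L = m" and "dim L' = m"
    and max: "\<And>W. isotropic S W \<Longrightarrow> dim W \<le> m"
  shows "\<exists>vs. anisotropic S vs \<and> length vs \<le> m \<and> scaled_refls S vs ` L = L'"
proof -
  \<comment> \<open>The count is kept against the dimension of the intersection, which every
    reflection enlarges. The bound \<open>length vs \<le> m\<close> is what later allows a fixed
    number of factors.\<close>
  have "\<exists>vs. anisotropic S vs \<and> length vs + dim (L \<inter> L') \<le> m \<and> scaled_refls S vs ` L = L'"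
    using assms(1-4)
  proof (induction "m - dim (L \<inter> L')" arbitrary: L rule: less_induct)
    case less
    have subs: "subspace L" "subspace L'" using less.prems by (auto simp: isotropic_def)
    show ?case
    proof (cases "L' \<subseteq> L")
      case True
      then have "L' = L" using subspace_dim_equal[of L' L] subs less.prems by auto
      then show ?thesis using less.prems by (intro exI[of _ "[]"]) auto
    next
      case False
      then obtain x where x: "x \<in> L'" "x \<notin> L" by blast
      have "\<exists>z\<in>L. S x \<bullet> z \<noteq> 0"
      proof (rule ccontr)
        assume *: "\<not> (\<exists>z\<in>L. S x \<bullet> z \<noteq> 0)"
        have "isotropic S (span (insert x L))"
          using * by (intro isotropic_insert less.prems(1) isotropicD[OF less.prems(2) x(1) x(1)]) auto
        from max[OF this] have "dim (insert x L) \<le> m" by simp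
        then show False using x(2) subs less.prems(3) by (simp add: dim_insert span_eq_iff[THEN iffD2])
      qed
      then obtain z where z: "z \<in> L" "S x \<bullet> z \<noteq> 0" by blast
      define v where "v = x - z"
      have xx: "S x \<bullet> x = 0" "S z \<bullet> z = 0"
        using isotropicD less.prems x z by blast+
      \<comment> \<open>As \<open>x\<close> and \<open>z\<close> are isotropic, only the mixed term
        survives; their non-orthogonality is what makes \<open>v\<close> anisotropic.\<close>
      have vv: "S v \<bullet> v = - 2 * (S x \<bullet> z)"
        unfolding v_def using xx by (simp add: S_simps sym[of z x])
      have vv0: "S v \<bullet> v \<noteq> 0" using z vv by simp
      have vz: "scaled_refl S v z = (S v \<bullet> v) *\<^sub>R x"
        unfolding scaled_refl_def vv using xx
        by (simp add: v_def S_simps algebra_simps)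
      have fixed: "scaled_refl S v y = (S v \<bullet> v) *\<^sub>R y" if "y \<in> L \<inter> L'" for y
        using that isotropicD[OF less.prems(2) x(1)] isotropicD[OF less.prems(1) z(1)]
        by (simp add: scaled_refl_def v_def S_simps)
      define L1 where "L1 = scaled_refl S v ` L"
      have L1: "L1 = scaled_refls S [v] ` L" by (simp add: L1_def)
      have iso1: "isotropic S L1" unfolding L1 by (rule isotropic_scaled_refls[OF less.prems(1)])
      have dim1: "dim L1 = m" unfolding L1 using vv0 less.prems(3) by (simp add: dim_scaled_refls del: scaled_refls_simps)
      have sub1: "subspace L1" using iso1 by (simp add: isotropic_def)
      have mem: "y \<in> L1" if "(S v \<bullet> v) *\<^sub>R y \<in> L1" for y
        using subspace_scale[OF sub1 that, of "1 / (S v \<bullet> v)"] vv0 by simp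
      have "x \<in> L1"
        by (rule mem) (unfold L1_def vz[symmetric], rule imageI, rule z(1))
      moreover have "L \<inter> L' \<subseteq> L1"
      proof
        fix y assume y: "y \<in> L \<inter> L'"
        have "(S v \<bullet> v) *\<^sub>R y \<in> L1"
          unfolding L1_def fixed[OF y, symmetric] using y by blast
        then show "y \<in> L1" by (rule mem)
      qed
      ultimately have "insert x (L \<inter> L') \<subseteq> L1 \<inter> L'" using x by auto
      from dim_subset[OF this] have dims: "dim (L \<inter> L') + 1 \<le> dim (L1 \<inter> L')"
        using x(2) subs by (simp add: dim_insert span_eq_iff[THEN iffD2] subspace_inter)
      have "dim (L1 \<inter> L') \<le> m" using dim_subset[of "L1 \<inter> L'" L'] less.prems by simp
      with dims have "m - dim (L1 \<inter> L') < m - dim (L \<inter> L')" by simp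
      from less.hyps[OF this iso1 less.prems(2) dim1 less.prems(4)]
      obtain vs where vs: "anisotropic S vs" "length vs + dim (L1 \<inter> L') \<le> m"
        "scaled_refls S vs ` L1 = L'" by blast
      then show ?thesis using dims vv0
        by (intro exI[of _ "vs @ [v]"]) (simp add: L1_def image_image)
    qed
  qed
  then show ?thesis using add_leD1 by blast
qed

lemma polynomial_function_scaled_refl:
  fixes V X :: "'a::real_normed_vector \<Rightarrow> 'v"
  assumes "polynomial_function V" and "polynomial_function X"
  shows "polynomial_function (\<lambda>t. scaled_refl S (V t) (X t))"
proof -
  note SV = polynomial_function_linear[OF linear assms(1)]
  have "polynomial_function (\<lambda>t. S (V t) \<bullet> V t)" "polynomial_function (\<lambda>t. 2 * (S (V t) \<bullet> X t))"
    using real_polynomial_function_inner[OF SV assms(1)] real_polynomial_function_inner[OF SV assms(2)]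
    by (auto simp flip: real_polynomial_function_eq)
  from this[THEN polynomial_function_mult] show ?thesis
    unfolding scaled_refl_def using assms by (intro polynomial_function_diff) auto
qed

lemma polynomial_function_scaled_refls:
  fixes X :: "'a::real_normed_vector \<Rightarrow> 'v"
  assumes "\<And>V. V \<in> set Vs \<Longrightarrow> polynomial_function V" and "polynomial_function X"
  shows "polynomial_function (\<lambda>t. scaled_refls S (map (\<lambda>V. V t) Vs) (X t))"
  using assms(1)
  by (induction Vs) (simp_all add: assms(2) polynomial_function_scaled_refl)

end

section \<open>The pencil as a family of symmetric forms\<close>

definition pencil_map ::
    "real^'d \<Rightarrow> real^'c \<Rightarrow> real \<Rightarrow> ('d::finite, 'c::finite) bigspace \<Rightarrow> ('d, 'c) bigspace" where
  "pencil_map a \<alpha> \<mu> z = (- fst z, (\<chi> i. (a $ i - \<mu>) * fst (snd z) $ i),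
     (\<chi> k. - (\<alpha> $ k - \<mu>) * snd (snd z) $ k))"

lemma inner_bigspace:
  "(z :: ('d::finite, 'c::finite) bigspace) \<bullet> z' = fst z * fst z' +
     (\<Sum>i\<in>UNIV. fst (snd z) $ i * fst (snd z') $ i) + (\<Sum>k\<in>UNIV. snd (snd z) $ k * snd (snd z') $ k)"
  by (simp add: inner_prod_def inner_vec_def)

lemma pencil_form:
  "pencil_map a \<alpha> \<mu> z \<bullet> z' = (\<Sum>i\<in>UNIV. (a $ i - \<mu>) * fst (snd z) $ i * fst (snd z') $ i)
     - (\<Sum>k\<in>UNIV. (\<alpha> $ k - \<mu>) * snd (snd z) $ k * snd (snd z') $ k) - fst z * fst z'"
  by (simp add: inner_bigspace pencil_map_def algebra_simps sum_subtractf)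

lemma symmetric_form_pencil: "symmetric_form (pencil_map a \<alpha> \<mu>)"
proof (rule symmetric_form.intro)
  show "Real_Vector_Spaces.linear (pencil_map a \<alpha> \<mu>)"
    by (rule linearI) (auto simp: pencil_map_def vec_eq_iff algebra_simps)
  show "pencil_map a \<alpha> \<mu> x \<bullet> y = pencil_map a \<alpha> \<mu> y \<bullet> x" for x y
    unfolding pencil_form by (simp add: mult.commute mult.left_commute)
qed

interpretation pencil: symmetric_form "pencil_map a \<alpha> \<mu>" for a :: "real^'d" and \<alpha> :: "real^'c" and \<mu>
  by (rule symmetric_form_pencil)

lemma pencil_quadric_iff: "z \<in> pencil_quadric a \<alpha> \<mu> \<longleftrightarrow> pencil_map a \<alpha> \<mu> z \<bullet> z = 0"
  by (cases z) (auto simp: pencil_quadric_def pencil_form power2_eq_square mult.assoc)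

lemma isotropic_pencil_iff:
  assumes "subspace L"
  shows "isotropic (pencil_map a \<alpha> \<mu>) L \<longleftrightarrow> L \<subseteq> pencil_quadric a \<alpha> \<mu>"
proof
  assume L: "L \<subseteq> pencil_quadric a \<alpha> \<mu>"
  have "pencil_map a \<alpha> \<mu> x \<bullet> y = 0" if "x \<in> L" "y \<in> L" for x y
  proof -
    have "x + y \<in> L" using assms that by (rule subspace_add)
    then have "pencil_map a \<alpha> \<mu> x \<bullet> x = 0" "pencil_map a \<alpha> \<mu> y \<bullet> y = 0"
      "pencil_map a \<alpha> \<mu> (x + y) \<bullet> (x + y) = 0"
      using L that by (auto simp: pencil_quadric_iff)
    then show ?thesis by (simp add: pencil.S_simps pencil.sym[of _ _ _ y x])
  qed
  then show "isotropic (pencil_map a \<alpha> \<mu>) L" using assms by (simp add: isotropic_def)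
qed (auto simp: isotropic_def pencil_quadric_iff)

lemma base_locus_subset_pencil: "base_locus a \<alpha> \<subseteq> pencil_quadric a \<alpha> \<mu>"
  by (auto simp: base_locus_def pencil_quadric_def algebra_simps sum_subtractf
      simp flip: sum_distrib_left)

lemma pencil_inter_subset_base_locus:
  assumes "\<mu>1 \<noteq> \<mu>2"
  shows "pencil_quadric a \<alpha> \<mu>1 \<inter> pencil_quadric a \<alpha> \<mu>2 \<subseteq> base_locus a \<alpha>"
proof
  fix z :: "('a, 'b) bigspace"
  assume z: "z \<in> pencil_quadric a \<alpha> \<mu>1 \<inter> pencil_quadric a \<alpha> \<mu>2"
  obtain x0 x y where [simp]: "z = (x0, x, y)" by (cases z)
  define A B C D where "A = (\<Sum>i\<in>UNIV. a $ i * (x $ i)\<^sup>2)" and "B = (\<Sum>i\<in>UNIV. (x $ i)\<^sup>2)"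
    and "C = (\<Sum>k\<in>UNIV. \<alpha> $ k * (y $ k)\<^sup>2)" and "D = (\<Sum>k\<in>UNIV. (y $ k)\<^sup>2)"
  have e: "A - \<mu> * B - (C - \<mu> * D) = x0\<^sup>2" if "z \<in> pencil_quadric a \<alpha> \<mu>" for \<mu>
    using that unfolding A_def B_def C_def D_def
    by (simp add: pencil_quadric_def left_diff_distrib sum_subtractf sum_distrib_left)
  have "(\<mu>1 - \<mu>2) * (B - D) = 0" using e[of \<mu>1] e[of \<mu>2] z by (auto simp: algebra_simps)
  then have "B = D" using assms by simp
  with e[of \<mu>1] z show "z \<in> base_locus a \<alpha>"
    by (auto simp: base_locus_def A_def B_def C_def D_def)
qed

lemma sum_option: "(\<Sum>l\<in>UNIV. F l) = F None + (\<Sum>k\<in>UNIV. F (Some k))"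
  for F :: "'c::finite option \<Rightarrow> real"
  by (simp add: UNIV_option_conv sum.reindex)

lemma prod_option: "(\<Prod>l\<in>UNIV. F l) = F None * (\<Prod>k\<in>UNIV. F (Some k))"
  for F :: "'c::finite option \<Rightarrow> real"
  by (simp add: UNIV_option_conv prod.reindex)

definition frame_lift :: "('c::finite \<Rightarrow> real) \<Rightarrow> ('c \<Rightarrow> real^'d) \<Rightarrow> real^'c \<Rightarrow> ('d::finite, 'c) bigspace" where
  "frame_lift h \<nu> y = ((\<Sum>k\<in>UNIV. y $ k * h k), (\<Sum>k\<in>UNIV. y $ k *\<^sub>R \<nu> k), y)"

text \<open>The bijection \<open>g\<close> lets a family of \<open>d - 1\<close> normals and one further vector be
  arranged as the rows of a square matrix.\<close>

locale confocal =
  fixes a :: "real^'d::finite" and \<alpha> :: "real^'c::finite" and g :: "'d \<Rightarrow> 'c option"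
  assumes bij_g: "bij g" and inj_alpha: "inj (($) \<alpha>)"
    and disjoint: "range (($) a) \<inter> range (($) \<alpha>) = {}"
begin

abbreviation "Sp \<equiv> pencil_map a \<alpha>"
abbreviation lift :: "('c \<Rightarrow> real) \<Rightarrow> ('c \<Rightarrow> real^'d) \<Rightarrow> real^'c \<Rightarrow> ('d, 'c) bigspace" where
  "lift \<equiv> frame_lift"

lemma a_neq_alpha: "a $ i \<noteq> \<alpha> $ k"
  using disjoint by (metis IntI empty_iff rangeI)

lemma alpha_eq_iff: "\<alpha> $ j = \<alpha> $ k \<longleftrightarrow> j = k"
  using inj_alpha by (auto dest: injD)

lemma card_d: "CARD('d) = CARD('c) + 1"
  using bij_betw_same_card[OF bij_g] by simp

lemma two_le_card_d: "2 \<le> CARD('d)"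
  using card_d one_le_card_finite[where 'a='c] by linarith

lemma DIM_bigspace: "DIM(('d, 'c) bigspace) = 2 * CARD('d)"
  by (simp add: card_d)

lemma sum_g: "(\<Sum>j\<in>UNIV. F (g j)) = F None + (\<Sum>k\<in>UNIV. F (Some k))" for F :: "'c option \<Rightarrow> real"
  using sum.reindex_bij_betw[OF bij_g, of F] by (simp add: sum_option)

lemma prod_g: "(\<Prod>j\<in>UNIV. F (g j)) = F None * (\<Prod>k\<in>UNIV. F (Some k))" for F :: "'c option \<Rightarrow> real"
  using prod.reindex_bij_betw[OF bij_g, of F] by (simp add: prod_option)

text \<open>The kernel of the form is at most a line. Changing one diagonal entry gives an injective
  \<open>T\<close> that pairs \<open>W\<close> with \<open>W0\<close> as the form does, so
  \<open>T\<close> maps \<open>W\<close> into the orthogonal complement of \<open>W0\<close> and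
  \<open>dim W + dim W0 \<le> 2 d\<close>. Since \<open>W0\<close> has codimension at most one in
  \<open>W\<close>, \<open>2 dim W \<le> 2 d + 1\<close>, and parity gives \<open>d\<close>.\<close>

lemma isotropic_dim_le:
  assumes \<mu>: "\<mu> \<notin> range (($) a)" and W: "isotropic (Sp \<mu>) W"
  shows "dim W \<le> CARD('d)"
proof -
  \<comment> \<open>The entries of \<open>\<alpha>\<close> are distinct, so at most one of them
    equals \<open>\<mu>\<close>; \<open>k\<close> is its index, or an arbitrary one if there is
    none.\<close>
  obtain k where k: "\<And>j. j \<noteq> k \<Longrightarrow> \<alpha> $ j \<noteq> \<mu>" using alpha_eq_iff by metis
  define e :: "('d, 'c) bigspace" where "e = (0, 0, axis k 1)"
  have ez: "e \<bullet> z = snd (snd z) $ k" for z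
    by (cases z) (simp add: e_def inner_axis')
  have [simp]: "e \<noteq> 0" by (simp add: e_def zero_prod_def axis_eq_0_iff)
  \<comment> \<open>The added term turns the diagonal entry \<open>- (\<alpha> $ k - \<mu>)\<close>
    into 1 and changes nothing else.\<close>
  define T where "T z = Sp \<mu> z + ((1 + \<alpha> $ k - \<mu>) * (e \<bullet> z)) *\<^sub>R e" for z
  have linT: "linear T"
    unfolding T_def
    by (rule linearI) (simp_all add: pencil.S_simps algebra_simps)
  have T0: "z = 0" if "T z = 0" for z
  proof -
    have f: "fst (T z) = - fst z" "fst (snd (T z)) $ i = (a $ i - \<mu>) * fst (snd z) $ i"
      "snd (snd (T z)) $ j = (if j = k then snd (snd z) $ k else - (\<alpha> $ j - \<mu>) * snd (snd z) $ j)" for i j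
      unfolding T_def ez by (auto simp: pencil_map_def e_def axis_def algebra_simps)
    have z1: "fst z = 0" using f(1) that by simp
    have "fst (snd z) $ i = 0" for i using f(2)[of i] that \<mu> by auto
    then have z2: "fst (snd z) = 0" by (simp add: vec_eq_iff)
    have "snd (snd z) $ j = 0" for j using f(3)[of j] f(3)[of k] that k[of j] by (auto split: if_splits)
    then have "snd (snd z) = 0" by (simp add: vec_eq_iff)
    with z1 z2 show ?thesis by (simp add: prod_eq_iff)
  qed
  have injT: "inj T" using T0 by (simp add: linear_injective_0[OF linT])
  define W0 where "W0 = W \<inter> {z. e \<bullet> z = 0}"
  have subs: "subspace W" "subspace W0" "subspace {z. e \<bullet> z = 0}"
    using W by (auto simp: isotropic_def W0_def subspace_inter subspace_hyperplane)
  have "dim {x + y |x y. x \<in> W \<and> y \<in> {z. e \<bullet> z = 0}} + dim W0 = dim W + dim {z. e \<bullet> z = 0}"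
    unfolding W0_def by (rule dim_sums_Int[OF subs(1,3)])
  moreover have "dim {x + y |x y. x \<in> W \<and> y \<in> {z. e \<bullet> z = 0}} \<le> DIM(('d, 'c) bigspace)"
    by (rule dim_subset_UNIV)
  moreover have "dim {z. e \<bullet> z = 0} = DIM(('d, 'c) bigspace) - 1"
    by (rule dim_hyperplane) simp
  ultimately have d0: "dim W \<le> dim W0 + 1" using DIM_positive[where 'a="('d, 'c) bigspace"] by linarith
  have "T w \<bullet> w0 = 0" if "w \<in> W" "w0 \<in> W0" for w w0
    using that isotropicD[OF W] by (simp add: T_def W0_def inner_simps)
  then have "T ` W \<subseteq> {y \<in> UNIV. \<forall>x\<in>W0. orthogonal x y}"
    by (auto simp: orthogonal_def inner_commute)
  then have "dim (T ` W) \<le> dim {y \<in> UNIV. \<forall>x\<in>W0. orthogonal x y}" by (rule dim_subset)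
  also have "\<dots> + dim W0 = DIM(('d, 'c) bigspace)"
    using dim_subspace_orthogonal_to_vectors[OF subs(2) subspace_UNIV subset_UNIV] by simp
  finally have "dim (T ` W) + dim W0 \<le> 2 * CARD('d)" unfolding DIM_bigspace by simp
  moreover have "dim (T ` W) = dim W"
    by (rule dim_image_eq[OF linT inj_on_subset[OF injT]]) simp
  ultimately show ?thesis using d0 by linarith
qed

section \<open>Normal frames of the subspaces in the base locus\<close>

text \<open>Orthogonality of the vectors \<open>(h j, \<nu> j, axis j 1)\<close> for every member of
  the pencil is affine in \<open>\<mu>\<close>; these are its two coefficients. For
  \<open>j = k\<close> they combine to \<open>\<Sum> (a $ i - \<alpha> $ k) (\<nu> k $ i)\<^sup>2 =
  (h k)\<^sup>2\<close>, the tangency of the hyperplane with normal \<open>\<nu> k\<close> and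
  offset \<open>h k\<close> to the caustic \<open>\<alpha> $ k\<close>.\<close>

definition normal_frame :: "('c \<Rightarrow> real) \<Rightarrow> ('c \<Rightarrow> real^'d) \<Rightarrow> bool" where
  "normal_frame h \<nu> \<longleftrightarrow> (\<forall>j k. \<nu> j \<bullet> \<nu> k = (if j = k then 1 else 0) \<and>
     (\<Sum>i\<in>UNIV. a $ i * \<nu> j $ i * \<nu> k $ i) - h j * h k = (if j = k then \<alpha> $ k else 0))"

lemma linear_lift: "linear (lift h \<nu>)"
  by (rule linearI)
    (simp_all add: frame_lift_def algebra_simps sum.distrib sum_distrib_left scaleR_sum_right)

lemma snd_snd_lift [simp]: "snd (snd (lift h \<nu> y)) = y"
  by (simp add: frame_lift_def)

lemma lift_axis: "lift h \<nu> (axis k 1) = (h k, \<nu> k, axis k 1)"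
  by (simp add: frame_lift_def axis_def if_distrib[of "\<lambda>x. x * _"] if_distrib[of "\<lambda>x. x *\<^sub>R _"] cong: if_cong)

lemma lift_sum: "lift h \<nu> y = (\<Sum>k\<in>UNIV. y $ k *\<^sub>R (h k, \<nu> k, axis k 1))"
proof -
  have "y = (\<Sum>k\<in>UNIV. y $ k *\<^sub>R axis k 1)" by (simp add: vec_eq_iff sum_component axis_def if_distrib cong: if_cong)
  then have "lift h \<nu> y = lift h \<nu> (\<Sum>k\<in>UNIV. y $ k *\<^sub>R axis k 1)" by simp
  also have "\<dots> = (\<Sum>k\<in>UNIV. y $ k *\<^sub>R lift h \<nu> (axis k 1))"
    by (simp add: linear_sum[OF linear_lift] linear_scale[OF linear_lift])
  finally show ?thesis by (simp add: lift_axis)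
qed

lemma subspace_range_lift: "subspace (range (lift h \<nu>))"
  by (simp add: linear_lift linear_subspace_image)

lemma dim_range_lift: "dim (range (lift h \<nu>)) = CARD('c)"
proof -
  have "inj (lift h \<nu>)" by (metis injI snd_snd_lift)
  then have "dim (range (lift h \<nu>)) = dim (UNIV :: (real^'c) set)"
    by (intro dim_image_eq[OF linear_lift]) (rule inj_on_subset, auto)
  then show ?thesis by simp
qed

lemma form_axis:
  "Sp \<mu> (h j, \<nu> j, axis j 1) \<bullet> (h k, \<nu> k, axis k 1) =
     (\<Sum>i\<in>UNIV. a $ i * \<nu> j $ i * \<nu> k $ i) - \<mu> * (\<nu> j \<bullet> \<nu> k) - h j * h k - (if j = k then \<alpha> $ k - \<mu> else 0)"
  by (simp add: pencil_form inner_vec_def left_diff_distrib sum_subtractf sum_distrib_left mult.assoc)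
    (simp add: axis_def if_distrib[of "\<lambda>x. x * _"] if_distrib[of "\<lambda>x. _ * x"] cong: if_cong)

lemma form_normal_frame:
  assumes "normal_frame h \<nu>"
  shows "Sp \<mu> (h j, \<nu> j, axis j 1) \<bullet> (h k, \<nu> k, axis k 1) = 0"
  using assms by (simp add: form_axis normal_frame_def)

lemma form_lift:
  assumes "normal_frame h \<nu>"
  shows "Sp \<mu> (lift h \<nu> y) \<bullet> lift h \<nu> y' = 0"
  unfolding lift_sum
  by (simp add: linear_sum[OF pencil.linear] linear_scale[OF pencil.linear] inner_sum_left inner_sum_right
      form_normal_frame[OF assms] del: scaleR_Pair)

lemma range_lift_in_FV:
  assumes "normal_frame h \<nu>"
  shows "range (lift h \<nu>) \<in> FV a \<alpha>"
proof -
  have "lift h \<nu> y \<in> base_locus a \<alpha>" for y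
    using pencil_inter_subset_base_locus[of 0 1 a \<alpha>] form_lift[OF assms]
    by (auto simp: pencil_quadric_iff)
  then show ?thesis
    unfolding FV_def using subspace_range_lift dim_range_lift card_d by auto
qed

text \<open>Real positivity: \<open>y = 0\<close> forces \<open>x = 0\<close> in the first equation
  and then \<open>x\<^sub>0 = 0\<close> in the second. Subspaces of the base locus are therefore
  graphs over subspaces of the \<open>y\<close>-space.\<close>

lemma base_locus_y_zero:
  assumes "z \<in> base_locus a \<alpha>" and "snd (snd z) = 0"
  shows "z = 0"
proof -
  obtain x0 x y where z: "z = (x0, x, y)" by (cases z)
  have "(\<Sum>i\<in>UNIV. (x $ i)\<^sup>2) = 0" "(\<Sum>i\<in>UNIV. a $ i * (x $ i)\<^sup>2) = x0\<^sup>2"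
    using assms by (auto simp: z base_locus_def)
  then show ?thesis using assms(2)
    by (auto simp: z sum_nonneg_eq_0_iff vec_eq_iff zero_prod_def)
qed

lemma inj_on_base_locus:
  assumes "subspace M" and "M \<subseteq> base_locus a \<alpha>"
  shows "inj_on (\<lambda>z :: ('d, 'c) bigspace. snd (snd z)) M"
proof (rule inj_onI)
  fix x z assume "x \<in> M" "z \<in> M" "snd (snd x) = snd (snd z)"
  then have "x - z \<in> base_locus a \<alpha>" "snd (snd (x - z)) = 0"
    using assms subspace_diff by auto
  then show "x = z" using base_locus_y_zero[of "x - z"] by simp
qed

lemma dim_in_base_locus:
  assumes "subspace (M :: ('d, 'c) bigspace set)" and "M \<subseteq> base_locus a \<alpha>"
  shows "dim M \<le> CARD('c)"
proof -
  have lin: "Real_Vector_Spaces.linear (\<lambda>z :: ('d, 'c) bigspace. snd (snd z))" by (rule linearI) simp_all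
  have "dim M = dim ((\<lambda>z. snd (snd z)) ` M)"
    using dim_image_eq[OF lin, of M] inj_on_base_locus[OF assms] assms(1)
    by (simp add: span_eq_iff[THEN iffD2])
  also have "\<dots> \<le> CARD('c)"
    using dim_subset_UNIV[of "(\<lambda>z. snd (snd z)) ` M"] by simp
  finally show ?thesis .
qed

lemma FV_normal_frame:
  assumes "M \<in> FV a \<alpha>"
  shows "\<exists>h \<nu>. normal_frame h \<nu> \<and> M = range (lift h \<nu>)"
proof -
  have M: "subspace M" "dim M = CARD('c)" "M \<subseteq> base_locus a \<alpha>"
    using assms card_d by (auto simp: FV_def)
  define Y :: "('d, 'c) bigspace \<Rightarrow> real^'c" where "Y = (\<lambda>z. snd (snd z))"
  have linY: "linear Y" by (rule linearI) (simp_all add: Y_def)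
  have injY: "inj_on Y M" unfolding Y_def by (rule inj_on_base_locus[OF M(1,3)])
  have "dim (Y ` M) = CARD('c)"
    using dim_image_eq[OF linY, of M] injY M by (simp add: span_eq_iff[THEN iffD2])
  then have "Y ` M = UNIV"
    using subspace_dim_equal[of "Y ` M" UNIV] linear_subspace_image[OF linY M(1)] by auto
  then have "\<forall>k. \<exists>m. m \<in> M \<and> Y m = axis k 1" by (metis UNIV_I imageE)
  then obtain m where "\<forall>k. m k \<in> M \<and> Y (m k) = axis k 1" by (rule choice[THEN exE])
  then have m: "\<And>k. m k \<in> M" "\<And>k. Y (m k) = axis k 1" by auto
  define h \<nu> where "h k = fst (m k)" and "\<nu> k = fst (snd (m k))" for k
  have m_eq: "m k = (h k, \<nu> k, axis k 1)" for k
    using m(2)[of k] by (simp add: h_def \<nu>_def Y_def prod_eq_iff)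
  have lift_M: "lift h \<nu> y \<in> M" for y
    unfolding lift_sum m_eq[symmetric] by (intro subspace_sum subspace_scale M(1) m)
  have "z = lift h \<nu> (Y z)" if "z \<in> M" for z
    by (rule inj_onD[OF injY _ that lift_M]) (simp add: Y_def)
  then have M_eq: "M = range (lift h \<nu>)" using lift_M by auto
  have iso: "isotropic (Sp \<mu>) M" for \<mu>
    using isotropic_pencil_iff[OF M(1)] M(3) base_locus_subset_pencil by blast
  have e: "(\<Sum>i\<in>UNIV. a $ i * \<nu> j $ i * \<nu> k $ i) - \<mu> * (\<nu> j \<bullet> \<nu> k) - h j * h k = (if j = k then \<alpha> $ k - \<mu> else 0)"
    for j k \<mu>
    using isotropicD[OF iso m(1)[of j] m(1)[of k], of \<mu>]
    by (simp add: m_eq form_axis)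
  \<comment> \<open>The identity \<open>e\<close> is affine in \<open>\<mu>\<close>, so its values
    at 0 and 1 yield both coefficients.\<close>
  have "normal_frame h \<nu>"
    unfolding normal_frame_def
  proof (intro allI)
    fix j k
    show "\<nu> j \<bullet> \<nu> k = (if j = k then 1 else 0) \<and>
       (\<Sum>i\<in>UNIV. a $ i * \<nu> j $ i * \<nu> k $ i) - h j * h k = (if j = k then \<alpha> $ k else 0)"
      using e[of j k 0] e[of j k 1] by (auto split: if_splits)
  qed
  with M_eq show ?thesis by blast
qed

section \<open>Minors of frames\<close>

definition xmat :: "('d \<Rightarrow> ('d, 'c) bigspace) \<Rightarrow> real^'d^'d" where
  "xmat b = (\<chi> i. fst (snd (b i)))"

text \<open>The form is a diagonal form in \<open>x\<close> minus a diagonal form in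
  \<open>(x\<^sub>0, y)\<close>. Grouping \<open>x\<^sub>0\<close> with \<open>y\<close> makes both
  blocks square; \<open>g\<close> arranges the columns.\<close>

definition ymat :: "('d \<Rightarrow> ('d, 'c) bigspace) \<Rightarrow> real^'d^'d" where
  "ymat b = (\<chi> i j. case g j of None \<Rightarrow> fst (b i) | Some k \<Rightarrow> snd (snd (b i)) $ k)"

definition xdet :: "('d \<Rightarrow> ('d, 'c) bigspace) \<Rightarrow> real" where "xdet b = det (xmat b)"
definition ydet :: "('d \<Rightarrow> ('d, 'c) bigspace) \<Rightarrow> real" where "ydet b = det (ymat b)"

text \<open>Isotropy says that the two diagonal forms have the same Gram matrix on the frame. Taking
  determinants leaves at most two values, opposite to each other, for the ratio of the
  minors.\<close>

lemma isotropic_minors: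
  assumes "\<And>i j. Sp \<mu> (b i) \<bullet> b j = 0"
  shows "(\<Prod>i\<in>UNIV. a $ i - \<mu>) * (xdet b)\<^sup>2 = (\<Prod>k\<in>UNIV. \<alpha> $ k - \<mu>) * (ydet b)\<^sup>2"
proof -
  define w where "w l = (case l of None \<Rightarrow> 1 | Some k \<Rightarrow> \<alpha> $ k - \<mu>)" for l :: "'c option"
  define DX :: "real^'d^'d" where "DX = (\<chi> i j. if i = j then a $ i - \<mu> else 0)"
  define DY :: "real^'d^'d" where "DY = (\<chi> i j. if i = j then w (g i) else 0)"
  have "xmat b ** DX ** transpose (xmat b) = ymat b ** DY ** transpose (ymat b)"
  proof -
    have "(xmat b ** DX ** transpose (xmat b)) $ i $ j = (ymat b ** DY ** transpose (ymat b)) $ i $ j" for i j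
    proof -
      have "(xmat b ** DX ** transpose (xmat b)) $ i $ j =
          (\<Sum>l\<in>UNIV. (a $ l - \<mu>) * fst (snd (b i)) $ l * fst (snd (b j)) $ l)"
        by (simp add: matrix_matrix_mult_def transpose_def xmat_def DX_def if_distrib mult_ac cong: if_cong)
      also have "\<dots> = (\<Sum>k\<in>UNIV. (\<alpha> $ k - \<mu>) * snd (snd (b i)) $ k * snd (snd (b j)) $ k) + fst (b i) * fst (b j)"
        using assms[of i j] by (simp add: pencil_form)
      also have "\<dots> = (\<Sum>l\<in>UNIV. (\<lambda>q. w q * (case q of None \<Rightarrow> fst (b i) | Some k \<Rightarrow> snd (snd (b i)) $ k)
          * (case q of None \<Rightarrow> fst (b j) | Some k \<Rightarrow> snd (snd (b j)) $ k)) (g l))"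
        by (subst sum_g) (simp add: w_def)
      also have "\<dots> = (ymat b ** DY ** transpose (ymat b)) $ i $ j"
        by (simp add: matrix_matrix_mult_def transpose_def ymat_def DY_def if_distrib mult_ac cong: if_cong)
      finally show ?thesis .
    qed
    then show ?thesis by (simp add: vec_eq_iff)
  qed
  then have "det (xmat b ** DX ** transpose (xmat b)) = det (ymat b ** DY ** transpose (ymat b))" by simp
  then have "det DX * (xdet b)\<^sup>2 = det DY * (ydet b)\<^sup>2"
    by (simp add: det_mul power2_eq_square mult_ac xdet_def ydet_def)
  moreover have "det DX = (\<Prod>i\<in>UNIV. a $ i - \<mu>)"
    by (subst det_diagonal) (auto simp: DX_def)
  moreover have "det DY = (\<Prod>i\<in>UNIV. w (g i))"
    by (subst det_diagonal) (auto simp: DY_def)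
  moreover have "\<dots> = (\<Prod>k\<in>UNIV. \<alpha> $ k - \<mu>)"
    by (subst prod_g) (simp add: w_def)
  ultimately show ?thesis by simp
qed

lemma change_of_frame:
  fixes b b' :: "'d \<Rightarrow> ('d, 'c) bigspace"
  assumes "range b \<subseteq> span (range b')"
  shows "\<exists>C :: real^'d^'d. \<forall>i. b i = (\<Sum>j\<in>UNIV. C $ i $ j *\<^sub>R b' j)"
proof -
  have "\<exists>c. b i = (\<Sum>j\<in>UNIV. c j *\<^sub>R b' j)" for i
  proof -
    have "b i \<in> span (range b')" using assms by auto
    then show ?thesis
    proof (induction rule: span_induct_alt)
      case base
      show ?case by (intro exI[of _ "\<lambda>_. 0"]) simp
    next
      case (step r x y)
      then obtain j0 c where "x = b' j0" "y = (\<Sum>j\<in>UNIV. c j *\<^sub>R b' j)" by blast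
      then show ?case
        by (intro exI[of _ "\<lambda>j. (if j = j0 then r else 0) + c j"])
          (simp add: scaleR_add_left sum.distrib if_distrib[of "\<lambda>x. x *\<^sub>R _"] cong: if_cong)
    qed
  qed
  then obtain c where "\<And>i. b i = (\<Sum>j\<in>UNIV. c i j *\<^sub>R b' j)" by metis
  then show ?thesis by (intro exI[of _ "\<chi> i j. c i j"]) simp
qed

text \<open>Both minors acquire the same factor, so their ratio depends on the subspace
  alone.\<close>

lemma minors_change_of_frame:
  assumes "\<And>i. b i = (\<Sum>j\<in>UNIV. (C :: real^'d^'d) $ i $ j *\<^sub>R b' j)"
  shows "xdet b = det C * xdet b'" and "ydet b = det C * ydet b'"
proof -
  have "xmat b = C ** xmat b'"
    by (simp add: vec_eq_iff xmat_def matrix_matrix_mult_def assms fst_sum snd_sum)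
  then show "xdet b = det C * xdet b'" by (simp add: xdet_def det_mul)
  have "ymat b = C ** ymat b'"
    by (simp add: vec_eq_iff ymat_def matrix_matrix_mult_def assms fst_sum snd_sum split: option.split)
  then show "ydet b = det C * ydet b'" by (simp add: ydet_def det_mul)
qed

lemma polynomial_xdet:
  assumes "\<And>i. polynomial_function (\<lambda>t. B t i)"
  shows "real_polynomial_function (\<lambda>t. xdet (B t))"
  unfolding xdet_def
proof (rule real_polynomial_function_det)
  fix i j
  have "Real_Vector_Spaces.linear (\<lambda>z :: ('d, 'c) bigspace. fst (snd z) $ j)"
    by (rule linearI) simp_all
  from real_polynomial_function_linear[OF this assms]
  show "real_polynomial_function (\<lambda>t. xmat (B t) $ i $ j)" by (simp add: xmat_def)
qed

lemma polynomial_ydet: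
  assumes "\<And>i. polynomial_function (\<lambda>t. B t i)"
  shows "real_polynomial_function (\<lambda>t. ydet (B t))"
  unfolding ydet_def
proof (rule real_polynomial_function_det)
  fix i j
  have "Real_Vector_Spaces.linear (\<lambda>z :: ('d, 'c) bigspace. case g j of None \<Rightarrow> fst z | Some k \<Rightarrow> snd (snd z) $ k)"
    by (rule linearI) (simp_all split: option.split)
  from real_polynomial_function_linear[OF this assms]
  show "real_polynomial_function (\<lambda>t. ymat (B t) $ i $ j)" by (simp add: ymat_def)
qed

lemma full_rank_if_det_nonzero:
  fixes \<phi> :: "('d, 'c) bigspace \<Rightarrow> real^'d"
  assumes lin: "Real_Vector_Spaces.linear \<phi>" and det: "det (\<chi> i. \<phi> (b i)) \<noteq> 0"
  shows "dim (span (range b)) = CARD('d)"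
proof -
  define A :: "real^'d^'d" where "A = (\<chi> i. \<phi> (b i))"
  obtain A' where inv: "A' ** A = mat 1"
    using det by (auto simp: A_def[symmetric] invertible_def simp flip: invertible_det_nz)
  have "v \<in> \<phi> ` span (range b)" for v
  proof -
    define c where "c = v v* A'"
    have "v = c v* A" by (simp add: c_def vector_matrix_mul_assoc inv)
    also have "\<dots> = \<phi> (\<Sum>i\<in>UNIV. c $ i *\<^sub>R b i)"
      by (simp add: vec_eq_iff vector_matrix_mult_def linear_sum[OF lin] linear_scale[OF lin]
          sum_component A_def mult.commute)
    finally show ?thesis by (intro image_eqI) (auto intro: span_sum span_scale span_base)
  qed
  then have "\<phi> ` span (range b) = UNIV" by auto
  then have "CARD('d) \<le> dim (span (range b))"
    using dim_image_le[OF lin, of "span (range b)"] by simp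
  moreover have "dim (span (range b)) \<le> CARD('d)"
    using dim_le_card[of "span (range b)" "range b"] card_image_le[of UNIV b] by simp
  ultimately show ?thesis by simp
qed

lemma minors_rank_deficient:
  assumes "dim (span (range b)) \<noteq> CARD('d)"
  shows "xdet b = 0" and "ydet b = 0"
proof -
  have "Real_Vector_Spaces.linear (\<lambda>z :: ('d, 'c) bigspace. fst (snd z))"
    by (rule linearI) simp_all
  from full_rank_if_det_nonzero[OF this, of b] assms show "xdet b = 0"
    by (auto simp: xdet_def xmat_def)
  have "Real_Vector_Spaces.linear (\<lambda>z :: ('d, 'c) bigspace. \<chi> j. case g j of None \<Rightarrow> fst z | Some k \<Rightarrow> snd (snd z) $ k)"
    by (rule linearI) (simp_all add: vec_eq_iff split: option.split)
  from full_rank_if_det_nonzero[OF this, of b] assms show "ydet b = 0"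
    by (auto simp: ydet_def ymat_def)
qed

lemma frame_exists:
  assumes "subspace (L :: ('d, 'c) bigspace set)" and "dim L = CARD('d)"
  shows "\<exists>b :: 'd \<Rightarrow> ('d, 'c) bigspace. span (range b) = L"
proof -
  obtain B where B: "B \<subseteq> L" "independent B" "L \<subseteq> span B" "card B = dim L"
    using basis_exists by blast
  then have "finite B" by (simp add: independent_imp_finite)
  then obtain b where b: "bij_betw b (UNIV :: 'd set) B"
    using B assms(2) by (metis finite_same_card_bij finite_code)
  then have "span (range b) = L"
    using B assms(1) by (simp add: bij_betw_def span_subspace)
  then show ?thesis by blast
qed

section \<open>Parity of products of reflections\<close>

text \<open>A common base point for deforming reflecting vectors: anisotropic for every
  \<open>\<mu>\<close> outside the \<open>a $ i\<close>, with a diagonal reflection.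
  \<open>undefined\<close> merely selects a fixed coordinate.\<close>

definition unit_x :: "('d, 'c) bigspace" where
  "unit_x = (0, axis undefined 1, 0)"

lemma form_unit_x: "Sp \<mu> unit_x \<bullet> z = (a $ undefined - \<mu>) * fst (snd z) $ undefined"
  by (simp add: pencil_form unit_x_def axis_def if_distrib[of "\<lambda>x. x * _"] if_distrib[of "\<lambda>x. _ * x"] cong: if_cong)

lemma unit_x_anisotropic:
  assumes "\<mu> \<notin> range (($) a)"
  shows "Sp \<mu> unit_x \<bullet> unit_x \<noteq> 0"
  using assms by (auto simp: form_unit_x) (simp add: unit_x_def)

lemma anisotropic_replicate:
  assumes "\<mu> \<notin> range (($) a)"
  shows "anisotropic (Sp \<mu>) (replicate m unit_x)"
  using unit_x_anisotropic[OF assms] by (auto simp: anisotropic_def)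

text \<open>The origin of the sign: all coordinates are scaled by \<open>q\<close> except one
  \<open>x\<close>-coordinate, which is scaled by \<open>- q\<close>. This affects one column of
  \<open>xmat\<close> and none of \<open>ymat\<close>.\<close>

lemma minors_refl_unit_x:
  fixes b :: "'d \<Rightarrow> ('d, 'c) bigspace" and \<mu> :: real
  defines "q \<equiv> Sp \<mu> unit_x \<bullet> unit_x"
  shows "xdet (\<lambda>i. scaled_refl (Sp \<mu>) unit_x (b i)) = - (q ^ CARD('d)) * xdet b"
    and "ydet (\<lambda>i. scaled_refl (Sp \<mu>) unit_x (b i)) = q ^ CARD('d) * ydet b"
proof -
  let ?i = "undefined :: 'd"
  have q: "q = a $ ?i - \<mu>" by (simp add: q_def form_unit_x) (simp add: unit_x_def)
  have refl: "scaled_refl (Sp \<mu>) unit_x z =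
      (q * fst z, \<chi> j. (if j = ?i then - q else q) * fst (snd z) $ j, q *\<^sub>R snd (snd z))" for z
  proof -
    have "scaled_refl (Sp \<mu>) unit_x z = q *\<^sub>R z - (2 * (q * fst (snd z) $ ?i)) *\<^sub>R unit_x"
      unfolding scaled_refl_def q_def[symmetric] by (simp add: form_unit_x q)
    then show ?thesis by (cases z) (simp add: unit_x_def axis_def vec_eq_iff)
  qed
  define DX :: "real^'d^'d" where "DX = (\<chi> i j. if i = j then (if j = ?i then - 1 else 1) * q else 0)"
  define DY :: "real^'d^'d" where "DY = (\<chi> i j. if i = j then q else 0)"
  have "xmat (\<lambda>i. scaled_refl (Sp \<mu>) unit_x (b i)) = xmat b ** DX"
    by (auto simp: vec_eq_iff xmat_def DX_def matrix_matrix_mult_def refl if_distrib[of "\<lambda>x. _ * x"] cong: if_cong)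
  moreover have "det DX = (\<Prod>j\<in>UNIV. (if j = ?i then - 1 else 1) * q)"
    by (subst det_diagonal) (auto simp: DX_def)
  moreover have "\<dots> = - (q ^ CARD('d))"
    by (simp add: prod.distrib)
  ultimately show "xdet (\<lambda>i. scaled_refl (Sp \<mu>) unit_x (b i)) = - (q ^ CARD('d)) * xdet b"
    by (simp add: xdet_def det_mul)
  have "ymat (\<lambda>i. scaled_refl (Sp \<mu>) unit_x (b i)) = ymat b ** DY"
    by (auto simp: vec_eq_iff ymat_def DY_def matrix_matrix_mult_def refl if_distrib[of "\<lambda>x. _ * x"]
        cong: if_cong split: option.split)
  moreover have "det DY = q ^ CARD('d)"
    by (subst det_diagonal) (auto simp: DY_def)
  ultimately show "ydet (\<lambda>i. scaled_refl (Sp \<mu>) unit_x (b i)) = q ^ CARD('d) * ydet b"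
    by (simp add: ydet_def det_mul)
qed

lemma minors_refls_unit_x:
  assumes "\<mu> \<notin> range (($) a)"
  obtains c where "c \<noteq> 0"
    and "\<And>b. xdet (\<lambda>i. scaled_refls (Sp \<mu>) (replicate m unit_x) (b i)) = (- 1) ^ m * c * xdet b"
    and "\<And>b. ydet (\<lambda>i. scaled_refls (Sp \<mu>) (replicate m unit_x) (b i)) = c * ydet b"
proof -
  define q where "q = Sp \<mu> unit_x \<bullet> unit_x"
  have "q \<noteq> 0" unfolding q_def by (rule unit_x_anisotropic[OF assms])
  have "xdet (\<lambda>i. scaled_refls (Sp \<mu>) (replicate m unit_x) (b i)) = (- 1) ^ m * (q ^ CARD('d)) ^ m * xdet b
      \<and> ydet (\<lambda>i. scaled_refls (Sp \<mu>) (replicate m unit_x) (b i)) = (q ^ CARD('d)) ^ m * ydet b" for b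
    by (induction m) (simp_all add: minors_refl_unit_x q_def)
  with \<open>q \<noteq> 0\<close> show ?thesis by (intro that[of "(q ^ CARD('d)) ^ m"]) auto
qed

definition refl_path :: "('d, 'c) bigspace list \<Rightarrow> real \<Rightarrow> ('d, 'c) bigspace list" where
  "refl_path vs s = map (\<lambda>v. unit_x + s *\<^sub>R (v - unit_x)) vs"

lemma refl_path_0: "refl_path vs 0 = replicate (length vs) unit_x"
  by (simp add: refl_path_def map_replicate_const)

lemma refl_path_1: "refl_path vs 1 = vs"
  by (simp add: refl_path_def)

lemma polynomial_refl_path: "polynomial_function (\<lambda>s. scaled_refls (Sp \<mu>) (refl_path vs s) x)"
proof -
  have "refl_path vs s = map (\<lambda>V. V s) (map (\<lambda>v s. unit_x + s *\<^sub>R (v - unit_x)) vs)" for s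
    by (simp add: refl_path_def)
  moreover have "polynomial_function (\<lambda>s. scaled_refls (Sp \<mu>) (map (\<lambda>V. V s) (map (\<lambda>v s. unit_x + s *\<^sub>R (v - unit_x)) vs)) x)"
    by (intro pencil.polynomial_function_scaled_refls) (auto intro!: polynomial_function_mult)
  ultimately show ?thesis by simp
qed

lemma prod_a_nonzero: "\<mu> \<notin> range (($) a) \<Longrightarrow> (\<Prod>i\<in>UNIV. a $ i - \<mu>) \<noteq> 0"
  by auto

text \<open>All factors are deformed simultaneously into \<open>unit_x\<close>, where the sign is visible;
  along the deformation one of two polynomials with product zero must vanish identically.\<close>

lemma minors_parity:
  fixes b :: "'d \<Rightarrow> ('d, 'c) bigspace"
  assumes \<mu>: "\<mu> \<notin> range (($) a)" and iso: "\<And>i j. Sp \<mu> (b i) \<bullet> b j = 0"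
    and r: "xdet b = r * ydet b" and nz: "xdet b \<noteq> 0"
  shows "xdet (\<lambda>i. scaled_refls (Sp \<mu>) vs (b i))
     = (- 1) ^ length vs * r * ydet (\<lambda>i. scaled_refls (Sp \<mu>) vs (b i))"
proof -
  let ?X = "\<lambda>s. xdet (\<lambda>i. scaled_refls (Sp \<mu>) (refl_path vs s) (b i))"
  let ?Y = "\<lambda>s. ydet (\<lambda>i. scaled_refls (Sp \<mu>) (refl_path vs s) (b i))"
  define \<epsilon> :: real where "\<epsilon> = (- 1) ^ length vs"
  have \<epsilon>: "\<epsilon> * \<epsilon> = 1" by (simp add: \<epsilon>_def flip: power_mult_distrib)
  define A where "A = (\<Prod>i\<in>UNIV. a $ i - \<mu>)"
  have A: "A \<noteq> 0" unfolding A_def by (rule prod_a_nonzero[OF \<mu>])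
  \<comment> \<open>Both products depend on \<open>\<mu>\<close> only, so one frame with nonzero
    minors determines the square of the ratio for all isotropic frames.\<close>
  have "(\<Prod>k\<in>UNIV. \<alpha> $ k - \<mu>) = A * r\<^sup>2"
    using isotropic_minors[of \<mu> b, OF iso] r nz by (simp add: A_def power_mult_distrib)
  then have sq: "(xdet b')\<^sup>2 = r\<^sup>2 * (ydet b')\<^sup>2" if "\<And>i j. Sp \<mu> (b' i) \<bullet> b' j = 0" for b'
    using isotropic_minors[of \<mu> b', OF that] A by (simp add: A_def)
  obtain c where c: "c \<noteq> 0" "?X 0 = \<epsilon> * c * xdet b" "?Y 0 = c * ydet b"
    unfolding refl_path_0 \<epsilon>_def using minors_refls_unit_x[OF \<mu>] by metis
  \<comment> \<open>At parameter 0 every factor is \<open>unit_x\<close> and the ratio is known to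
    be \<open>\<epsilon> * r\<close>. The polynomial with the wrong sign is nonzero there, so the
    other one vanishes identically, in particular at 1.\<close>
  have "?X 1 - \<epsilon> * r * ?Y 1 = 0"
  proof (rule real_polynomial_function_zero_product[where f = "\<lambda>s. ?X s + \<epsilon> * r * ?Y s"
        and g = "\<lambda>s. ?X s - \<epsilon> * r * ?Y s" and u = 0])
    show "real_polynomial_function (\<lambda>s. ?X s + \<epsilon> * r * ?Y s)"
      "real_polynomial_function (\<lambda>s. ?X s - \<epsilon> * r * ?Y s)"
      by (auto intro!: real_polynomial_function.intros(2-4) real_polynomial_function_diff
          polynomial_xdet polynomial_ydet polynomial_refl_path)
    show "(?X s + \<epsilon> * r * ?Y s) * (?X s - \<epsilon> * r * ?Y s) = 0" for s
    proof -
      have "(?X s)\<^sup>2 = r\<^sup>2 * (?Y s)\<^sup>2"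
        by (rule sq) (simp add: pencil.form_zero_scaled_refls iso)
      then show ?thesis using \<epsilon> by (simp add: power2_eq_square algebra_simps)
    qed
    have "?X 0 + \<epsilon> * r * ?Y 0 = 2 * \<epsilon> * c * xdet b" using c(2,3) r by simp
    then show "?X 0 + \<epsilon> * r * ?Y 0 \<noteq> 0" using c(1) nz \<epsilon> by auto
  qed
  then show ?thesis by (simp add: refl_path_1 \<epsilon>_def)
qed

lemma xdet_nonzero_of_same_span:
  assumes "span (range b) = span (range b')" and "xdet b \<noteq> 0"
  shows "xdet b' \<noteq> 0"
proof -
  have "range b \<subseteq> span (range b')"
    unfolding assms(1)[symmetric] by (rule span_superset)
  then obtain C where "\<And>i. b i = (\<Sum>j\<in>UNIV. (C :: real^'d^'d) $ i $ j *\<^sub>R b' j)"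
    using change_of_frame by blast
  from minors_change_of_frame(1)[OF this] assms(2) show ?thesis by auto
qed

lemma span_scaled_refls:
  "span (range (\<lambda>i. scaled_refls (Sp \<mu>) vs (b i))) = scaled_refls (Sp \<mu>) vs ` span (range b)"
  using linear_span_image[OF pencil.linear_scaled_refls, of a \<alpha> \<mu> vs "range b"]
  by (simp add: image_image)

lemma anisotropic_if_xdet_nonzero:
  assumes "xdet (\<lambda>i. scaled_refls (Sp \<mu>) vs (b i)) \<noteq> 0"
  shows "anisotropic (Sp \<mu>) vs"
  unfolding anisotropic_def
proof (intro ballI notI)
  fix v assume "v \<in> set vs" "Sp \<mu> v \<bullet> v = 0"
  then obtain u where u: "\<And>x. scaled_refls (Sp \<mu>) vs x \<in> span {u}"
    using pencil.scaled_refls_degenerate by blast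
  have "dim (span (range (\<lambda>i. scaled_refls (Sp \<mu>) vs (b i)))) \<le> dim (span {u})"
    by (intro dim_subset span_minimal subspace_span image_subsetI u)
  also have "\<dots> \<le> 1" by simp
  finally have "dim (span (range (\<lambda>i. scaled_refls (Sp \<mu>) vs (b i)))) \<noteq> CARD('d)"
    using two_le_card_d by linarith
  from minors_rank_deficient(1)[OF this] assms show False by simp
qed

lemma reach:
  assumes "\<mu> \<notin> range (($) a)" and "isotropic (Sp \<mu>) L" and "isotropic (Sp \<mu>) L'"
    and "dim L = CARD('d)" and "dim L' = CARD('d)"
  shows "\<exists>vs. anisotropic (Sp \<mu>) vs \<and> length vs \<le> CARD('d) \<and> scaled_refls (Sp \<mu>) vs ` L = L'"
  by (rule pencil.isotropic_reachable[OF assms(2-5) isotropic_dim_le[OF assms(1)]])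

text \<open>The nondegenerate frame \<open>b1\<close> is used twice: \<open>ws\<close> carries the
  span of \<open>b\<close> onto its span, and \<open>vs\<close> does the same for the frame that
  \<open>ws\<close> makes of \<open>b'\<close>. Along \<open>refl_path vs\<close> the minor of the
  first frame is nonzero at 0 and that of the second at 1, so at some parameter neither
  vanishes.\<close>

lemma generic_refls:
  fixes b b' :: "'d \<Rightarrow> ('d, 'c) bigspace"
  assumes \<mu>: "\<mu> \<notin> range (($) a)"
    and iso: "isotropic (Sp \<mu>) (span (range b))" "isotropic (Sp \<mu>) (span (range b'))"
    and dims: "dim (span (range b)) = CARD('d)" "dim (span (range b')) = CARD('d)"
    and iso1: "isotropic (Sp \<mu>) (span (range b1))" and nz: "xdet b1 \<noteq> 0"
  shows "\<exists>gs. anisotropic (Sp \<mu>) gs \<and>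
    xdet (\<lambda>i. scaled_refls (Sp \<mu>) gs (b i)) \<noteq> 0 \<and>
    xdet (\<lambda>i. scaled_refls (Sp \<mu>) gs (b' i)) \<noteq> 0"
proof -
  have dim1: "dim (span (range b1)) = CARD('d)"
    using minors_rank_deficient(1) nz by blast
  obtain ws where ws: "anisotropic (Sp \<mu>) ws"
    "scaled_refls (Sp \<mu>) ws ` span (range b) = span (range b1)"
    using reach[OF \<mu> iso(1) iso1 dims(1) dim1] by metis
  define c c' where "c = (\<lambda>i. scaled_refls (Sp \<mu>) ws (b i))"
    and "c' = (\<lambda>i. scaled_refls (Sp \<mu>) ws (b' i))"
  have c_nz: "xdet c \<noteq> 0"
    by (rule xdet_nonzero_of_same_span[OF _ nz]) (simp add: c_def span_scaled_refls ws)
  have "isotropic (Sp \<mu>) (span (range c'))" "dim (span (range c')) = CARD('d)"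
    unfolding c'_def span_scaled_refls
    using iso(2) dims(2) ws(1) by (auto intro: pencil.isotropic_scaled_refls simp: pencil.dim_scaled_refls)
  then obtain vs where vs: "scaled_refls (Sp \<mu>) vs ` span (range c') = span (range b1)"
    using reach[OF \<mu> _ iso1 _ dim1] by metis
  have vs_nz: "xdet (\<lambda>i. scaled_refls (Sp \<mu>) vs (c' i)) \<noteq> 0"
    by (rule xdet_nonzero_of_same_span[OF _ nz]) (simp add: span_scaled_refls vs)
  have "\<exists>s. xdet (\<lambda>i. scaled_refls (Sp \<mu>) (refl_path vs s) (c i)) *
            xdet (\<lambda>i. scaled_refls (Sp \<mu>) (refl_path vs s) (c' i)) \<noteq> 0"
  proof (rule ccontr)
    assume *: "\<not> ?thesis"
    obtain k where "k \<noteq> 0" "xdet (\<lambda>i. scaled_refls (Sp \<mu>) (refl_path vs 0) (c i)) = (- 1) ^ length vs * k * xdet c"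
      unfolding refl_path_0 using minors_refls_unit_x[OF \<mu>] by metis
    then have "xdet (\<lambda>i. scaled_refls (Sp \<mu>) (refl_path vs 0) (c i)) \<noteq> 0" using c_nz by simp
    then have "xdet (\<lambda>i. scaled_refls (Sp \<mu>) (refl_path vs 1) (c' i)) = 0"
      by (rule real_polynomial_function_zero_product[rotated 3])
        (use * in \<open>auto intro!: polynomial_xdet polynomial_refl_path\<close>)
    with vs_nz show False by (simp add: refl_path_1)
  qed
  then obtain s where s: "xdet (\<lambda>i. scaled_refls (Sp \<mu>) (refl_path vs s @ ws) (b i)) \<noteq> 0"
    "xdet (\<lambda>i. scaled_refls (Sp \<mu>) (refl_path vs s @ ws) (b' i)) \<noteq> 0"
    by (auto simp: c_def c'_def)
  from anisotropic_if_xdet_nonzero[OF s(1)] s show ?thesis by blast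
qed

text \<open>In the parameters of the family, \<open>(X - r * Y) * (X + r * Y)\<close> vanishes
  identically. Hence one factor does, and by Zariski density it vanishes on all of \<open>F\<close>;
  the frame \<open>b\<close> decides which one. An odd number of reflections would lead to the
  opposite ratio.\<close>

lemma unirational_parity:
  fixes L :: "('d, 'c) bigspace set"
  assumes \<mu>: "\<mu> \<notin> range (($) a)" "\<mu> \<notin> range (($) \<alpha>)"
    and iso1: "isotropic (Sp \<mu>) (span (range b1))" and nz: "xdet b1 \<noteq> 0"
    and F: "unirational_family F" "\<forall>L\<in>F. L \<subseteq> pencil_quadric a \<alpha> \<mu>"
    and L: "L \<in> F" "scaled_refls (Sp \<mu>) us ` L \<in> F" and us: "anisotropic (Sp \<mu>) us"
  shows "even (length us)"
proof (rule ccontr)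
  assume odd: "odd (length us)"
  have isoF: "isotropic (Sp \<mu>) L" "dim L = CARD('d)" if "L \<in> F" for L
    using F that by (auto simp: unirational_family_def isotropic_pencil_iff)
  obtain b :: "'d \<Rightarrow> ('d, 'c) bigspace" where b: "span (range b) = L"
    using frame_exists isoF[OF L(1)] by (metis isotropic_def)
  define b' where "b' = (\<lambda>i. scaled_refls (Sp \<mu>) us (b i))"
  have b': "span (range b') = scaled_refls (Sp \<mu>) us ` L"
    by (simp add: b'_def span_scaled_refls b)
  \<comment> \<open>The minors of \<open>L\<close> and of its image may both vanish; they are taken
    only after a common change of position.\<close>
  obtain gs where gs: "anisotropic (Sp \<mu>) gs" "xdet (\<lambda>i. scaled_refls (Sp \<mu>) gs (b i)) \<noteq> 0"
    "xdet (\<lambda>i. scaled_refls (Sp \<mu>) gs (b' i)) \<noteq> 0"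
    using generic_refls[OF \<mu>(1), of b b' b1] isoF[OF L(1)] isoF[OF L(2)] iso1 nz b b' by metis
  define X Y where "X \<beta> = xdet (\<lambda>i. scaled_refls (Sp \<mu>) gs (\<beta> $ i))"
    and "Y \<beta> = ydet (\<lambda>i. scaled_refls (Sp \<mu>) gs (\<beta> $ i))" for \<beta> :: "(('d, 'c) bigspace)^'d"
  define A where "A = (\<Prod>i\<in>UNIV. a $ i - \<mu>)"
  define A' where "A' = (\<Prod>i\<in>UNIV. \<alpha> $ i - \<mu>)"
  have A: "A \<noteq> 0" "A' \<noteq> 0" unfolding A_def A'_def using \<mu> by auto
  have minors: "A * (X \<beta>)\<^sup>2 = A' * (Y \<beta>)\<^sup>2" if "frame_span \<beta> \<in> F" for \<beta>
    unfolding A_def A'_def X_def Y_def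
    by (intro isotropic_minors pencil.form_zero_scaled_refls isotropicD[OF isoF(1)[OF that]])
      (auto simp: frame_span_def span_base)
  define r where "r = X (vec_lambda b) / Y (vec_lambda b)"
  have fs: "frame_span (vec_lambda b) = L" "frame_span (vec_lambda b') = scaled_refls (Sp \<mu>) us ` L"
    by (simp_all add: frame_span_def b b')
  have XY: "X (vec_lambda b) \<noteq> 0" "X (vec_lambda b') \<noteq> 0" "Y (vec_lambda b) \<noteq> 0"
    "X (vec_lambda b) = r * Y (vec_lambda b)"
    using minors[of "vec_lambda b"] A fs gs(2,3) L by (auto simp: r_def X_def)
  have r2: "A * r\<^sup>2 = A'"
    using minors[of "vec_lambda b"] XY fs L by (simp add: power_mult_distrib)
  have "X (vec_lambda b') = - r * Y (vec_lambda b')"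
  proof -
    obtain ws s where ws: "s \<noteq> 0" "length ws = length us"
      "\<And>x. scaled_refls (Sp \<mu>) ws (scaled_refls (Sp \<mu>) gs x) = s *\<^sub>R scaled_refls (Sp \<mu>) gs (scaled_refls (Sp \<mu>) us x)"
      using pencil.scaled_refls_conjugate[OF gs(1) us] by metis
    \<comment> \<open>Applying \<open>us\<close> before \<open>gs\<close> amounts, up to the scalar
      \<open>s\<close>, to applying \<open>ws\<close> of the same length after \<open>gs\<close>. On
      frames the scalar acts as the matrix \<open>D\<close>.\<close>
    define D :: "real^'d^'d" where "D = mat s"
    have D: "det D \<noteq> 0" unfolding D_def mat_def using ws(1) by (subst det_diagonal) auto
    have eq: "scaled_refls (Sp \<mu>) ws (scaled_refls (Sp \<mu>) gs (b i))
        = (\<Sum>j\<in>UNIV. D $ i $ j *\<^sub>R scaled_refls (Sp \<mu>) gs (b' j))" for i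
      by (simp add: ws(3) D_def mat_def b'_def if_distrib[of "\<lambda>x. x *\<^sub>R _"] cong: if_cong)
    have "xdet (\<lambda>i. scaled_refls (Sp \<mu>) ws (scaled_refls (Sp \<mu>) gs (b i)))
      = (- 1) ^ length ws * r * ydet (\<lambda>i. scaled_refls (Sp \<mu>) ws (scaled_refls (Sp \<mu>) gs (b i)))"
    proof (rule minors_parity[OF \<mu>(1)])
      show "Sp \<mu> (scaled_refls (Sp \<mu>) gs (b i)) \<bullet> scaled_refls (Sp \<mu>) gs (b j) = 0" for i j
        by (intro pencil.form_zero_scaled_refls isotropicD[OF isoF(1)[OF L(1)]])
          (auto simp: b[symmetric] span_base)
    qed (use XY in \<open>simp_all add: X_def Y_def\<close>)
    then have "det D * X (vec_lambda b') = - r * (det D * Y (vec_lambda b'))"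
      using minors_change_of_frame[of "\<lambda>i. scaled_refls (Sp \<mu>) ws (scaled_refls (Sp \<mu>) gs (b i))" D, OF eq]
        odd ws(2) by (simp add: X_def Y_def)
    then have "det D * X (vec_lambda b') = det D * (- r * Y (vec_lambda b'))" by (simp only: mult_ac)
    then show ?thesis using mult_left_cancel[OF D] by blast
  qed
  moreover have "X (vec_lambda b') = r * Y (vec_lambda b')"
  proof -
    obtain B :: "(('d, 'c) bigspace)^'d \<Rightarrow> (('d, 'c) bigspace)^'d" where
      B: "polynomial_function B" "\<forall>t. dim (frame_span (B t)) = CARD('d) \<longrightarrow> frame_span (B t) \<in> F"
      and dense: "\<forall>f. real_polynomial_function f \<longrightarrow>
             (\<forall>b t. dim (frame_span (B t)) = CARD('d) \<and> frame_span b = frame_span (B t)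
                      \<longrightarrow> f b = 0) \<longrightarrow>
             (\<forall>b. frame_span b \<in> F \<longrightarrow> f b = 0)"
      using F(1) unfolding unirational_family_def by (elim conjE exE) (rule that)
    have "polynomial_function (\<lambda>\<beta> :: (('d, 'c) bigspace)^'d. scaled_refls (Sp \<mu>) gs (\<beta> $ i))" for i
      by (rule polynomial_function_linear[OF pencil.linear_scaled_refls
            polynomial_function_bounded_linear[OF bounded_linear_vec_nth]])
    then have polX: "real_polynomial_function X" "real_polynomial_function Y"
      unfolding X_def Y_def by (simp_all add: polynomial_xdet polynomial_ydet)
    have polB: "real_polynomial_function (\<lambda>t. X (B t))" "real_polynomial_function (\<lambda>t. Y (B t))"
      using real_polynomial_function_compose[OF B(1)] polX by (auto simp: o_def)
    have prod0: "(X (B t) - r * Y (B t)) * (X (B t) + r * Y (B t)) = 0" for t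
    proof (cases "dim (frame_span (B t)) = CARD('d)")
      case True
      from minors[OF B(2)[rule_format, OF True]] r2 A show ?thesis
        by (auto simp: algebra_simps power2_eq_square)
    next
      case False
      \<comment> \<open>Where the parametrization drops rank, \<open>frame_span (B t)\<close> is not
        a member of the family, but then both minors are zero.\<close>
      have "dim (span (range (\<lambda>i. scaled_refls (Sp \<mu>) gs (B t $ i)))) \<noteq> CARD('d)"
        using False gs(1) by (simp add: span_scaled_refls pencil.dim_scaled_refls frame_span_def)
      then show ?thesis
        by (simp add: X_def Y_def minors_rank_deficient)
    qed
    \<comment> \<open>Density refers to all bases of the subspaces in the image; a change of basis
      multiplies the expression by a determinant, so its vanishing is inherited.\<close>
    have vanish: "X \<beta> + \<epsilon> * r * Y \<beta> = 0"
      if *: "\<And>t. X (B t) + \<epsilon> * r * Y (B t) = 0" and "frame_span \<beta> \<in> F" for \<epsilon> \<beta>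
    proof (rule dense[rule_format, OF _ _ that(2)])
      show "real_polynomial_function (\<lambda>\<beta>. X \<beta> + \<epsilon> * r * Y \<beta>)"
        using polX by (intro real_polynomial_function.intros(2-4))
      fix c t assume "dim (frame_span (B t)) = CARD('d) \<and> frame_span c = frame_span (B t)"
      then have "span (range (($) c)) = span (range (($) (B t)))"
        by (simp add: frame_span_def)
      then have "range (($) c) \<subseteq> span (range (($) (B t)))"
        using span_superset[of "range (($) c)"] by simp
      then obtain C where C: "\<And>i. c $ i = (\<Sum>j\<in>UNIV. (C :: real^'d^'d) $ i $ j *\<^sub>R B t $ j)"
        using change_of_frame by blast
      have "scaled_refls (Sp \<mu>) gs (c $ i) = (\<Sum>j\<in>UNIV. C $ i $ j *\<^sub>R scaled_refls (Sp \<mu>) gs (B t $ j))" for i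
        unfolding C by (simp add: linear_sum[OF pencil.linear_scaled_refls] linear_scale[OF pencil.linear_scaled_refls])
      from minors_change_of_frame[of "\<lambda>i. scaled_refls (Sp \<mu>) gs (c $ i)" C, OF this]
      have "X c + \<epsilon> * r * Y c = det C * (X (B t) + \<epsilon> * r * Y (B t))"
        by (simp add: X_def Y_def algebra_simps)
      then show "X c + \<epsilon> * r * Y c = 0" by (simp add: *)
    qed
    have "\<forall>t. X (B t) - r * Y (B t) = 0"
    proof (rule ccontr)
      assume "\<not> ?thesis"
      then obtain u where u: "X (B u) - r * Y (B u) \<noteq> 0" by blast
      have "X (B t) + r * Y (B t) = 0" for t
        by (rule real_polynomial_function_zero_product[where f = "\<lambda>t. X (B t) - r * Y (B t)"
              and g = "\<lambda>t. X (B t) + r * Y (B t)", OF _ _ prod0 u])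
          (auto intro!: real_polynomial_function.intros(2-4) real_polynomial_function_diff polB)
      then have "X (vec_lambda b) + r * Y (vec_lambda b) = 0"
        using vanish[of 1 "vec_lambda b"] fs L by simp
      with XY show False by auto
    qed
    then show ?thesis using vanish[of "-1" "vec_lambda b'"] fs L by simp
  qed
  ultimately show False using XY(2) by auto
qed

section \<open>Construction of rulings\<close>

text \<open>The fixed number of factors makes the family the image of one polynomial map in
  \<open>d\<close> vectors, which is exactly the parameter space prescribed for unirational
  families.\<close>

definition refl_ruling :: "real \<Rightarrow> ('d, 'c) bigspace set \<Rightarrow> ('d, 'c) bigspace set set" where
  "refl_ruling \<mu> L = {scaled_refls (Sp \<mu>) vs ` L | vs. anisotropic (Sp \<mu>) vs \<and> length vs = CARD('d)}"

lemma refl_ruling_isotropic: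
  assumes "isotropic (Sp \<mu>) L" and "dim L = CARD('d)" and "L' \<in> refl_ruling \<mu> L"
  shows "isotropic (Sp \<mu>) L'" and "dim L' = CARD('d)"
  using assms by (auto simp: refl_ruling_def pencil.dim_scaled_refls intro: pencil.isotropic_scaled_refls)

text \<open>The frame \<open>B t\<close> applies the scaled reflections in the components of
  \<open>t\<close> to a basis of \<open>L\<close>. Full rank excludes isotropic components and every
  member is attained, so the density condition holds because the parametrization is onto.\<close>

lemma refl_ruling_unirational:
  assumes iso: "isotropic (Sp \<mu>) L" and dim: "dim L = CARD('d)" and \<mu>: "\<mu> \<notin> range (($) a)"
  shows "unirational_family (refl_ruling \<mu> L)"
proof -
  have sub: "subspace L" using iso by (simp add: isotropic_def)
  obtain b :: "'d \<Rightarrow> ('d, 'c) bigspace" where b: "span (range b) = L" using frame_exists[OF sub dim] by blast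
  obtain ks :: "'d list" where ks: "set ks = UNIV" "distinct ks"
    using finite_distinct_list[OF finite[of UNIV]] by blast
  then have len: "length ks = CARD('d)" by (metis distinct_card)
  define B :: "(('d, 'c) bigspace)^'d \<Rightarrow> (('d, 'c) bigspace)^'d" where
    "B t = (\<chi> i. scaled_refls (Sp \<mu>) (map (($) t) ks) (b i))" for t
  have fsB: "frame_span (B t) = scaled_refls (Sp \<mu>) (map (($) t) ks) ` L" for t
    by (simp add: frame_span_def B_def span_scaled_refls b)
  have "polynomial_function B"
  proof (rule polynomial_function_vec)
    fix i
    have "map (($) t) ks = map (\<lambda>V. V t) (map (\<lambda>k t. t $ k) ks)" for t :: "(('d, 'c) bigspace)^'d"
      by simp
    moreover have "polynomial_function (\<lambda>t :: (('d, 'c) bigspace)^'d. scaled_refls (Sp \<mu>) (map (\<lambda>V. V t) (map (\<lambda>k t. t $ k) ks)) (b i))"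
      by (intro pencil.polynomial_function_scaled_refls)
        (auto intro: polynomial_function_bounded_linear bounded_linear_vec_nth)
    ultimately show "polynomial_function (\<lambda>t. B t $ i)" by (simp add: B_def o_def)
  qed
  moreover have full: "frame_span (B t) \<in> refl_ruling \<mu> L" if "dim (frame_span (B t)) = CARD('d)" for t
  proof -
    have "anisotropic (Sp \<mu>) (map (($) t) ks)"
      unfolding anisotropic_def
    proof (intro ballI notI)
      fix v assume "v \<in> set (map (($) t) ks)" "Sp \<mu> v \<bullet> v = 0"
      then obtain u where "\<And>x. scaled_refls (Sp \<mu>) (map (($) t) ks) x \<in> span {u}"
        using pencil.scaled_refls_degenerate by blast
      then have "dim (frame_span (B t)) \<le> dim (span {u})"
        unfolding fsB by (intro dim_subset) auto
      also have "\<dots> \<le> 1" by simp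
      finally show False using that two_le_card_d by linarith
    qed
    then show ?thesis unfolding fsB refl_ruling_def using len by auto
  qed
  moreover have surj: "\<exists>t. dim (frame_span (B t)) = CARD('d) \<and> frame_span (B t) = L'"
    if "L' \<in> refl_ruling \<mu> L" for L'
  proof -
    obtain vs where vs: "anisotropic (Sp \<mu>) vs" "length vs = CARD('d)" "L' = scaled_refls (Sp \<mu>) vs ` L"
      using \<open>L' \<in> _\<close> by (auto simp: refl_ruling_def)
    define t :: "(('d, 'c) bigspace)^'d" where "t = (\<chi> k. the (map_of (zip ks vs) k))"
    have "map (($) t) ks = vs"
      using ks len vs(2) by (intro nth_equalityI) (simp_all add: t_def map_of_zip_nth)
    then have "frame_span (B t) = L'" by (simp add: fsB vs)
    moreover have "dim L' = CARD('d)" using refl_ruling_isotropic[OF iso dim that] by simp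
    ultimately show ?thesis by auto
  qed
  moreover have "\<exists>t. dim (frame_span (B t)) = CARD('d)"
  proof -
    have "scaled_refls (Sp \<mu>) (replicate CARD('d) unit_x) ` L \<in> refl_ruling \<mu> L"
      unfolding refl_ruling_def using anisotropic_replicate[OF \<mu>] by auto
    then show ?thesis using surj by blast
  qed
  moreover have "\<forall>L'\<in>refl_ruling \<mu> L. subspace L' \<and> dim L' = CARD('d)"
    using refl_ruling_isotropic[OF iso dim] by (auto simp: isotropic_def)
  ultimately show ?thesis
    unfolding unirational_family_def by (intro conjI exI[of _ B]) (auto, metis)
qed

lemma refl_ruling_subset:
  assumes "isotropic (Sp \<mu>) L" and "dim L = CARD('d)" and "L' \<in> refl_ruling \<mu> L"
  shows "L' \<subseteq> pencil_quadric a \<alpha> \<mu>"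
  using refl_ruling_isotropic[OF assms] isotropic_pencil_iff isotropic_def by blast

lemma scaled_refls_replicate_even:
  assumes "subspace L" and "Sp \<mu> v \<bullet> v \<noteq> 0"
  shows "scaled_refls (Sp \<mu>) (replicate (2 * m) v) ` L = L"
proof (induction m)
  case (Suc m)
  have "scaled_refls (Sp \<mu>) (replicate (2 * Suc m) v) ` L
      = scaled_refl (Sp \<mu>) v ` scaled_refl (Sp \<mu>) v ` scaled_refls (Sp \<mu>) (replicate (2 * m) v) ` L"
    by (simp add: image_image)
  then show ?case by (simp add: Suc.IH pencil.scaled_refl_image_twice[OF assms])
qed simp

text \<open>A pair of equal reflections acts trivially on subspaces, so a product that is too short
  by an even number can be filled up to \<open>d\<close> factors.\<close>

lemma refl_ruling_pad:
  assumes "subspace L" and \<mu>: "\<mu> \<notin> range (($) a)" and vs: "anisotropic (Sp \<mu>) vs" "length vs \<le> CARD('d)"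
    and even: "even (length vs + CARD('d))"
  shows "scaled_refls (Sp \<mu>) vs ` L \<in> refl_ruling \<mu> L"
proof -
  from even vs(2) have "even (CARD('d) - length vs)" by presburger
  then obtain m where m: "CARD('d) - length vs = 2 * m" by blast
  have "scaled_refls (Sp \<mu>) (vs @ replicate (2 * m) unit_x) ` L = scaled_refls (Sp \<mu>) vs ` L"
    unfolding scaled_refls_append_image
    by (simp only: scaled_refls_replicate_even[OF assms(1) unit_x_anisotropic[OF \<mu>]])
  moreover have "scaled_refls (Sp \<mu>) (vs @ replicate (2 * m) unit_x) ` L \<in> refl_ruling \<mu> L"
    unfolding refl_ruling_def using vs m anisotropic_replicate[OF \<mu>]
    by (intro CollectI exI[of _ "vs @ replicate (2 * m) unit_x"]) auto
  ultimately show ?thesis by simp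
qed

text \<open>For maximality, a larger unirational family also contains \<open>L\<close>, and
  \<open>unirational_parity\<close> confines it to subspaces an even number of reflections away from
  \<open>L\<close>. All of these already lie in \<open>refl_ruling\<close>.\<close>

lemma ruling_nondegenerate:
  assumes \<mu>: "\<mu> \<notin> range (($) a)" "\<mu> \<notin> range (($) \<alpha>)"
    and iso1: "isotropic (Sp \<mu>) (span (range b1))" and nz: "xdet b1 \<noteq> 0"
    and L: "isotropic (Sp \<mu>) L" "dim L = CARD('d)"
  obtains R where "ruling (pencil_quadric a \<alpha> \<mu>) R"
    and "\<And>us. anisotropic (Sp \<mu>) us \<Longrightarrow> even (length us) \<Longrightarrow> scaled_refls (Sp \<mu>) us ` L \<in> R"
proof -
  note parity = unirational_parity[OF \<mu> iso1 nz]
  define es where "es = replicate CARD('d) (unit_x :: ('d, 'c) bigspace)"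
  have es: "anisotropic (Sp \<mu>) es" "length es = CARD('d)" "rev es = es"
    unfolding es_def using anisotropic_replicate[OF \<mu>(1)] by auto
  \<comment> \<open>The base point is placed \<open>d\<close> reflections away from
    \<open>L\<close>, so that \<open>L\<close> itself arises from it by exactly \<open>d\<close>
    factors, whatever the parity of \<open>d\<close>.\<close>
  define L0 where "L0 = scaled_refls (Sp \<mu>) es ` L"
  have sub: "subspace L" using L by (simp add: isotropic_def)
  have L_eq: "L = scaled_refls (Sp \<mu>) es ` L0"
    using pencil.scaled_refls_image_rev[OF sub es(1)] by (simp add: L0_def es)
  have L0: "isotropic (Sp \<mu>) L0" "dim L0 = CARD('d)"
    unfolding L0_def using L es by (auto intro: pencil.isotropic_scaled_refls simp: pencil.dim_scaled_refls)
  have sub0: "subspace L0" using L0 by (simp add: isotropic_def)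
  define R where "R = refl_ruling \<mu> L0"
  have uni: "unirational_family R" unfolding R_def by (rule refl_ruling_unirational[OF L0 \<mu>(1)])
  have RQ: "\<forall>L\<in>R. L \<subseteq> pencil_quadric a \<alpha> \<mu>"
    unfolding R_def using refl_ruling_subset[OF L0] by blast
  have L_in: "L \<in> R" unfolding R_def refl_ruling_def using es L_eq by blast
  have key: "L' \<in> R" if R': "unirational_family R'" "\<forall>L\<in>R'. L \<subseteq> pencil_quadric a \<alpha> \<mu>" "L \<in> R'"
    and L': "L' = scaled_refls (Sp \<mu>) us ` L" "anisotropic (Sp \<mu>) us" "L' \<in> R' \<or> L \<in> R' \<and> even (length us)" for R' L' us
  proof -
    have iso': "isotropic (Sp \<mu>) L'" "dim L' = CARD('d)"
      using L L' by (auto intro: pencil.isotropic_scaled_refls simp: pencil.dim_scaled_refls)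
    obtain vs where vs: "anisotropic (Sp \<mu>) vs" "length vs \<le> CARD('d)" "scaled_refls (Sp \<mu>) vs ` L0 = L'"
      using reach[OF \<mu>(1) L0(1) iso'(1) L0(2) iso'(2)] by blast
    have ev: "even (length us)" using L'(3) parity[OF R' _ L'(2)] L'(1) by auto
    \<comment> \<open>From \<open>L\<close> to \<open>L0\<close>, on to \<open>L'\<close> by
      \<open>vs\<close>, and back to \<open>L\<close>: this closed path has even length, which fixes
      the parity of \<open>vs\<close>.\<close>
    have "scaled_refls (Sp \<mu>) (rev us @ vs @ es) ` L = scaled_refls (Sp \<mu>) (rev us) ` scaled_refls (Sp \<mu>) us ` L"
      unfolding scaled_refls_append_image by (simp only: L0_def[symmetric] vs(3) L'(1))
    also have "\<dots> = L" by (rule pencil.scaled_refls_image_rev[OF sub L'(2)])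
    finally have "even (length (rev us @ vs @ es))"
      using L'(2) vs(1) es(1) R'(3) by (intro parity[OF R']) auto
    then have "even (length vs + CARD('d))" using ev es(2) by simp
    from refl_ruling_pad[OF sub0 \<mu>(1) vs(1,2) this] show ?thesis by (simp add: R_def vs(3))
  qed
  have "R' = R" if R': "unirational_family R'" "\<forall>L\<in>R'. L \<subseteq> pencil_quadric a \<alpha> \<mu>" "R \<subseteq> R'" for R'
  proof
    show "R' \<subseteq> R"
    proof
      fix L' assume "L' \<in> R'"
      then have iso': "isotropic (Sp \<mu>) L'" "dim L' = CARD('d)"
        using R' by (auto simp: unirational_family_def isotropic_pencil_iff)
      obtain us where "anisotropic (Sp \<mu>) us" "scaled_refls (Sp \<mu>) us ` L = L'"
        using reach[OF \<mu>(1) L(1) iso'(1) L(2) iso'(2)] by blast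
      then show "L' \<in> R" using key[OF R'(1,2)] L_in R'(3) \<open>L' \<in> R'\<close> by blast
    qed
  qed (rule that)
  then have "ruling (pencil_quadric a \<alpha> \<mu>) R" using uni RQ by (auto simp: ruling_def)
  moreover have "scaled_refls (Sp \<mu>) us ` L \<in> R" if "anisotropic (Sp \<mu>) us" "even (length us)" for us
    by (rule key[OF uni RQ L_in refl that(1)]) (use L_in that in auto)
  ultimately show ?thesis by (rule that)
qed

lemma pencil_map_axis: "Sp (\<alpha> $ k) (0, 0, axis k 1) = 0"
  by (auto simp: pencil_map_def vec_eq_iff axis_def zero_prod_def)

text \<open>Adjoining a kernel vector keeps a subspace isotropic, and dimension \<open>d\<close> is
  maximal.\<close>

lemma kernel_in_isotropic:
  assumes \<mu>: "\<alpha> $ k \<notin> range (($) a)" and L: "isotropic (Sp (\<alpha> $ k)) L" "dim L = CARD('d)"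
  shows "(0, 0, axis k 1) \<in> L"
proof (rule ccontr)
  let ?e = "(0, 0, axis k 1) :: ('d, 'c) bigspace"
  assume n: "?e \<notin> L"
  have sub: "subspace L" using L by (simp add: isotropic_def)
  have "isotropic (Sp (\<alpha> $ k)) (span (insert ?e L))"
    by (intro pencil.isotropic_insert[OF L(1)]) (simp_all add: pencil_map_axis)
  from isotropic_dim_le[OF \<mu> this] show False
    using n sub L by (simp add: dim_insert span_eq_iff[THEN iffD2])
qed

text \<open>Parity is lost because the reflection in some anisotropic \<open>v\<close> fixes
  \<open>L0\<close>. Since \<open>L0\<close> contains the kernel, its polar space \<open>P\<close>
  has dimension at least \<open>d + 1\<close>, so \<open>P\<close> is not isotropic and contains
  such a \<open>v\<close>. Padding with \<open>v\<close> reaches every maximal isotropic subspace by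
  exactly \<open>d\<close> factors.\<close>

lemma ruling_degenerate:
  assumes \<mu>: "\<alpha> $ k \<notin> range (($) a)" and L0: "isotropic (Sp (\<alpha> $ k)) L0" "dim L0 = CARD('d)"
  obtains R where "ruling (pencil_quadric a \<alpha> (\<alpha> $ k)) R"
    and "\<And>L. isotropic (Sp (\<alpha> $ k)) L \<Longrightarrow> dim L = CARD('d) \<Longrightarrow> L \<in> R"
proof -
  let ?S = "Sp (\<alpha> $ k)" and ?e = "(0, 0, axis k 1) :: ('d, 'c) bigspace"
  have sub: "subspace L0" using L0 by (simp add: isotropic_def)
  define P where "P = {z. \<forall>x\<in>?S ` L0. orthogonal x z}"
  have subP: "subspace P" unfolding P_def by (rule subspace_orthogonal_to_vectors)
  have e0: "?e \<noteq> 0" by (simp add: zero_prod_def axis_eq_0_iff)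
  have "dim (?S ` L0) + 1 \<le> CARD('d)"
  proof -
    \<comment> \<open>A complement of the kernel in \<open>L0\<close>, of dimension
      \<open>d - 1\<close> and with the same image under the form.\<close>
    define L1 where "L1 = {y \<in> L0. \<forall>x\<in>span {?e}. orthogonal x y}"
    have e_in: "?e \<in> L0" by (rule kernel_in_isotropic[OF \<mu> L0])
    have "?S ` L0 \<subseteq> ?S ` L1"
    proof
      fix w assume "w \<in> ?S ` L0"
      then obtain x where x: "x \<in> L0" "w = ?S x" by blast
      define r where "r = (?e \<bullet> x) / (?e \<bullet> ?e)"
      have "x - r *\<^sub>R ?e \<in> L1"
        unfolding L1_def using x e_in sub e0
        by (auto simp: orthogonal_def span_singleton inner_diff_right r_def simp del: scaleR_Pair
            intro: subspace_diff subspace_scale)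
      moreover have "w = ?S (x - r *\<^sub>R ?e)" using x(2)
        by (simp add: linear_diff[OF pencil.linear] linear_scale[OF pencil.linear] pencil_map_axis del: scaleR_Pair)
      ultimately show "w \<in> ?S ` L1" by blast
    qed
    then have "dim (?S ` L0) \<le> dim (?S ` L1)" by (rule dim_subset)
    also have "\<dots> \<le> dim L1" by (rule dim_image_le[OF pencil.linear])
    also have "dim L1 + dim (span {?e}) = dim L0"
      unfolding L1_def
      by (rule dim_subspace_orthogonal_to_vectors[OF subspace_span sub span_minimal[OF _ sub]])
        (use e_in in simp)
    then have "dim L1 + 1 = CARD('d)" using e0 L0 by simp
    then have "dim L1 = CARD('d) - 1" by simp
    finally show ?thesis using two_le_card_d by linarith
  qed
  moreover have "dim {z \<in> UNIV. \<forall>x\<in>?S ` L0. orthogonal x z} + dim (?S ` L0) = dim (UNIV :: ('d, 'c) bigspace set)"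
    by (rule dim_subspace_orthogonal_to_vectors) (auto intro: linear_subspace_image pencil.linear sub)
  ultimately have "dim P > CARD('d)" unfolding P_def dim_UNIV DIM_bigspace by simp
  then have "\<not> isotropic ?S P" using isotropic_dim_le[OF \<mu>] by force
  then obtain x y where xy: "x \<in> P" "y \<in> P" "?S x \<bullet> y \<noteq> 0" using subP by (auto simp: isotropic_def)
  have "\<exists>v\<in>P. ?S v \<bullet> v \<noteq> 0"
  proof (rule ccontr)
    assume *: "\<not> ?thesis"
    then have "?S (x + y) \<bullet> (x + y) = 0" using subspace_add[OF subP xy(1,2)] by blast
    then have "2 * (?S x \<bullet> y) = 0" using * xy pencil.sym[of a \<alpha> "\<alpha> $ k" y x] by (simp add: pencil.S_simps)
    with xy show False by simp
  qed
  then obtain v where v: "v \<in> P" "?S v \<bullet> v \<noteq> 0" by blast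
  have fix_v: "scaled_refl ?S v ` L0 = L0"
  proof -
    have "scaled_refl ?S v x = (?S v \<bullet> v) *\<^sub>R x" if "x \<in> L0" for x
      using v(1) that by (simp add: P_def orthogonal_def scaled_refl_def pencil.sym[of a \<alpha> "\<alpha> $ k" v x])
    then have 1: "scaled_refl ?S v ` L0 \<subseteq> L0"
      by (intro image_subsetI) (simp add: subspace_scale[OF sub] del: split_paired_All)
    then have "scaled_refl ?S v ` scaled_refl ?S v ` L0 \<subseteq> scaled_refl ?S v ` L0" by (rule image_mono)
    with 1 show ?thesis unfolding pencil.scaled_refl_image_twice[OF sub v(2)] by blast
  qed
  have fix_vs: "scaled_refls ?S (replicate m v) ` L0 = L0" for m
  proof (induction m)
    case (Suc m)
    have "scaled_refls ?S (replicate (Suc m) v) ` L0 = scaled_refl ?S v ` scaled_refls ?S (replicate m v) ` L0"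
      by (simp add: image_image)
    then show ?case by (simp add: Suc.IH fix_v)
  qed simp
  define R where "R = refl_ruling (\<alpha> $ k) L0"
  have all: "L \<in> R" if L: "isotropic ?S L" "dim L = CARD('d)" for L
  proof -
    obtain vs where vs: "anisotropic ?S vs" "length vs \<le> CARD('d)" "scaled_refls ?S vs ` L0 = L"
      using reach[OF \<mu> L0(1) L(1) L0(2) L(2)] by blast
    define us where "us = vs @ replicate (CARD('d) - length vs) v"
    have "scaled_refls ?S us ` L0 = L" unfolding us_def scaled_refls_append_image by (simp only: fix_vs vs)
    moreover have "anisotropic ?S us" "length us = CARD('d)"
      unfolding us_def using vs v by (auto simp: anisotropic_def)
    ultimately show ?thesis unfolding R_def refl_ruling_def by blast
  qed
  have "ruling (pencil_quadric a \<alpha> (\<alpha> $ k)) R"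
    unfolding ruling_def
  proof (intro conjI allI impI)
    show "unirational_family R" unfolding R_def by (rule refl_ruling_unirational[OF L0 \<mu>])
    show "\<forall>L\<in>R. L \<subseteq> pencil_quadric a \<alpha> (\<alpha> $ k)"
      unfolding R_def using refl_ruling_subset[OF L0] by blast
    fix R' assume R': "unirational_family R' \<and> (\<forall>L\<in>R'. L \<subseteq> pencil_quadric a \<alpha> (\<alpha> $ k)) \<and> R \<subseteq> R'"
    then show "R' = R"
      using all by (auto simp: unirational_family_def isotropic_pencil_iff)
  qed
  then show ?thesis using that all by blast
qed

end

section \<open>Mirrors, lines cut out by hyperplanes, and vertices on them\<close>

lemma confocal_bilinear_normal:
  "confocal_bilinear a \<mu> p z = quadric_normal a \<mu> p \<bullet> snd z - fst p * fst z"
  by (simp add: confocal_bilinear_def quadric_normal_def inner_vec_def)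

lemma confocal_bilinear_commute: "confocal_bilinear a \<mu> p z = confocal_bilinear a \<mu> z p"
  by (simp add: confocal_bilinear_def mult_ac)

lemma confocal_quadric_iff: "p \<in> confocal_quadric a \<mu> \<longleftrightarrow> confocal_bilinear a \<mu> p p = 0"
  by (simp add: confocal_quadric_def confocal_bilinear_def power2_eq_square)

lemma linear_confocal_bilinear: "Real_Vector_Spaces.linear (confocal_bilinear a \<mu> p)"
  by (rule linearI) (simp_all add: confocal_bilinear_normal inner_simps algebra_simps)

lemma mirror_inner: "mirror N x \<bullet> mirror N y = x \<bullet> y"
  by (cases "N = 0") (simp_all add: mirror_def inner_simps inner_commute field_simps)

lemma norm_mirror: "norm (mirror N x) = norm x"
  by (simp add: norm_eq_sqrt_inner mirror_inner)

lemma linear_mirror: "Real_Vector_Spaces.linear (mirror N)"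
  by (rule linearI) (simp_all add: mirror_def inner_simps algebra_simps add_divide_distrib)

text \<open>An orthogonal map takes \<open>N\<close> to a multiple of an axis, where the mirror is
  diagonal with a single entry -1.\<close>

lemma det_matrix_mirror:
  fixes N :: "real^'n::finite"
  assumes "N \<noteq> 0"
  shows "det (matrix (mirror N)) = - 1"
proof -
  let ?i = "undefined :: 'n"
  define E :: "real^'n" where "E = norm N *\<^sub>R axis ?i 1"
  obtain f where f: "orthogonal_transformation f" "f N = E"
    by (rule orthogonal_transformation_exists[of N E]) (simp_all add: E_def)
  have lin: "Real_Vector_Spaces.linear f" using f by (simp add: orthogonal_transformation_def)
  have inn: "f x \<bullet> f y = x \<bullet> y" for x y using f by (simp add: orthogonal_transformation_def)
  have "f (mirror N x) = mirror E (f x)" for x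
    by (simp add: mirror_def linear_diff[OF lin] linear_scale[OF lin] f(2)[symmetric] inn)
  then have "f \<circ> mirror N = mirror E \<circ> f" by auto
  then have "matrix f ** matrix (mirror N) = matrix (mirror E) ** matrix f"
    by (metis matrix_compose linear_mirror lin)
  then have "det (matrix f) * det (matrix (mirror N)) = det (matrix (mirror E)) * det (matrix f)"
    by (metis det_mul)
  moreover have "det (matrix f) \<noteq> 0" using orthogonal_transformation_det[OF f(1)] by auto
  ultimately have "det (matrix (mirror N)) = det (matrix (mirror E))" by simp
  also have "mirror E x $ i = (if i = ?i then - x $ i else x $ i)" for x i
    using assms by (simp add: mirror_def E_def inner_axis power2_eq_square) (simp add: axis_def)
  then have "matrix (mirror E) = (\<chi> i j. if i = j then (if i = ?i then - 1 else 1) else 0)"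
    by (auto simp: vec_eq_iff matrix_def axis_def)
  also have "det \<dots> = (\<Prod>i\<in>UNIV. if i = ?i then - 1 else 1)"
    by (subst det_diagonal) auto
  also have "\<dots> = - 1" by simp
  finally show ?thesis .
qed

lemma det_mirror_rows:
  fixes r :: "'n::finite \<Rightarrow> real^'n"
  assumes "N \<noteq> 0"
  shows "det (\<chi> i. mirror N (r i)) = - det (\<chi> i. r i)"
proof -
  have "(\<chi> i. mirror N (r i)) = (\<chi> i. r i) ** transpose (matrix (mirror N))"
  proof -
    have "mirror N (r i) $ j = ((\<chi> i. r i) ** transpose (matrix (mirror N))) $ i $ j" for i j
    proof -
      have "matrix (mirror N) *v r i = mirror N (r i)"
        by (rule matrix_works) (simp add: linear_matrix_vector_mul_eq linear_mirror)
      from arg_cong[OF this, of "\<lambda>v. v $ j"] show ?thesis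
        by (simp add: matrix_matrix_mult_def transpose_def matrix_vector_mult_def mult.commute)
    qed
    then show ?thesis by (simp add: vec_eq_iff)
  qed
  then show ?thesis by (simp add: det_mul det_matrix_mirror[OF assms])
qed

definition normals_line :: "('c \<Rightarrow> real) \<Rightarrow> ('c \<Rightarrow> real^'d::finite) \<Rightarrow> 'd pspace set" where
  "normals_line h \<nu> = {z. \<forall>k. fst z * h k + snd z \<bullet> \<nu> k = 0}"

definition unit_direction :: "('c \<Rightarrow> real^'d::finite) \<Rightarrow> real^'d \<Rightarrow> bool" where
  "unit_direction \<nu> w \<longleftrightarrow> norm w = 1 \<and> (\<forall>k. w \<bullet> \<nu> k = 0)"

text \<open>For \<open>\<mu>\<close> outside the \<open>a $ i\<close>, \<open>pencil_map\<close>
  sends this vector to \<open>(fst p, snd p, 0)\<close>. Orthogonality to it is therefore incidence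
  with \<open>p\<close>, and it is isotropic exactly when \<open>p\<close> lies on the
  quadric.\<close>

definition vertex_vec :: "real^'d \<Rightarrow> real \<Rightarrow> 'd::finite pspace \<Rightarrow> ('d, 'c::finite) bigspace" where
  "vertex_vec a \<mu> p = (- fst p, quadric_normal a \<mu> p, 0)"

lemma subspace_normals_line: "subspace (normals_line h \<nu>)"
  by (auto simp: normals_line_def subspace_def inner_simps algebra_simps simp flip: distrib_left)

context confocal
begin

abbreviation vvec :: "real \<Rightarrow> 'd pspace \<Rightarrow> ('d, 'c) bigspace" where
  "vvec \<equiv> vertex_vec a"

lemma form_vertex_vec:
  assumes "\<mu> \<notin> range (($) a)"
  shows "Sp \<mu> (vvec \<mu> p) \<bullet> z = snd p \<bullet> fst (snd z) + fst p * fst z"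
proof -
  have "(a $ i - \<mu>) * (snd p $ i / (a $ i - \<mu>)) = snd p $ i" for i using assms by auto
  then show ?thesis by (simp add: pencil_form vertex_vec_def quadric_normal_def inner_vec_def)
qed

lemma form_vertex_vertex:
  assumes "\<mu> \<notin> range (($) a)"
  shows "Sp \<mu> (vvec \<mu> p) \<bullet> vvec \<mu> q = confocal_bilinear a \<mu> p q"
  unfolding form_vertex_vec[OF assms]
  by (simp add: vertex_vec_def confocal_bilinear_def quadric_normal_def inner_vec_def)

lemma form_vertex_lift:
  assumes "\<mu> \<notin> range (($) a)" and "p \<in> normals_line h \<nu>"
  shows "Sp \<mu> (vvec \<mu> p) \<bullet> lift h \<nu> y = 0"
proof -
  have "Sp \<mu> (vvec \<mu> p) \<bullet> (h k, \<nu> k, axis k 1) = 0" for k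
    using assms(2) by (simp add: form_vertex_vec[OF assms(1)] normals_line_def add.commute)
  then show ?thesis unfolding lift_sum by (simp add: inner_sum_right del: scaleR_Pair)
qed

lemma vertex_vec_nonzero:
  assumes "\<mu> \<notin> range (($) a)" and "p \<noteq> 0"
  shows "vvec \<mu> p \<noteq> 0"
proof
  assume *: "vvec \<mu> p = 0"
  then have "fst p = 0" by (simp add: vertex_vec_def zero_prod_def)
  moreover have "snd p $ i / (a $ i - \<mu>) = 0" for i
    using * by (simp add: vertex_vec_def zero_prod_def quadric_normal_def vec_eq_iff)
  then have "snd p = 0" using assms(1) by (auto simp: vec_eq_iff)
  ultimately show False using assms(2) by (simp add: prod_eq_iff)
qed

lemma quadric_normal_nonzero:
  assumes "\<mu> \<notin> range (($) a)" and "p \<noteq> 0" and "p \<in> confocal_quadric a \<mu>"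
  shows "quadric_normal a \<mu> p \<noteq> 0"
proof
  assume *: "quadric_normal a \<mu> p = 0"
  then have "fst p = 0"
    using assms(3) by (simp add: confocal_quadric_iff confocal_bilinear_normal)
  then have "vvec \<mu> p = 0" using * by (simp add: vertex_vec_def zero_prod_def)
  with vertex_vec_nonzero[OF assms(1,2)] show False by blast
qed

abbreviation extension :: "real \<Rightarrow> ('c \<Rightarrow> real) \<Rightarrow> ('c \<Rightarrow> real^'d) \<Rightarrow> 'd pspace \<Rightarrow> ('d, 'c) bigspace set" where
  "extension \<mu> h \<nu> p \<equiv> span (insert (vvec \<mu> p) (range (lift h \<nu>)))"

lemma mem_ext: "x \<in> extension \<mu> h \<nu> p \<longleftrightarrow> (\<exists>t y. x = lift h \<nu> y + t *\<^sub>R vvec \<mu> p)"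
proof -
  have "span (range (lift h \<nu>)) = range (lift h \<nu>)"
    using subspace_range_lift by (rule span_eq_iff[THEN iffD2])
  then have "x \<in> extension \<mu> h \<nu> p \<longleftrightarrow> (\<exists>t y. x - t *\<^sub>R vvec \<mu> p = lift h \<nu> y)"
    unfolding span_insert by blast
  then show ?thesis by (simp add: diff_eq_eq)
qed

lemma vertex_vec_notin_lift:
  assumes "\<mu> \<notin> range (($) a)" and "p \<noteq> 0"
  shows "vvec \<mu> p \<notin> range (lift h \<nu>)"
proof
  assume "vvec \<mu> p \<in> range (lift h \<nu>)"
  then obtain y where y: "vvec \<mu> p = lift h \<nu> y" by blast
  have "y = snd (snd (vvec \<mu> p))" unfolding y by simp
  then have "y = 0" by (simp add: vertex_vec_def)
  then have "vvec \<mu> p = 0" using y linear_0[OF linear_lift] by simp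
  with vertex_vec_nonzero[OF assms] show False by blast
qed

lemma dim_ext:
  assumes "\<mu> \<notin> range (($) a)" and "p \<noteq> 0"
  shows "dim (extension \<mu> h \<nu> p) = CARD('d)"
  using vertex_vec_notin_lift[OF assms, of h \<nu>] subspace_range_lift[of h \<nu>]
  by (simp add: dim_insert span_eq_iff[THEN iffD2] dim_range_lift card_d)

lemma isotropic_range_lift: "normal_frame h \<nu> \<Longrightarrow> isotropic (Sp \<mu>) (range (lift h \<nu>))"
  by (auto simp: isotropic_def subspace_range_lift form_lift)

lemma isotropic_ext:
  assumes "\<mu> \<notin> range (($) a)" and "normal_frame h \<nu>" and "p \<in> normals_line h \<nu>"
    and "p \<in> confocal_quadric a \<mu>"
  shows "isotropic (Sp \<mu>) (extension \<mu> h \<nu> p)"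
  using assms
  by (intro pencil.isotropic_insert isotropic_range_lift)
    (auto simp: form_vertex_vertex form_vertex_lift confocal_quadric_iff)

text \<open>A vector of \<open>L\<close> outside the lift can be corrected by an element of the lift
  until its \<open>y\<close>-part is zero, and every such vector is the vertex vector of a point.
  Isotropy puts the point on the quadric, orthogonality to the lift puts it on the line.\<close>

lemma vertex_exists:
  assumes \<mu>: "\<mu> \<notin> range (($) a)" and nf: "normal_frame h \<nu>"
    and L: "isotropic (Sp \<mu>) L" "dim L = CARD('d)" "range (lift h \<nu>) \<subseteq> L"
  shows "\<exists>p. p \<noteq> 0 \<and> p \<in> confocal_quadric a \<mu> \<and> p \<in> normals_line h \<nu> \<and> L = extension \<mu> h \<nu> p"
proof -
  have sub: "subspace L" using L by (simp add: isotropic_def)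
  have "range (lift h \<nu>) \<noteq> L"
    using dim_range_lift[of h \<nu>] L(2) card_d by (metis n_not_Suc_n Suc_eq_plus1)
  then obtain x where x: "x \<in> L" "x \<notin> range (lift h \<nu>)" using L(3) by blast
  define v where "v = x - lift h \<nu> (snd (snd x))"
  have vL: "v \<in> L" unfolding v_def using x(1) L(3) by (intro subspace_diff sub) auto
  have v0: "v \<noteq> 0" using x(2) unfolding v_def by (metis eq_iff_diff_eq_0 rangeI)
  have vy: "snd (snd v) = 0" by (simp add: v_def)
  define p where "p = (- fst v, \<chi> i. (a $ i - \<mu>) * fst (snd v) $ i)"
  have v_eq: "vvec \<mu> p = v"
  proof -
    have "(a $ i - \<mu>) * x / (a $ i - \<mu>) = x" for i x using \<mu> by auto
    then show ?thesis using vy by (auto simp: p_def vertex_vec_def quadric_normal_def prod_eq_iff vec_eq_iff)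
  qed
  have p0: "p \<noteq> 0"
  proof
    assume "p = 0"
    then have "vvec \<mu> p = 0" by (simp add: vertex_vec_def quadric_normal_def vec_eq_iff zero_prod_def)
    with v0 v_eq show False by simp
  qed
  have pQ: "p \<in> confocal_quadric a \<mu>"
    using isotropicD[OF L(1) vL vL] form_vertex_vertex[OF \<mu>, of p p] by (simp add: confocal_quadric_iff v_eq)
  have pl: "p \<in> normals_line h \<nu>"
    unfolding normals_line_def
  proof (intro CollectI allI)
    fix k
    have "Sp \<mu> (vvec \<mu> p) \<bullet> lift h \<nu> (axis k 1) = 0"
      unfolding v_eq using L(3) by (intro isotropicD[OF L(1) vL]) auto
    then show "fst p * h k + snd p \<bullet> \<nu> k = 0"
      by (simp add: form_vertex_vec[OF \<mu>] lift_axis add.commute)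
  qed
  have "extension \<mu> h \<nu> p \<subseteq> L" using vL L(3) by (intro span_minimal sub) (auto simp: v_eq)
  then have "L = extension \<mu> h \<nu> p"
    using subspace_dim_equal[OF subspace_span sub] dim_ext[OF \<mu> p0] L(2) by (metis order_refl)
  with p0 pQ pl show ?thesis by blast
qed

section \<open>Lines and their normals\<close>

definition normal_rows :: "('c \<Rightarrow> real^'d) \<Rightarrow> real^'d \<Rightarrow> real^'d^'d" where
  "normal_rows \<nu> w = (\<chi> i. case g i of None \<Rightarrow> w | Some k \<Rightarrow> \<nu> k)"

definition normal_det :: "('c \<Rightarrow> real^'d) \<Rightarrow> real^'d \<Rightarrow> real" where
  "normal_det \<nu> w = det (normal_rows \<nu> w)"

lemma normal_frame_orthonormal:
  "normal_frame h \<nu> \<Longrightarrow> \<nu> j \<bullet> \<nu> k = (if j = k then 1 else 0)"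
  by (simp add: normal_frame_def)

lemma normal_rows_orthogonal:
  assumes "normal_frame h \<nu>" and "unit_direction \<nu> w"
  shows "normal_rows \<nu> w ** transpose (normal_rows \<nu> w) = mat 1"
proof -
  have "normal_rows \<nu> w $ i \<bullet> normal_rows \<nu> w $ j = (if i = j then 1 else 0)" for i j
  proof -
    have "i = j \<longleftrightarrow> g i = g j" using bij_g by (auto simp: bij_def dest: injD)
    moreover have "w \<bullet> w = 1" "w \<bullet> \<nu> k = 0" "\<nu> k \<bullet> w = 0" for k
      using assms(2) by (simp_all add: unit_direction_def norm_eq_1 inner_commute)
    moreover have "\<nu> k \<bullet> \<nu> l = (if k = l then 1 else 0)" for k l
      using assms(1) by (simp add: normal_frame_def)
    ultimately show ?thesis
      by (cases "g i"; cases "g j") (simp_all add: normal_rows_def)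
  qed
  then show ?thesis
    by (simp add: vec_eq_iff matrix_matrix_mult_def transpose_def mat_def inner_vec_def)
qed

lemma normal_rows_expansion:
  assumes "normal_frame h \<nu>" and "unit_direction \<nu> w"
  shows "x = (\<Sum>i\<in>UNIV. (normal_rows \<nu> w $ i \<bullet> x) *s row i (normal_rows \<nu> w))"
proof -
  let ?A = "normal_rows \<nu> w"
  have "transpose ?A ** ?A = mat 1"
    using normal_rows_orthogonal[OF assms] matrix_left_right_inverse by blast
  then have "x = transpose ?A *v (?A *v x)" by (simp add: matrix_vector_mul_assoc)
  also have "\<dots> = (\<Sum>i\<in>UNIV. (?A *v x) $ i *s row i ?A)"
    by (simp only: matrix_mult_sum column_transpose)
  finally show ?thesis by (simp only: matrix_vector_mul_component)
qed

lemma normal_expansion: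
  assumes "normal_frame h \<nu>" and "unit_direction \<nu> w"
  shows "x = (\<Sum>k\<in>UNIV. (x \<bullet> \<nu> k) *\<^sub>R \<nu> k) + (x \<bullet> w) *\<^sub>R w"
proof -
  define f where "f l = (case l of None \<Rightarrow> w | Some k \<Rightarrow> \<nu> k)" for l
  have "x $ j = (\<Sum>i\<in>UNIV. (\<lambda>l. (f l \<bullet> x) * f l $ j) (g i))" for j
    by (subst normal_rows_expansion[OF assms, of x]) (simp add: sum_component row_def normal_rows_def f_def)
  then have "x $ j = (f None \<bullet> x) * f None $ j + (\<Sum>k\<in>UNIV. (f (Some k) \<bullet> x) * f (Some k) $ j)" for j
    using sum_g[of "\<lambda>l. (f l \<bullet> x) * f l $ j"] by (rule trans)
  then have "x $ j = (w \<bullet> x) * w $ j + (\<Sum>k\<in>UNIV. (\<nu> k \<bullet> x) * \<nu> k $ j)" for j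
    unfolding f_def option.case .
  then show ?thesis
    by (simp add: vec_eq_iff sum_component inner_commute add.commute)
qed

lemma normal_det_abs:
  assumes "normal_frame h \<nu>" and "unit_direction \<nu> w"
  shows "normal_det \<nu> w = 1 \<or> normal_det \<nu> w = - 1"
proof -
  have "orthogonal_matrix (normal_rows \<nu> w)"
    using normal_rows_orthogonal[OF assms] matrix_left_right_inverse unfolding orthogonal_matrix_def by blast
  then show ?thesis unfolding normal_det_def by (rule det_orthogonal_matrix)
qed

lemma normal_det_nonzero:
  "normal_frame h \<nu> \<Longrightarrow> unit_direction \<nu> w \<Longrightarrow> normal_det \<nu> w \<noteq> 0"
  using normal_det_abs[of h \<nu> w] by auto

text \<open>Cramer's rule in the orthonormal basis \<open>(\<nu>, w)\<close>: only the component
  along \<open>w\<close> contributes.\<close>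

lemma normal_det_replace:
  assumes "normal_frame h \<nu>" and "unit_direction \<nu> w"
  shows "normal_det \<nu> x = (x \<bullet> w) * normal_det \<nu> w"
proof -
  obtain i0 where i0: "g i0 = None" using bij_g by (metis bij_pointE)
  have g_None: "g i = None \<longleftrightarrow> i = i0" for i using i0 bij_g by (metis bij_def injD)
  let ?A = "normal_rows \<nu> w"
  have "normal_rows \<nu> x = (\<chi> i. if i = i0 then x else row i ?A)"
    using i0 by (auto simp: vec_eq_iff normal_rows_def row_def simp flip: g_None split: option.split)
  also have "\<dots> = (\<chi> i. if i = i0 then (\<Sum>i\<in>UNIV. (?A *v x) $ i *s row i ?A) else row i ?A)"
    unfolding matrix_vector_mul_component normal_rows_expansion[OF assms, of x, symmetric] ..
  finally have "normal_det \<nu> x = (?A *v x) $ i0 * det ?A"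
    unfolding normal_det_def by (simp only: cramer_lemma_transpose)
  also have "(?A *v x) $ i0 = x \<bullet> w"
    by (simp add: matrix_vector_mul_component normal_rows_def i0 inner_commute)
  finally show ?thesis by (simp add: normal_det_def)
qed

lemma normal_det_mirror:
  assumes "N \<noteq> 0"
  shows "normal_det (\<lambda>k. mirror N (\<nu> k)) (mirror N w) = - normal_det \<nu> w"
proof -
  have "normal_rows (\<lambda>k. mirror N (\<nu> k)) (mirror N w) = (\<chi> i. mirror N (case g i of None \<Rightarrow> w | Some k \<Rightarrow> \<nu> k))"
    by (simp add: vec_eq_iff normal_rows_def split: option.split)
  then show ?thesis by (simp add: normal_det_def det_mirror_rows[OF assms] normal_rows_def)
qed

lemma unit_direction_uminus: "unit_direction \<nu> w \<Longrightarrow> unit_direction \<nu> (- w)"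
  by (simp add: unit_direction_def)

lemma unit_direction_unique:
  assumes "normal_frame h \<nu>" and "unit_direction \<nu> w" and "unit_direction \<nu> w'"
  shows "w' = (w' \<bullet> w) *\<^sub>R w" and "w' \<bullet> w = 1 \<or> w' \<bullet> w = - 1"
proof -
  show 1: "w' = (w' \<bullet> w) *\<^sub>R w"
    using normal_expansion[OF assms(1,2), of w'] assms(3) by (simp add: unit_direction_def)
  from arg_cong[OF this, of norm] assms(2,3) show "w' \<bullet> w = 1 \<or> w' \<bullet> w = - 1"
    by (auto simp: unit_direction_def)
qed

lemma unit_direction_exists:
  assumes "normal_frame h \<nu>" and "\<epsilon> = 1 \<or> \<epsilon> = - 1"
  shows "\<exists>w. unit_direction \<nu> w \<and> normal_det \<nu> w = \<epsilon>"
proof -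
  have "dim (range \<nu>) \<le> card (range \<nu>)" by (rule dim_le_card'[OF finite_imageI[OF finite]])
  also have "\<dots> \<le> CARD('c)" by (rule card_image_le) simp
  finally have "dim (range \<nu>) < DIM(real^'d)" using card_d by simp
  then obtain x where x: "x \<noteq> 0" "\<And>y. y \<in> span (range \<nu>) \<Longrightarrow> orthogonal x y"
    using orthogonal_to_subspace_exists by blast
  define w where "w = x /\<^sub>R norm x"
  have w: "unit_direction \<nu> w"
    using x by (auto simp: w_def unit_direction_def orthogonal_def span_base)
  then have "w \<bullet> w = 1" by (simp add: unit_direction_def norm_eq_1)
  then have "normal_det \<nu> (- w) = - normal_det \<nu> w"
    using normal_det_replace[OF assms(1) w, of "- w"] by simp
  then show ?thesis
    using assms(2) normal_det_abs[OF assms(1) w] w unit_direction_uminus[OF w] by fastforce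
qed

lemma direction_in_line: "unit_direction \<nu> w \<Longrightarrow> (0, w) \<in> normals_line h \<nu>"
  by (simp add: normals_line_def unit_direction_def)

text \<open>This is the foot of the perpendicular from the centre, used as a reference point on the
  line.\<close>

lemma foot_in_line:
  assumes "normal_frame h \<nu>"
  shows "(1, - (\<Sum>k\<in>UNIV. h k *\<^sub>R \<nu> k)) \<in> normals_line h \<nu>"
proof -
  have "(\<Sum>j\<in>UNIV. h j *\<^sub>R \<nu> j) \<bullet> \<nu> k = h k" for k
    by (simp add: inner_sum_left normal_frame_orthonormal[OF assms] if_distrib cong: if_cong)
  then show ?thesis by (simp add: normals_line_def)
qed

lemma infinite_point_of_line:
  assumes "normal_frame h \<nu>" and "unit_direction \<nu> w" and "z \<in> normals_line h \<nu>" and "fst z = 0"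
  shows "z = (0, (snd z \<bullet> w) *\<^sub>R w)"
  using normal_expansion[OF assms(1,2), of "snd z"] assms(3,4)
  by (simp add: normals_line_def prod_eq_iff)

lemma dim_normals_line:
  assumes "normal_frame h \<nu>"
  shows "dim (normals_line h \<nu>) = 2"
proof -
  obtain w where w: "unit_direction \<nu> w" using unit_direction_exists[OF assms, of 1] by auto
  define z1 where "z1 = (1 :: real, - (\<Sum>k\<in>UNIV. h k *\<^sub>R \<nu> k))"
  have z1: "z1 \<in> normals_line h \<nu>" unfolding z1_def by (rule foot_in_line[OF assms])
  have "normals_line h \<nu> = span {z1, (0, w)}"
  proof
    show "span {z1, (0, w)} \<subseteq> normals_line h \<nu>"
      using z1 direction_in_line[OF w] by (intro span_minimal subspace_normals_line) auto
    show "normals_line h \<nu> \<subseteq> span {z1, (0, w)}"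
    proof
      fix z assume z: "z \<in> normals_line h \<nu>"
      have "z - fst z *\<^sub>R z1 \<in> normals_line h \<nu>"
        using z z1 subspace_normals_line by (intro subspace_diff subspace_scale) auto
      from infinite_point_of_line[OF assms w this]
      obtain c where "z - fst z *\<^sub>R z1 = c *\<^sub>R (0, w)"
        unfolding scaleR_Pair scaleR_zero_right by (auto simp: z1_def)
      then have "z = fst z *\<^sub>R z1 + c *\<^sub>R (0, w)"
        by (metis add.commute diff_add_cancel)
      also have "\<dots> \<in> span {z1, (0, w)}" by (intro span_add span_scale span_base) auto
      finally show "z \<in> span {z1, (0, w)}" .
    qed
  qed
  moreover have "z1 \<notin> span {(0, w)}" by (auto simp: span_singleton z1_def)
  moreover have "(0 :: real, w) \<noteq> 0" using w by (auto simp: unit_direction_def zero_prod_def)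
  ultimately show ?thesis by (simp add: dim_insert)
qed

lemma euclidean_normals_line: "normal_frame h \<nu> \<Longrightarrow> euclidean_line (normals_line h \<nu>)"
  unfolding euclidean_line_def using subspace_normals_line dim_normals_line foot_in_line
  by (metis fst_conv zero_neq_one)

lemma dual_line_lift: "dual_line (range (lift h \<nu>)) = normals_line h \<nu>"
proof -
  have e: "orthogonal (drop_y (lift h \<nu> y)) z \<longleftrightarrow> (\<Sum>k\<in>UNIV. y $ k * (fst z * h k + snd z \<bullet> \<nu> k)) = 0" for y z
    by (simp add: orthogonal_def drop_y_def frame_lift_def inner_prod_def inner_sum_left
        inner_sum_right sum_distrib_right sum_distrib_left sum.distrib algebra_simps inner_commute)
  show ?thesis
  proof (intro set_eqI iffI)
    fix z assume "z \<in> dual_line (range (lift h \<nu>))"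
    then have *: "(\<Sum>k\<in>UNIV. y $ k * (fst z * h k + snd z \<bullet> \<nu> k)) = 0" for y
      using e[of y z] by (auto simp: dual_line_def orthogonal_comp_def)
    have "fst z * h k + snd z \<bullet> \<nu> k = 0" for k
      using *[of "axis k 1"] by (simp add: axis_def if_distrib[of "\<lambda>x. x * _"] cong: if_cong)
    then show "z \<in> normals_line h \<nu>" by (simp add: normals_line_def)
  next
    fix z assume "z \<in> normals_line h \<nu>"
    then show "z \<in> dual_line (range (lift h \<nu>))"
      by (auto simp: dual_line_def orthogonal_comp_def e normals_line_def)
  qed
qed

text \<open>The point is the pole of the hyperplane \<open>(h k, \<nu> k)\<close> with respect to
  the caustic. The frame equations for the pairs \<open>(k, j)\<close> put it into each of the
  hyperplanes that define the line.\<close>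

lemma line_contact:
  assumes "normal_frame h \<nu>"
  shows "contact_point a (\<alpha> $ k) (normals_line h \<nu>) (- h k, \<chi> i. (a $ i - \<alpha> $ k) * \<nu> k $ i)"
    and "quadric_normal a (\<alpha> $ k) (- h k, \<chi> i. (a $ i - \<alpha> $ k) * \<nu> k $ i) = \<nu> k"
proof -
  define c where "c = (- h k, \<chi> i. (a $ i - \<alpha> $ k) * \<nu> k $ i)"
  show n: "quadric_normal a (\<alpha> $ k) (- h k, \<chi> i. (a $ i - \<alpha> $ k) * \<nu> k $ i) = \<nu> k"
    using a_neq_alpha by (simp add: quadric_normal_def vec_eq_iff)
  have c0: "c \<noteq> 0"
  proof
    assume "c = 0"
    then have "(a $ i - \<alpha> $ k) * \<nu> k $ i = 0" for i by (simp add: c_def zero_prod_def vec_eq_iff)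
    then have "\<nu> k = 0" using a_neq_alpha by (auto simp: vec_eq_iff)
    then show False using normal_frame_orthonormal[OF assms, of k k] by simp
  qed
  have "fst c * h j + snd c \<bullet> \<nu> j = 0" for j
  proof -
    have "snd c \<bullet> \<nu> j = (\<Sum>i\<in>UNIV. a $ i * \<nu> k $ i * \<nu> j $ i) - \<alpha> $ k * (\<nu> k \<bullet> \<nu> j)"
      by (simp add: c_def inner_vec_def left_diff_distrib sum_subtractf sum_distrib_left mult.assoc)
    moreover have "(\<Sum>i\<in>UNIV. a $ i * \<nu> k $ i * \<nu> j $ i) - h k * h j = (if k = j then \<alpha> $ j else 0)"
      using assms by (simp add: normal_frame_def)
    moreover have "fst c = - h k" by (simp add: c_def)
    ultimately show ?thesis
      using normal_frame_orthonormal[OF assms, of k j] by (cases "k = j") simp_all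
  qed
  then have cl: "c \<in> normals_line h \<nu>" by (simp add: normals_line_def)
  have B: "confocal_bilinear a (\<alpha> $ k) c z = 0" if "z \<in> normals_line h \<nu>" for z
    unfolding confocal_bilinear_normal using that n
    by (simp add: c_def normals_line_def inner_commute mult.commute add.commute)
  from c0 cl B show "contact_point a (\<alpha> $ k) (normals_line h \<nu>) (- h k, \<chi> i. (a $ i - \<alpha> $ k) * \<nu> k $ i)"
    by (auto simp: contact_point_def confocal_quadric_iff c_def)
qed

lemma tangent_normals_line: "normal_frame h \<nu> \<Longrightarrow> tangent_to a (\<alpha> $ k) (normals_line h \<nu>)"
  unfolding tangent_to_def by (rule exI, rule line_contact(1))

lemma contact_normal_line:
  assumes "normal_frame h \<nu>"
  shows "contact_normal a (\<alpha> $ k) (normals_line h \<nu>) (\<nu> k)"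
  unfolding contact_normal_def
proof
  show "norm (\<nu> k) = 1" using assms by (simp add: normal_frame_def norm_eq_1)
  show "\<exists>c. contact_point a (\<alpha> $ k) (normals_line h \<nu>) c \<and> \<nu> k \<in> span {quadric_normal a (\<alpha> $ k) c}"
    using line_contact[OF assms, of k] by (intro exI conjI) (assumption, simp add: span_base)
qed

text \<open>Chasles' theorem: the contact normals are mutually orthogonal, because the
  points of contact lie on the line and the parameters differ.\<close>

lemma normal_frame_of_tangent_line:
  assumes l: "euclidean_line l" and cn: "\<And>k. contact_normal a (\<alpha> $ k) l (\<nu> k)"
  shows "\<exists>h. normal_frame h \<nu> \<and> l = normals_line h \<nu>"
proof -
  have "\<forall>k. \<exists>c. contact_point a (\<alpha> $ k) l c \<and> \<nu> k \<in> span {quadric_normal a (\<alpha> $ k) c}"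
    using cn by (simp add: contact_normal_def)
  then obtain c where c: "\<And>k. contact_point a (\<alpha> $ k) l (c k)"
    "\<And>k. \<nu> k \<in> span {quadric_normal a (\<alpha> $ k) (c k)}" by metis
  from c(2) have "\<forall>k. \<exists>s. \<nu> k = s *\<^sub>R quadric_normal a (\<alpha> $ k) (c k)" by (auto simp: span_singleton)
  then obtain s where s: "\<And>k. \<nu> k = s k *\<^sub>R quadric_normal a (\<alpha> $ k) (c k)" by metis
  define h where "h k = - (s k * fst (c k))" for k
  have in_line: "fst z * h k + snd z \<bullet> \<nu> k = 0" if "z \<in> l" for z k
  proof -
    have "confocal_bilinear a (\<alpha> $ k) (c k) z = 0" using c(1)[of k] that by (simp add: contact_point_def)
    then have "s k * (quadric_normal a (\<alpha> $ k) (c k) \<bullet> snd z - fst (c k) * fst z) = 0"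
      by (simp add: confocal_bilinear_normal)
    then show ?thesis by (simp add: h_def s inner_commute algebra_simps)
  qed
  have sub_l: "subspace l" using l by (simp add: euclidean_line_def)
  have contact: "s k *\<^sub>R c k = (- h k, \<chi> i. (a $ i - \<alpha> $ k) * \<nu> k $ i)" for k
    using a_neq_alpha by (simp add: h_def s quadric_normal_def prod_eq_iff vec_eq_iff)
  have mem: "(- h k, \<chi> i. (a $ i - \<alpha> $ k) * \<nu> k $ i) \<in> l" for k
    unfolding contact[symmetric] using c(1)[of k] by (auto simp: contact_point_def intro: subspace_scale[OF sub_l])
  have e: "(\<Sum>i\<in>UNIV. a $ i * \<nu> k $ i * \<nu> j $ i) - h k * h j = \<alpha> $ k * (\<nu> k \<bullet> \<nu> j)" for j k
    using in_line[OF mem[of k], of j]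
    by (simp add: inner_vec_def left_diff_distrib sum_subtractf sum_distrib_left mult.assoc)
  \<comment> \<open>The left-hand side of \<open>e\<close> is symmetric in the two indices, so
    \<open>(\<alpha> $ j - \<alpha> $ k) * (\<nu> j \<bullet> \<nu> k) = 0\<close>.\<close>
  have orth: "\<nu> j \<bullet> \<nu> k = 0" if "j \<noteq> k" for j k
  proof -
    have "\<alpha> $ j * (\<nu> j \<bullet> \<nu> k) = \<alpha> $ k * (\<nu> j \<bullet> \<nu> k)"
      using e[of k j] e[of j k] by (auto simp: mult_ac inner_commute)
    then show ?thesis using alpha_eq_iff that by auto
  qed
  have unit: "\<nu> k \<bullet> \<nu> k = 1" for k using cn[of k] by (simp add: contact_normal_def norm_eq_1)
  have nf: "normal_frame h \<nu>"
    unfolding normal_frame_def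
  proof (intro allI)
    fix j k
    show "\<nu> j \<bullet> \<nu> k = (if j = k then 1 else 0) \<and>
       (\<Sum>i\<in>UNIV. a $ i * \<nu> j $ i * \<nu> k $ i) - h j * h k = (if j = k then \<alpha> $ k else 0)"
      using e[where k = j and j = k] orth[of j k] unit[of k] by (cases "j = k") simp_all
  qed
  have "l \<subseteq> normals_line h \<nu>" using in_line by (auto simp: normals_line_def)
  moreover have "dim (normals_line h \<nu>) \<le> dim l"
    using l dim_normals_line[OF nf] by (simp add: euclidean_line_def)
  ultimately have "l = normals_line h \<nu>"
    by (rule subspace_dim_equal[OF sub_l subspace_normals_line])
  with nf show ?thesis by blast
qed

section \<open>The Joachimsthal coefficient\<close>

definition vertex_of :: "real \<Rightarrow> ('c \<Rightarrow> real) \<Rightarrow> ('c \<Rightarrow> real^'d) \<Rightarrow> 'd pspace \<Rightarrow> bool" where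
  "vertex_of \<mu> h \<nu> p \<longleftrightarrow> p \<noteq> 0 \<and> p \<in> confocal_quadric a \<mu> \<and> p \<in> normals_line h \<nu>"

definition joachimsthal ::
    "real \<Rightarrow> ('c \<Rightarrow> real) \<Rightarrow> ('c \<Rightarrow> real^'d) \<Rightarrow> real^'d \<Rightarrow> 'd pspace \<Rightarrow> real \<Rightarrow> bool" where
  "joachimsthal \<mu> h \<nu> w p c \<longleftrightarrow> (\<forall>z\<in>normals_line h \<nu>.
     confocal_bilinear a \<mu> p z = c * ((fst p *\<^sub>R snd z - fst z *\<^sub>R snd p) \<bullet> w))"

lemma line_cross:
  assumes "normal_frame h \<nu>" and "unit_direction \<nu> w"
    and "p \<in> normals_line h \<nu>" and "z \<in> normals_line h \<nu>"
  shows "fst p *\<^sub>R z - fst z *\<^sub>R p = ((fst p *\<^sub>R snd z - fst z *\<^sub>R snd p) \<bullet> w) *\<^sub>R (0, w)"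
proof -
  have "fst p *\<^sub>R z - fst z *\<^sub>R p \<in> normals_line h \<nu>"
    using assms(3,4) subspace_normals_line by (intro subspace_diff subspace_scale) auto
  from infinite_point_of_line[OF assms(1,2) this] show ?thesis by simp
qed

lemma infinite_vertex:
  assumes "normal_frame h \<nu>" and "unit_direction \<nu> w" and "vertex_of \<mu> h \<nu> p" and "fst p = 0"
  obtains l where "l \<noteq> 0" and "p = l *\<^sub>R (0, w)"
proof (rule that)
  show p: "p = (snd p \<bullet> w) *\<^sub>R (0, w)"
    using infinite_point_of_line[OF assms(1,2) _ assms(4)] assms(3) by (simp add: vertex_of_def)
  show "snd p \<bullet> w \<noteq> 0"
    using p assms(3) by (auto simp: vertex_of_def zero_prod_def)
qed

text \<open>On the line, a space of dimension two, both sides are linear forms in \<open>z\<close>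
  that vanish at \<open>p\<close>, and the form on the right is not zero; hence they are
  proportional. The factor is read off at the direction if \<open>p\<close> is affine, and at the
  foot point if \<open>p\<close> is at infinity.\<close>

lemma joachimsthal_exists:
  assumes nf: "normal_frame h \<nu>" and w: "unit_direction \<nu> w" and p: "vertex_of \<mu> h \<nu> p"
  shows "\<exists>c. joachimsthal \<mu> h \<nu> w p c"
proof -
  note lin = linear_confocal_bilinear[of a \<mu> p]
  have pp: "confocal_bilinear a \<mu> p p = 0" and pl: "p \<in> normals_line h \<nu>"
    using p by (simp_all add: vertex_of_def confocal_quadric_iff)
  show ?thesis
  proof (cases "fst p = 0")
    case False
    have "confocal_bilinear a \<mu> p z =
        confocal_bilinear a \<mu> p (0, w) / fst p * ((fst p *\<^sub>R snd z - fst z *\<^sub>R snd p) \<bullet> w)"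
      if "z \<in> normals_line h \<nu>" for z
    proof -
      have "fst p * confocal_bilinear a \<mu> p z = confocal_bilinear a \<mu> p (fst p *\<^sub>R z - fst z *\<^sub>R p)"
        by (simp add: linear_diff[OF lin] linear_scale[OF lin] pp)
      also have "\<dots> = ((fst p *\<^sub>R snd z - fst z *\<^sub>R snd p) \<bullet> w) * confocal_bilinear a \<mu> p (0, w)"
        unfolding line_cross[OF nf w pl that] by (simp add: linear_scale[OF lin] del: scaleR_Pair)
      finally show ?thesis using False by (simp add: field_simps)
    qed
    then show ?thesis unfolding joachimsthal_def by blast
  next
    case True
    obtain l where l: "l \<noteq> 0" "p = l *\<^sub>R (0, w)"
      using infinite_vertex[OF nf w p True] by metis
    have ww: "w \<bullet> w = 1" using w by (simp add: unit_direction_def norm_eq_1)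
    define z1 where "z1 = (1 :: real, - (\<Sum>k\<in>UNIV. h k *\<^sub>R \<nu> k))"
    have z1: "z1 \<in> normals_line h \<nu>" unfolding z1_def by (rule foot_in_line[OF nf])
    have "confocal_bilinear a \<mu> p z =
        - confocal_bilinear a \<mu> p z1 / l * ((fst p *\<^sub>R snd z - fst z *\<^sub>R snd p) \<bullet> w)"
      if "z \<in> normals_line h \<nu>" for z
    proof -
      have "z - fst z *\<^sub>R z1 \<in> normals_line h \<nu>"
        using that z1 subspace_normals_line by (intro subspace_diff subspace_scale) auto
      from infinite_point_of_line[OF nf w this]
      obtain m where m: "z - fst z *\<^sub>R z1 = m *\<^sub>R (0, w)"
        unfolding scaleR_Pair scaleR_zero_right by (auto simp: z1_def)
      have "confocal_bilinear a \<mu> p (0, w) = 0"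
        using pp l(1) unfolding l(2) linear_scale[OF linear_confocal_bilinear]
        by (simp add: confocal_bilinear_commute[of a \<mu> "l *\<^sub>R (0, w)"]
            linear_scale[OF linear_confocal_bilinear] del: scaleR_Pair)
      then have "confocal_bilinear a \<mu> p (z - fst z *\<^sub>R z1) = 0"
        unfolding m by (simp add: linear_scale[OF lin] del: scaleR_Pair)
      then have "confocal_bilinear a \<mu> p z = fst z * confocal_bilinear a \<mu> p z1"
        by (simp add: linear_diff[OF lin] linear_scale[OF lin])
      moreover have "(fst p *\<^sub>R snd z - fst z *\<^sub>R snd p) \<bullet> w = - fst z * l"
        by (simp add: l(2) ww)
      ultimately show ?thesis using l(1) by simp
    qed
    then show ?thesis unfolding joachimsthal_def by blast
  qed
qed

text \<open>If the line lies in the polar hyperplane of \<open>p\<close>, the normal at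
  \<open>p\<close> is a combination of the \<open>\<nu> k\<close>. Orthogonality of the vertex
  vector to the lift then kills all coefficients except where
  \<open>\<alpha> $ k = \<mu>\<close>.\<close>

lemma polar_vertex:
  assumes \<mu>: "\<mu> \<notin> range (($) a)" and nf: "normal_frame h \<nu>" and p: "vertex_of \<mu> h \<nu> p"
    and polar: "\<And>z. z \<in> normals_line h \<nu> \<Longrightarrow> confocal_bilinear a \<mu> p z = 0"
  shows "\<exists>y. vvec \<mu> p = lift h \<nu> y - (0, 0, y) \<and> (\<forall>k. (\<alpha> $ k - \<mu>) * y $ k = 0)"
proof -
  obtain w where w: "unit_direction \<nu> w" using unit_direction_exists[OF nf, of 1] by auto
  let ?N = "quadric_normal a \<mu> p"
  define y where "y = (\<chi> k. ?N \<bullet> \<nu> k)"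
  have "?N \<bullet> w = 0"
    using polar[OF direction_in_line[OF w]] by (simp add: confocal_bilinear_normal)
  then have N: "?N = (\<Sum>k\<in>UNIV. y $ k *\<^sub>R \<nu> k)"
    using normal_expansion[OF nf w, of ?N] by (simp add: y_def)
  have "- fst p = (\<Sum>k\<in>UNIV. y $ k * h k)"
    using polar[OF foot_in_line[OF nf]]
    by (simp add: confocal_bilinear_normal inner_sum_right y_def mult.commute)
  then have v: "vvec \<mu> p = lift h \<nu> y - (0, 0, y)"
    using N by (simp add: vertex_vec_def frame_lift_def)
  have "(\<alpha> $ k - \<mu>) * y $ k = 0" for k
  proof -
    have "0 = Sp \<mu> (vvec \<mu> p) \<bullet> lift h \<nu> (axis k 1)"
      using form_vertex_lift[OF \<mu>] p by (simp add: vertex_of_def)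
    also have "\<dots> = - (Sp \<mu> (0, 0, y) \<bullet> lift h \<nu> (axis k 1))"
      unfolding v linear_diff[OF pencil.linear] inner_diff_left form_lift[OF nf] by simp
    also have "\<dots> = (\<alpha> $ k - \<mu>) * y $ k"
      by (simp add: pencil_form) (simp add: axis_def if_distrib[of "\<lambda>x. _ * x"] cong: if_cong)
    finally show ?thesis by simp
  qed
  with v show ?thesis by blast
qed

text \<open>A zero constant would make the line tangent to the member \<open>\<mu>\<close> at
  \<open>p\<close>, and \<open>polar_vertex\<close> leaves no nonzero coefficient when
  \<open>\<mu>\<close> is not the parameter of a caustic.\<close>

lemma joachimsthal_nonzero:
  assumes \<mu>: "\<mu> \<notin> range (($) a)" "\<mu> \<notin> range (($) \<alpha>)" and nf: "normal_frame h \<nu>"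
    and p: "vertex_of \<mu> h \<nu> p" and c: "joachimsthal \<mu> h \<nu> w p c"
  shows "c \<noteq> 0"
proof
  assume "c = 0"
  then have "\<And>z. z \<in> normals_line h \<nu> \<Longrightarrow> confocal_bilinear a \<mu> p z = 0"
    using c by (simp add: joachimsthal_def)
  from polar_vertex[OF \<mu>(1) nf p this] obtain y where
    y: "vvec \<mu> p = lift h \<nu> y - (0, 0, y)" "\<And>k. (\<alpha> $ k - \<mu>) * y $ k = 0" by blast
  have "y $ k = 0" for k using y(2)[of k] \<mu>(2) by auto
  then have "y = 0" by (simp add: vec_eq_iff)
  then have "vvec \<mu> p = 0" using y(1) linear_0[OF linear_lift] by (simp add: zero_prod_def)
  with vertex_vec_nonzero[OF \<mu>(1)] p show False by (auto simp: vertex_of_def)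
qed

text \<open>The kernel vector lies in the extension. Comparing components shows that
  \<open>\<nu> k\<close> is a multiple of the normal at \<open>p\<close>: the vertex is the point
  where the line touches the caustic.\<close>

lemma joachimsthal_degenerate:
  assumes \<mu>: "\<alpha> $ k \<notin> range (($) a)" and nf: "normal_frame h \<nu>" and w: "unit_direction \<nu> w"
    and p: "vertex_of (\<alpha> $ k) h \<nu> p" and c: "joachimsthal (\<alpha> $ k) h \<nu> w p c"
  shows "c = 0"
proof -
  have p': "p \<noteq> 0" "p \<in> confocal_quadric a (\<alpha> $ k)" "p \<in> normals_line h \<nu>"
    using p by (simp_all add: vertex_of_def)
  have "(0, 0, axis k 1) \<in> extension (\<alpha> $ k) h \<nu> p"
    by (rule kernel_in_isotropic[OF \<mu> isotropic_ext[OF \<mu> nf p'(3,2)] dim_ext[OF \<mu> p'(1)]])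
  then obtain t y where ty: "(0, 0, axis k 1) = lift h \<nu> y + t *\<^sub>R vvec (\<alpha> $ k) p"
    unfolding mem_ext by blast
  have "y = axis k 1" using arg_cong[OF ty, of "\<lambda>z. snd (snd z)"] by (simp add: vertex_vec_def)
  then have t: "h k = t * fst p" "\<nu> k = - (t *\<^sub>R quadric_normal a (\<alpha> $ k) p)"
    using ty by (auto simp: lift_axis vertex_vec_def eq_neg_iff_add_eq_0)
  have "t \<noteq> 0" using t(2) normal_frame_orthonormal[OF nf, of k k] by auto
  have B: "confocal_bilinear a (\<alpha> $ k) p z = 0" if "z \<in> normals_line h \<nu>" for z
  proof -
    have "fst z * h k + snd z \<bullet> \<nu> k = 0" using that by (simp add: normals_line_def)
    then have "t * confocal_bilinear a (\<alpha> $ k) p z = 0"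
      by (auto simp: t confocal_bilinear_normal inner_commute algebra_simps)
    then show ?thesis using \<open>t \<noteq> 0\<close> by simp
  qed
  have ww: "w \<bullet> w = 1" using w by (simp add: unit_direction_def norm_eq_1)
  show ?thesis
  proof (cases "fst p = 0")
    case False
    then show ?thesis
      using c B[OF direction_in_line[OF w]] direction_in_line[OF w, of h] ww by (force simp: joachimsthal_def)
  next
    case True
    obtain l where l: "l \<noteq> 0" "p = l *\<^sub>R (0, w)" using infinite_vertex[OF nf w p True] by metis
    have "c * ((fst p *\<^sub>R snd z - fst z *\<^sub>R snd p) \<bullet> w) = 0" if "z \<in> normals_line h \<nu>" for z
      using c B[OF that] that by (simp add: joachimsthal_def)
    from this[OF foot_in_line[OF nf]] show ?thesis using l ww by simp
  qed
qed

section \<open>Minors of a frame adapted to a vertex\<close>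

definition adapted_frame ::
    "real \<Rightarrow> ('c \<Rightarrow> real) \<Rightarrow> ('c \<Rightarrow> real^'d) \<Rightarrow> 'd pspace \<Rightarrow> 'd \<Rightarrow> ('d, 'c) bigspace" where
  "adapted_frame \<mu> h \<nu> p i = (case g i of None \<Rightarrow> vvec \<mu> p | Some k \<Rightarrow> (h k, \<nu> k, axis k 1))"

lemma span_adapted_frame: "span (range (adapted_frame \<mu> h \<nu> p)) = extension \<mu> h \<nu> p"
proof (rule span_eq[THEN iffD2], intro conjI subsetI)
  fix x assume "x \<in> range (adapted_frame \<mu> h \<nu> p)"
  then obtain i where "x = adapted_frame \<mu> h \<nu> p i" by blast
  then have "x \<in> insert (vvec \<mu> p) (range (lift h \<nu>))"
    by (auto simp: adapted_frame_def lift_axis[symmetric] split: option.split)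
  then show "x \<in> extension \<mu> h \<nu> p" by (rule span_base)
next
  have in_range: "adapted_frame \<mu> h \<nu> p (inv g l) \<in> span (range (adapted_frame \<mu> h \<nu> p))" for l
    by (intro span_base) simp
  have gi: "g (inv g l) = l" for l using bij_g by (simp add: bij_is_surj surj_f_inv_f)
  have v: "vvec \<mu> p \<in> span (range (adapted_frame \<mu> h \<nu> p))"
    using in_range[of None] by (simp add: adapted_frame_def[of _ _ _ _ "inv g _"] gi)
  have H: "(h k, \<nu> k, axis k 1) \<in> span (range (adapted_frame \<mu> h \<nu> p))" for k
    using in_range[of "Some k"] by (simp add: adapted_frame_def[of _ _ _ _ "inv g _"] gi)
  fix x assume "x \<in> insert (vvec \<mu> p) (range (lift h \<nu>))"
  then show "x \<in> span (range (adapted_frame \<mu> h \<nu> p))"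
    using v by (auto simp: lift_sum intro!: span_sum span_scale H simp del: scaleR_Pair)
qed

lemma xdet_adapted_frame: "xdet (adapted_frame \<mu> h \<nu> p) = normal_det \<nu> (quadric_normal a \<mu> p)"
proof -
  have "xmat (adapted_frame \<mu> h \<nu> p) = normal_rows \<nu> (quadric_normal a \<mu> p)"
    by (simp add: vec_eq_iff xmat_def normal_rows_def adapted_frame_def vertex_vec_def split: option.split)
  then show ?thesis by (simp add: xdet_def normal_det_def)
qed

text \<open>Apart from the column of \<open>x\<^sub>0\<close> the matrix is the identity, so only
  the \<open>x\<^sub>0\<close>-entry of the vertex vector remains.\<close>

lemma ydet_adapted_frame: "ydet (adapted_frame \<mu> h \<nu> p) = - fst p"
proof -
  obtain i0 where i0: "g i0 = None" using bij_g by (metis bij_pointE)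
  have g_None: "g i = None \<longleftrightarrow> i = i0" for i using i0 bij_g by (metis bij_def injD)
  have g_eq: "g i = g j \<longleftrightarrow> i = j" for i j using bij_g by (auto simp: bij_def dest: injD)
  define x where "x = (\<chi> i. case g i of None \<Rightarrow> - fst p | Some k \<Rightarrow> h k)"
  have "ymat (adapted_frame \<mu> h \<nu> p) $ i $ j = (if j = i0 then (mat 1 *v x) $ i else mat 1 $ i $ j)" for i j
  proof (cases "g j")
    case None
    then have "j = i0" by (simp add: g_None)
    with None show ?thesis
      by (simp add: ymat_def adapted_frame_def x_def vertex_vec_def split: option.split)
  next
    case (Some k)
    then have "j \<noteq> i0" using i0 by auto
    moreover have "snd (snd (adapted_frame \<mu> h \<nu> p i)) $ k = (if i = j then 1 else 0)"
      using Some g_eq[of i j] by (auto simp: adapted_frame_def vertex_vec_def axis_def split: option.split)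
    ultimately show ?thesis using Some by (simp add: ymat_def mat_def)
  qed
  then have "ymat (adapted_frame \<mu> h \<nu> p) = (\<chi> i j. if j = i0 then (mat 1 *v x) $ i else mat 1 $ i $ j)"
    by (simp add: vec_eq_iff)
  then have "ydet (adapted_frame \<mu> h \<nu> p) = x $ i0 * det (mat 1 :: real^'d^'d)"
    unfolding ydet_def by (simp only: cramer_lemma)
  then show ?thesis by (simp add: x_def i0)
qed

text \<open>The relation defining \<open>c\<close>, evaluated at \<open>(0, w)\<close>, gives
  \<open>N \<bullet> w = c * fst p\<close> for the normal \<open>N\<close> at \<open>p\<close>, and
  only the component of \<open>N\<close> along \<open>w\<close> enters the determinant.\<close>

lemma minors_adapted_frame:
  assumes "normal_frame h \<nu>" and "unit_direction \<nu> w" and "joachimsthal \<mu> h \<nu> w p c"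
  shows "xdet (adapted_frame \<mu> h \<nu> p) = - (c * normal_det \<nu> w) * ydet (adapted_frame \<mu> h \<nu> p)"
proof -
  have "w \<bullet> w = 1" using assms(2) by (simp add: unit_direction_def norm_eq_1)
  then have "quadric_normal a \<mu> p \<bullet> w = c * fst p"
    using assms(3) direction_in_line[OF assms(2), of h]
    by (force simp: joachimsthal_def confocal_bilinear_normal)
  then show ?thesis
    by (simp add: xdet_adapted_frame ydet_adapted_frame
        normal_det_replace[OF assms(1,2), of "quadric_normal a \<mu> p"])
qed

text \<open>If the vertex is at infinity, the reflection exchanging it with the second
  intersection point of line and quadric replaces it by an affine one.\<close>

lemma affine_vertex:
  assumes \<mu>: "\<mu> \<notin> range (($) a)" "\<mu> \<notin> range (($) \<alpha>)" and nf: "normal_frame h \<nu>"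
    and w: "unit_direction \<nu> w" and p: "vertex_of \<mu> h \<nu> p" and c: "joachimsthal \<mu> h \<nu> w p c"
  shows "\<exists>p' vs. vertex_of \<mu> h \<nu> p' \<and> fst p' \<noteq> 0 \<and> anisotropic (Sp \<mu>) vs \<and>
     extension \<mu> h \<nu> p = scaled_refls (Sp \<mu>) vs ` extension \<mu> h \<nu> p' \<and>
     joachimsthal \<mu> h \<nu> w p' ((- 1) ^ length vs * c)"
proof (cases "fst p = 0")
  case False
  then show ?thesis using p c by (intro exI[of _ p] exI[of _ "[]"]) simp
next
  case True
  have c0: "c \<noteq> 0" by (rule joachimsthal_nonzero[OF \<mu> nf p c])
  obtain l where l: "l \<noteq> 0" "p = l *\<^sub>R (0, w)" using infinite_vertex[OF nf w p True] by metis
  have ww: "w \<bullet> w = 1" using w by (simp add: unit_direction_def norm_eq_1)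
  have pp: "confocal_bilinear a \<mu> p p = 0" and pl: "p \<in> normals_line h \<nu>" and p0: "p \<noteq> 0"
    using p by (simp_all add: vertex_of_def confocal_quadric_iff)
  define z where "z = (1 :: real, - (\<Sum>k\<in>UNIV. h k *\<^sub>R \<nu> k))"
  have z: "z \<in> normals_line h \<nu>" "fst z = 1" unfolding z_def using foot_in_line[OF nf] by auto
  have pz: "confocal_bilinear a \<mu> p z \<noteq> 0"
    using c z c0 l ww by (simp add: joachimsthal_def)
  note lin = linear_confocal_bilinear
  \<comment> \<open>Because \<open>p\<close> lies on the quadric, the form at
    \<open>z + s *\<^sub>R p\<close> is affine in \<open>s\<close>; its zero gives the second
    intersection point \<open>q\<close>.\<close>
  define s where "s = - confocal_bilinear a \<mu> z z / (2 * confocal_bilinear a \<mu> p z)"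
  define q where "q = z + s *\<^sub>R p"
  have q1: "fst q = 1" using z True by (simp add: q_def)
  have ql: "q \<in> normals_line h \<nu>"
    unfolding q_def using z pl subspace_normals_line by (intro subspace_add subspace_scale) auto
  have pq: "confocal_bilinear a \<mu> p q = confocal_bilinear a \<mu> p z"
    by (simp add: q_def linear_add[OF lin] linear_scale[OF lin] pp)
  have "confocal_bilinear a \<mu> q q = confocal_bilinear a \<mu> z q + s * confocal_bilinear a \<mu> p q"
    unfolding confocal_bilinear_commute[of a \<mu> z q] confocal_bilinear_commute[of a \<mu> p q]
    by (subst (2) q_def) (simp add: linear_add[OF lin] linear_scale[OF lin])
  also have "confocal_bilinear a \<mu> z q = confocal_bilinear a \<mu> z z + s * confocal_bilinear a \<mu> p z"
    by (simp add: q_def linear_add[OF lin] linear_scale[OF lin] confocal_bilinear_commute[of a \<mu> z p])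
  finally have qq: "confocal_bilinear a \<mu> q q = 0"
    using pz by (simp add: pq s_def field_simps)
  have q: "vertex_of \<mu> h \<nu> q"
    using q1 ql qq by (auto simp: vertex_of_def confocal_quadric_iff)
  define P Q v where "P = vvec \<mu> p" and "Q = vvec \<mu> q" and "v = Q - P"
  have forms: "Sp \<mu> P \<bullet> P = 0" "Sp \<mu> Q \<bullet> Q = 0" "Sp \<mu> P \<bullet> Q = confocal_bilinear a \<mu> p z"
    "Sp \<mu> Q \<bullet> P = confocal_bilinear a \<mu> p z"
    unfolding P_def Q_def form_vertex_vertex[OF \<mu>(1)] using pp qq pq
    by (simp_all add: confocal_bilinear_commute[of a \<mu> q p])
  have vv: "Sp \<mu> v \<bullet> v = - 2 * confocal_bilinear a \<mu> p z"
    by (simp add: v_def pencil.S_simps forms)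
  have rQ: "scaled_refl (Sp \<mu>) v Q = (Sp \<mu> v \<bullet> v) *\<^sub>R P"
    unfolding scaled_refl_def vv by (simp add: v_def pencil.S_simps forms algebra_simps)
  have rM: "scaled_refl (Sp \<mu>) v (lift h \<nu> y) = (Sp \<mu> v \<bullet> v) *\<^sub>R lift h \<nu> y" for y
    by (simp add: scaled_refl_def v_def P_def Q_def linear_diff[OF pencil.linear] inner_diff_left
        form_vertex_lift[OF \<mu>(1) pl] form_vertex_lift[OF \<mu>(1) ql])
  have an: "anisotropic (Sp \<mu>) [v]" using pz vv by simp
  have "scaled_refls (Sp \<mu>) [v] ` extension \<mu> h \<nu> q \<subseteq> extension \<mu> h \<nu> p"
  proof -
    have "scaled_refl (Sp \<mu>) v x \<in> extension \<mu> h \<nu> p" if "x \<in> insert Q (range (lift h \<nu>))" for x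
    proof -
      have "P \<in> extension \<mu> h \<nu> p" "lift h \<nu> y \<in> extension \<mu> h \<nu> p" for y
        by (simp_all add: P_def span_base)
      with that show ?thesis by (auto simp: rQ rM intro!: span_scale)
    qed
    then have "span (scaled_refl (Sp \<mu>) v ` insert Q (range (lift h \<nu>))) \<subseteq> extension \<mu> h \<nu> p"
      by (intro span_minimal subspace_span) blast
    then show ?thesis
      using linear_span_image[OF pencil.linear_scaled_refls, of a \<alpha> \<mu> "[v]" "insert Q (range (lift h \<nu>))"]
      by (simp add: Q_def)
  qed
  then have "extension \<mu> h \<nu> p = scaled_refls (Sp \<mu>) [v] ` extension \<mu> h \<nu> q"
    using subspace_dim_equal[OF pencil.subspace_scaled_refls[OF subspace_span] subspace_span]
      pencil.dim_scaled_refls[OF an] dim_ext[OF \<mu>(1), of q h \<nu>] dim_ext[OF \<mu>(1) p0, of h \<nu>] q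
    by (metis order_refl vertex_of_def)
  \<comment> \<open>The bilinear form is symmetric in \<open>p\<close> and \<open>q\<close> while
    the bracket is antisymmetric, so the constants at the two ends of the chord are
    opposite.\<close>
  moreover have "joachimsthal \<mu> h \<nu> w q (- c)"
  proof -
    obtain c' where c': "joachimsthal \<mu> h \<nu> w q c'" using joachimsthal_exists[OF nf w q] by blast
    have "confocal_bilinear a \<mu> q p = c' * ((fst q *\<^sub>R snd p - fst p *\<^sub>R snd q) \<bullet> w)"
      using c' pl by (simp add: joachimsthal_def)
    moreover have "confocal_bilinear a \<mu> p q = - c * ((fst q *\<^sub>R snd p - fst p *\<^sub>R snd q) \<bullet> w)"
      using c ql by (simp add: joachimsthal_def inner_diff_left algebra_simps)
    moreover have "confocal_bilinear a \<mu> p q \<noteq> 0" using pz pq by simp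
    ultimately have "c' = - c"
      unfolding confocal_bilinear_commute[of a \<mu> q p] by (metis mult_eq_0_iff mult_right_cancel)
    with c' show ?thesis by simp
  qed
  ultimately show ?thesis using q q1 an by (intro exI[of _ q] exI[of _ "[v]"]) simp
qed

lemma affine_frame:
  assumes "\<mu> \<notin> range (($) a)" "\<mu> \<notin> range (($) \<alpha>)" and "normal_frame h \<nu>"
    and w: "unit_direction \<nu> w" and "vertex_of \<mu> h \<nu> p" and "fst p \<noteq> 0" and "joachimsthal \<mu> h \<nu> w p c"
  shows "isotropic (Sp \<mu>) (span (range (adapted_frame \<mu> h \<nu> p)))" and "xdet (adapted_frame \<mu> h \<nu> p) \<noteq> 0"
  using assms isotropic_ext[OF assms(1,3), of p] joachimsthal_nonzero[OF assms(1-3,5,7)]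
    normal_det_nonzero[OF assms(3) w] minors_adapted_frame[OF assms(3) w assms(7)]
  by (auto simp: span_adapted_frame vertex_of_def ydet_adapted_frame)

text \<open>Both subspaces are replaced by ones with affine vertices. The detour \<open>vs\<close>
  enters once through the constant at \<open>q\<close> and once through the length of
  \<open>ws\<close>, so its sign cancels; likewise for \<open>vs'\<close>.\<close>

lemma joachimsthal_parity:
  assumes \<mu>: "\<mu> \<notin> range (($) a)" "\<mu> \<notin> range (($) \<alpha>)"
    and 1: "normal_frame h \<nu>" "unit_direction \<nu> w" "vertex_of \<mu> h \<nu> p" "joachimsthal \<mu> h \<nu> w p c"
    and 2: "normal_frame h' \<nu>'" "unit_direction \<nu>' w'" "vertex_of \<mu> h' \<nu>' p'" "joachimsthal \<mu> h' \<nu>' w' p' c'"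
    and us: "anisotropic (Sp \<mu>) us" "scaled_refls (Sp \<mu>) us ` extension \<mu> h \<nu> p = extension \<mu> h' \<nu>' p'"
  shows "c' * normal_det \<nu>' w' = (- 1) ^ length us * (c * normal_det \<nu> w)"
proof -
  obtain q vs where q: "vertex_of \<mu> h \<nu> q" "fst q \<noteq> 0" "anisotropic (Sp \<mu>) vs"
    "extension \<mu> h \<nu> p = scaled_refls (Sp \<mu>) vs ` extension \<mu> h \<nu> q"
    "joachimsthal \<mu> h \<nu> w q ((- 1) ^ length vs * c)"
    using affine_vertex[OF \<mu> 1] by blast
  obtain q' vs' where q': "vertex_of \<mu> h' \<nu>' q'" "fst q' \<noteq> 0" "anisotropic (Sp \<mu>) vs'"
    "extension \<mu> h' \<nu>' p' = scaled_refls (Sp \<mu>) vs' ` extension \<mu> h' \<nu>' q'"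
    "joachimsthal \<mu> h' \<nu>' w' q' ((- 1) ^ length vs' * c')"
    using affine_vertex[OF \<mu> 2] by blast
  define ws where "ws = rev vs' @ us @ vs"
  let ?b = "adapted_frame \<mu> h \<nu> q" and ?b' = "adapted_frame \<mu> h' \<nu>' q'"
  have "scaled_refls (Sp \<mu>) ws ` extension \<mu> h \<nu> q = scaled_refls (Sp \<mu>) (rev vs') ` scaled_refls (Sp \<mu>) vs' ` extension \<mu> h' \<nu>' q'"
    unfolding ws_def scaled_refls_append_image by (simp only: q(4)[symmetric] us(2) q'(4)[symmetric])
  also have "\<dots> = extension \<mu> h' \<nu>' q'" by (rule pencil.scaled_refls_image_rev[OF subspace_span q'(3)])
  finally have img: "scaled_refls (Sp \<mu>) ws ` extension \<mu> h \<nu> q = extension \<mu> h' \<nu>' q'" .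
  define r where "r = - ((- 1) ^ length vs * c * normal_det \<nu> w)"
  define r' where "r' = - ((- 1) ^ length vs' * c' * normal_det \<nu>' w')"
  note af = affine_frame[OF \<mu> 1(1,2) q(1,2,5)] and af' = affine_frame[OF \<mu> 2(1,2) q'(1,2,5)]
  have b: "xdet ?b = r * ydet ?b" using minors_adapted_frame[OF 1(1,2) q(5)] by (simp add: r_def)
  have b': "xdet ?b' = r' * ydet ?b'" using minors_adapted_frame[OF 2(1,2) q'(5)] by (simp add: r'_def)
  have par: "xdet (\<lambda>i. scaled_refls (Sp \<mu>) ws (?b i)) = (- 1) ^ length ws * r * ydet (\<lambda>i. scaled_refls (Sp \<mu>) ws (?b i))"
    by (rule minors_parity[OF \<mu>(1) _ b af(2)]) (intro isotropicD[OF af(1)] span_base rangeI)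
  have "span (range ?b') = span (range (\<lambda>i. scaled_refls (Sp \<mu>) ws (?b i)))"
    by (simp add: span_adapted_frame span_scaled_refls img)
  then have "range ?b' \<subseteq> span (range (\<lambda>i. scaled_refls (Sp \<mu>) ws (?b i)))"
    using span_superset[of "range ?b'"] by simp
  then obtain C where C: "\<And>i. ?b' i = (\<Sum>j\<in>UNIV. (C :: real^'d^'d) $ i $ j *\<^sub>R scaled_refls (Sp \<mu>) ws (?b j))"
    using change_of_frame by blast
  have "r' * ydet ?b' = (- 1) ^ length ws * r * ydet ?b'"
  proof -
    have "r' * ydet ?b' = xdet ?b'" by (rule b'[symmetric])
    also have "\<dots> = (- 1) ^ length ws * r * ydet ?b'"
      unfolding minors_change_of_frame[of ?b' C, OF C] par by simp
    finally show ?thesis .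
  qed
  moreover have "ydet ?b' \<noteq> 0" using q'(2) by (simp add: ydet_adapted_frame)
  ultimately have "r' = (- 1) ^ length ws * r" by simp
  then have "(- 1) ^ length vs' * (c' * normal_det \<nu>' w')
      = (- 1) ^ length vs' * ((- 1) ^ length us * ((- 1) ^ length vs * (- 1) ^ length vs) * (c * normal_det \<nu> w))"
    by (simp add: r_def r'_def ws_def power_add mult_ac)
  moreover have "(- 1) ^ length vs * (- 1) ^ length vs = (1 :: real)"
    by (simp flip: power_mult_distrib)
  ultimately show ?thesis by simp
qed

section \<open>The Joachimsthal constant on a ruling\<close>

lemma ruling_isotropic:
  assumes "ruling (pencil_quadric a \<alpha> \<mu>) R" and "L \<in> R"
  shows "isotropic (Sp \<mu>) L" and "dim L = CARD('d)"
  using assms by (auto simp: ruling_def unirational_family_def isotropic_pencil_iff)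

text \<open>Members of one ruling are joined by an even number of reflections, so no sign appears;
  on a caustic both constants vanish.\<close>

lemma ruling_coefficient:
  assumes \<mu>: "\<mu> \<notin> range (($) a)" and R: "ruling (pencil_quadric a \<alpha> \<mu>) R"
    and 1: "normal_frame h \<nu>" "unit_direction \<nu> w" "vertex_of \<mu> h \<nu> p" "joachimsthal \<mu> h \<nu> w p c"
    and 2: "normal_frame h' \<nu>'" "unit_direction \<nu>' w'" "vertex_of \<mu> h' \<nu>' p'" "joachimsthal \<mu> h' \<nu>' w' p' c'"
    and in_R: "extension \<mu> h \<nu> p \<in> R" "extension \<mu> h' \<nu>' p' \<in> R"
  shows "c' * normal_det \<nu>' w' = c * normal_det \<nu> w"
proof (cases "\<mu> \<in> range (($) \<alpha>)")
  case True
  then obtain k where "\<mu> = \<alpha> $ k" by blast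
  then have "c = 0" "c' = 0"
    using joachimsthal_degenerate[of k] \<mu> 1 2 by blast+
  then show ?thesis by simp
next
  case False
  obtain q and vs :: "('d, 'c) bigspace list" where q: "vertex_of \<mu> h \<nu> q" "fst q \<noteq> 0"
    "joachimsthal \<mu> h \<nu> w q ((- 1) ^ length vs * c)"
    using affine_vertex[OF \<mu> False 1] by blast
  note af = affine_frame[OF \<mu> False 1(1,2) q]
  obtain us where us: "anisotropic (Sp \<mu>) us" "scaled_refls (Sp \<mu>) us ` extension \<mu> h \<nu> p = extension \<mu> h' \<nu>' p'"
    using reach[OF \<mu>] ruling_isotropic[OF R in_R(1)] ruling_isotropic[OF R in_R(2)] by blast
  have "even (length us)"
    using R in_R us by (intro unirational_parity[OF \<mu> False af, of R]) (auto simp: ruling_def)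
  then show ?thesis using joachimsthal_parity[OF \<mu> False 1 2 us] by simp
qed

text \<open>Both vertices have the same constant, while the bracket of \<open>p\<close> and
  \<open>p'\<close> is antisymmetric; hence they are conjugate with respect to the quadric. Then the
  vertex vector of \<open>p'\<close> can be adjoined to \<open>L\<close>, and maximality puts it
  into \<open>L\<close>.\<close>

lemma ruling_unique:
  assumes \<mu>: "\<mu> \<notin> range (($) a)" and R: "ruling (pencil_quadric a \<alpha> \<mu>) R"
    and nf: "normal_frame h \<nu>" and L: "L \<in> R" "range (lift h \<nu>) \<subseteq> L" and L': "L' \<in> R" "range (lift h \<nu>) \<subseteq> L'"
  shows "L = L'"
proof -
  note iso = ruling_isotropic[OF R L(1)] and iso' = ruling_isotropic[OF R L'(1)]
  obtain p where p: "vertex_of \<mu> h \<nu> p" "L = extension \<mu> h \<nu> p"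
    using vertex_exists[OF \<mu> nf iso L(2)] by (auto simp: vertex_of_def)
  obtain p' where p': "vertex_of \<mu> h \<nu> p'" "L' = extension \<mu> h \<nu> p'"
    using vertex_exists[OF \<mu> nf iso' L'(2)] by (auto simp: vertex_of_def)
  obtain w where w: "unit_direction \<nu> w" using unit_direction_exists[OF nf, of 1] by auto
  obtain c c' where c: "joachimsthal \<mu> h \<nu> w p c" "joachimsthal \<mu> h \<nu> w p' c'"
    using joachimsthal_exists[OF nf w] p p' by blast
  have "c' * normal_det \<nu> w = c * normal_det \<nu> w"
    using ruling_coefficient[OF \<mu> R nf w p(1) c(1) nf w p'(1) c(2)] L(1) L'(1) p(2) p'(2) by simp
  then have "c' = c" using normal_det_nonzero[OF nf w] by simp
  moreover have "confocal_bilinear a \<mu> p p' = c * ((fst p *\<^sub>R snd p' - fst p' *\<^sub>R snd p) \<bullet> w)"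
    using c(1) p'(1) by (simp add: joachimsthal_def vertex_of_def)
  moreover have "confocal_bilinear a \<mu> p' p = c' * ((fst p' *\<^sub>R snd p - fst p *\<^sub>R snd p') \<bullet> w)"
    using c(2) p(1) by (simp add: joachimsthal_def vertex_of_def)
  ultimately have "confocal_bilinear a \<mu> p p' = - confocal_bilinear a \<mu> p' p"
    by (simp add: inner_diff_left algebra_simps)
  then have B: "confocal_bilinear a \<mu> p p' = 0"
    using confocal_bilinear_commute[of a \<mu> p p'] by simp
  have p'l: "p' \<in> normals_line h \<nu>" "p' \<in> confocal_quadric a \<mu>" using p'(1) by (simp_all add: vertex_of_def)
  have "isotropic (Sp \<mu>) (span (insert (vvec \<mu> p') L))"
  proof (rule pencil.isotropic_insert[OF iso(1)])
    show "Sp \<mu> (vvec \<mu> p') \<bullet> vvec \<mu> p' = 0"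
      using p'l by (simp add: form_vertex_vertex[OF \<mu>] confocal_quadric_iff)
    fix z assume "z \<in> L"
    then obtain t y where z: "z = lift h \<nu> y + t *\<^sub>R vvec \<mu> p" unfolding p(2) mem_ext by blast
    show "Sp \<mu> (vvec \<mu> p') \<bullet> z = 0"
      by (simp add: z inner_add_right form_vertex_lift[OF \<mu> p'l(1)] form_vertex_vertex[OF \<mu>]
          confocal_bilinear_commute[of a \<mu> p' p] B)
  qed
  then have "dim (insert (vvec \<mu> p') L) \<le> dim L" using isotropic_dim_le[OF \<mu>] iso(2) by fastforce
  moreover have sub: "subspace L" using iso(1) by (simp add: isotropic_def)
  ultimately have "vvec \<mu> p' \<in> L"
    by (auto simp: dim_insert span_eq_iff[THEN iffD2] split: if_splits)
  then have "L' \<subseteq> L" unfolding p'(2) using L(2) sub by (intro span_minimal) auto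
  moreover have "subspace L'" using iso'(1) by (simp add: isotropic_def)
  ultimately show ?thesis using subspace_dim_equal[of L' L] sub iso(2) iso'(2) by simp
qed

text \<open>Outside the caustics \<open>c * normal_det \<nu> w\<close> is nonzero, so equal values
  force an even number of reflections, and even products stay in the ruling. On a caustic the single
  ruling contains everything.\<close>

lemma exists_ruling:
  assumes \<mu>: "\<mu> \<notin> range (($) a)"
    and 1: "normal_frame h \<nu>" "unit_direction \<nu> w" "vertex_of \<mu> h \<nu> p" "joachimsthal \<mu> h \<nu> w p c"
  shows "\<exists>R. ruling (pencil_quadric a \<alpha> \<mu>) R \<and>
     (\<forall>h' \<nu>' w' p' c'. normal_frame h' \<nu>' \<and> unit_direction \<nu>' w' \<and> vertex_of \<mu> h' \<nu>' p' \<and>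
        joachimsthal \<mu> h' \<nu>' w' p' c' \<and> c' * normal_det \<nu>' w' = c * normal_det \<nu> w
        \<longrightarrow> extension \<mu> h' \<nu>' p' \<in> R)"
proof -
  have iso: "isotropic (Sp \<mu>) (extension \<mu> h' \<nu>' p')" "dim (extension \<mu> h' \<nu>' p') = CARD('d)"
    if "normal_frame h' \<nu>'" "vertex_of \<mu> h' \<nu>' p'" for h' \<nu>' p'
    using isotropic_ext[OF \<mu>] dim_ext[OF \<mu>] that unfolding vertex_of_def by auto
  show ?thesis
  proof (cases "\<mu> \<in> range (($) \<alpha>)")
    case True
    then obtain k where k: "\<mu> = \<alpha> $ k" by blast
    show ?thesis
      using ruling_degenerate[of k, OF \<mu>[unfolded k] iso[unfolded k, OF 1(1) 1(3)[unfolded k]]] iso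
      unfolding k by metis
  next
    case False
    obtain q and vs :: "('d, 'c) bigspace list" where q: "vertex_of \<mu> h \<nu> q" "fst q \<noteq> 0"
      "joachimsthal \<mu> h \<nu> w q ((- 1) ^ length vs * c)"
      using affine_vertex[OF \<mu> False 1] by blast
    obtain R where R: "ruling (pencil_quadric a \<alpha> \<mu>) R"
      "\<And>us. anisotropic (Sp \<mu>) us \<Longrightarrow> even (length us) \<Longrightarrow> scaled_refls (Sp \<mu>) us ` extension \<mu> h \<nu> p \<in> R"
      using ruling_nondegenerate[OF \<mu> False affine_frame[OF \<mu> False 1(1,2) q] iso[OF 1(1,3)]] by metis
    have "extension \<mu> h' \<nu>' p' \<in> R"
      if 2: "normal_frame h' \<nu>'" "unit_direction \<nu>' w'" "vertex_of \<mu> h' \<nu>' p'" "joachimsthal \<mu> h' \<nu>' w' p' c'"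
        and eq: "c' * normal_det \<nu>' w' = c * normal_det \<nu> w" for h' \<nu>' w' p' c'
    proof -
      obtain us where us: "anisotropic (Sp \<mu>) us" "scaled_refls (Sp \<mu>) us ` extension \<mu> h \<nu> p = extension \<mu> h' \<nu>' p'"
        using reach[OF \<mu>] iso[OF 1(1,3)] iso[OF 2(1,3)] by blast
      have "c * normal_det \<nu> w \<noteq> 0"
        using joachimsthal_nonzero[OF \<mu> False 1(1,3,4)] normal_det_nonzero[OF 1(1,2)] by simp
      then have "even (length us)"
        using joachimsthal_parity[OF \<mu> False 1 2 us] eq by (cases "even (length us)") auto
      with R(2)[OF us(1)] us(2) show ?thesis by simp
    qed
    with R(1) show ?thesis by blast
  qed
qed

end

section \<open>Cyclic indices, and recovering frames and vertices from subspaces\<close>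

lemma cyc_succ_in: "j \<in> {1..2*n} \<Longrightarrow> cyc_succ n j \<in> {1..2*n}"
  by (auto simp: cyc_succ_def)

lemma cyc_succ_parity: "odd (cyc_succ n j) \<longleftrightarrow> even j"
  by (auto simp: cyc_succ_def)

lemma cyc_succ_twice: "2 \<le> n \<Longrightarrow> j \<in> {1..2*n} \<Longrightarrow> cyc_succ n (cyc_succ n j) \<noteq> j"
  by (auto simp: cyc_succ_def)

lemma cyc_succ_surj:
  assumes "j \<in> {1..2*n}"
  obtains i where "i \<in> {1..2*n}" and "cyc_succ n i = j"
proof (cases "j = 1")
  case True
  then show ?thesis using assms by (intro that[of "2 * n"]) (auto simp: cyc_succ_def)
next
  case False
  then show ?thesis using assms by (intro that[of "j - 1"]) (auto simp: cyc_succ_def)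
qed

context confocal
begin

lemma range_lift_determines:
  assumes "range (lift h \<nu>) = range (lift h' \<nu>')"
  shows "h = h'" and "\<nu> = \<nu>'"
proof -
  have "lift h \<nu> (axis k 1) = lift h' \<nu>' (axis k 1)" for k
  proof -
    have "lift h \<nu> (axis k 1) \<in> range (lift h' \<nu>')" using assms by auto
    then obtain y where y: "lift h \<nu> (axis k 1) = lift h' \<nu>' y" by blast
    have "y = axis k 1" using arg_cong[OF y, of "\<lambda>z. snd (snd z)"] by simp
    with y show ?thesis by simp
  qed
  then show "h = h'" "\<nu> = \<nu>'" by (auto simp: lift_axis)
qed

lemma normals_line_determines:
  assumes "normal_frame h \<nu>" and "normals_line h \<nu> = normals_line h' \<nu>"
  shows "h = h'"
proof
  fix k
  let ?z = "(1 :: real, - (\<Sum>k\<in>UNIV. h k *\<^sub>R \<nu> k))"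
  have "?z \<in> normals_line h \<nu>" by (rule foot_in_line[OF assms(1)])
  moreover from this have "?z \<in> normals_line h' \<nu>" using assms(2) by simp
  ultimately have "fst ?z * h k + snd ?z \<bullet> \<nu> k = 0" "fst ?z * h' k + snd ?z \<bullet> \<nu> k = 0"
    unfolding normals_line_def by blast+
  then show "h k = h' k" by simp
qed

text \<open>The vertex belongs to the extension rather than to a lift inside it: up to a factor, the
  vertex vector is the only vector there with zero \<open>y\<close>-part.\<close>

lemma vertex_transfer:
  assumes \<mu>: "\<mu> \<notin> range (($) a)" and p: "p \<noteq> 0" and iso: "isotropic (Sp \<mu>) (extension \<mu> h \<nu> p)"
    and sub: "range (lift h' \<nu>') \<subseteq> extension \<mu> h \<nu> p"
  shows "vertex_of \<mu> h' \<nu>' p" and "extension \<mu> h' \<nu>' p = extension \<mu> h \<nu> p"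
proof -
  have v: "vvec \<mu> p \<in> extension \<mu> h \<nu> p" by (simp add: span_base)
  have "fst p * h' k + snd p \<bullet> \<nu>' k = 0" for k
  proof -
    have "Sp \<mu> (vvec \<mu> p) \<bullet> lift h' \<nu>' (axis k 1) = 0"
      using sub by (intro isotropicD[OF iso v]) auto
    then show ?thesis by (simp add: form_vertex_vec[OF \<mu>] lift_axis add.commute)
  qed
  moreover have "confocal_bilinear a \<mu> p p = 0"
    using isotropicD[OF iso v v] by (simp add: form_vertex_vertex[OF \<mu>])
  ultimately show "vertex_of \<mu> h' \<nu>' p"
    using p by (simp add: vertex_of_def confocal_quadric_iff normals_line_def)
  have "extension \<mu> h' \<nu>' p \<subseteq> extension \<mu> h \<nu> p" using v sub by (intro span_minimal subspace_span) auto
  then show "extension \<mu> h' \<nu>' p = extension \<mu> h \<nu> p"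
    using subspace_dim_equal[OF subspace_span subspace_span] dim_ext[OF \<mu> p, of h' \<nu>'] dim_ext[OF \<mu> p, of h \<nu>]
    by (metis order_refl)
qed

section \<open>Billiard reflections\<close>

text \<open>These are the coordinates of
  \<open>(h k, \<nu> k, axis k 1) + t *\<^sub>R vertex_vec a \<mu> p\<close> with
  \<open>t = - 2 (\<nu> k \<bullet> N) / (N \<bullet> N)\<close>. They remain meaningful at
  infinity, where the offsets do not change.\<close>

definition reflected ::
    "real \<Rightarrow> 'd pspace \<Rightarrow> ('c \<Rightarrow> real) \<Rightarrow> ('c \<Rightarrow> real^'d) \<Rightarrow> ('c \<Rightarrow> real) \<Rightarrow> ('c \<Rightarrow> real^'d) \<Rightarrow> bool" where
  "reflected \<mu> p h \<nu> h' \<nu>' \<longleftrightarrow> (let N = quadric_normal a \<mu> p in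
     \<forall>k. \<nu>' k = mirror N (\<nu> k) \<and> h' k = h k + 2 * (\<nu> k \<bullet> N) / (N \<bullet> N) * fst p)"

text \<open>A second normal frame in the extension differs from the first by multiples
  \<open>t k\<close> of the vertex vector.  Comparing lengths shows that the product of the linear
  functionals with coefficients \<open>t\<close> and \<open>m\<close> below vanishes, hence one of them does.\<close>

lemma frames_in_extension:
  assumes \<mu>: "\<mu> \<notin> range (($) a)" and p: "vertex_of \<mu> h0 \<nu>0 p"
    and nf: "normal_frame h \<nu>" and nf': "normal_frame h' \<nu>'"
    and sub: "range (lift h' \<nu>') \<subseteq> extension \<mu> h \<nu> p" and ne: "range (lift h' \<nu>') \<noteq> range (lift h \<nu>)"
  shows "reflected \<mu> p h \<nu> h' \<nu>'"
proof -
  define N where "N = quadric_normal a \<mu> p"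
  have N0: "N \<noteq> 0" unfolding N_def using p by (intro quadric_normal_nonzero[OF \<mu>]) (auto simp: vertex_of_def)
  have "\<forall>k. \<exists>t. h' k = h k - t * fst p \<and> \<nu>' k = \<nu> k + t *\<^sub>R N"
  proof
    fix k
    have "lift h' \<nu>' (axis k 1) \<in> extension \<mu> h \<nu> p" using sub by auto
    then obtain t y where ty: "lift h' \<nu>' (axis k 1) = lift h \<nu> y + t *\<^sub>R vvec \<mu> p"
      unfolding mem_ext by blast
    have "y = axis k 1" using arg_cong[OF ty, of "\<lambda>z. snd (snd z)"] by (simp add: vertex_vec_def)
    with ty show "\<exists>t. h' k = h k - t * fst p \<and> \<nu>' k = \<nu> k + t *\<^sub>R N"
      by (intro exI[of _ t]) (simp add: lift_axis vertex_vec_def N_def)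
  qed
  then obtain t where t: "\<And>k. h' k = h k - t k * fst p" "\<And>k. \<nu>' k = \<nu> k + t k *\<^sub>R N" by metis
  define m where "m k = 2 * (\<nu> k \<bullet> N) + (N \<bullet> N) * t k" for k
  have tm: "t j * m k + t k * m j = 0" for j k
  proof -
    have "\<nu>' j \<bullet> \<nu>' k = \<nu> j \<bullet> \<nu> k"
      using normal_frame_orthonormal[OF nf] normal_frame_orthonormal[OF nf'] by simp
    then have "t k * (\<nu> j \<bullet> N) + t j * (\<nu> k \<bullet> N) + t j * t k * (N \<bullet> N) = 0"
      by (simp add: t(2) inner_simps inner_commute[of N "\<nu> k"] algebra_simps)
    then have "2 * (t k * (\<nu> j \<bullet> N) + t j * (\<nu> k \<bullet> N) + t j * t k * (N \<bullet> N)) = 0" by simp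
    then show ?thesis by (simp add: m_def algebra_simps)
  qed
  have "\<exists>k. t k \<noteq> 0"
  proof (rule ccontr)
    assume "\<nexists>k. t k \<noteq> 0"
    then have "h' = h" "\<nu>' = \<nu>" using t by auto
    with ne show False by simp
  qed
  then obtain j where j: "t j \<noteq> 0" by blast
  have mj: "m j = 0" using tm[of j j] j by simp
  have mk: "m k = 0" for k using tm[of j k] mj j by simp
  have "t k = - (2 * (\<nu> k \<bullet> N) / (N \<bullet> N))" for k
    using mk[of k] N0 by (simp add: m_def field_simps)
  then show ?thesis
    by (simp add: reflected_def t N_def[symmetric] mirror_def)
qed

lemma reflected_in_extension:
  assumes "reflected \<mu> p h \<nu> h' \<nu>'"
  shows "range (lift h' \<nu>') \<subseteq> extension \<mu> h \<nu> p"
proof -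
  define N where "N = quadric_normal a \<mu> p"
  define t where "t k = - (2 * (\<nu> k \<bullet> N) / (N \<bullet> N))" for k
  have "(h' k, \<nu>' k, axis k 1) = lift h \<nu> (axis k 1) + t k *\<^sub>R vvec \<mu> p" for k
    using assms by (simp add: reflected_def lift_axis vertex_vec_def t_def N_def[symmetric] mirror_def Let_def)
  moreover have "lift h \<nu> (axis k 1) + t k *\<^sub>R vvec \<mu> p \<in> extension \<mu> h \<nu> p" for k
    unfolding mem_ext by blast
  ultimately have "(h' k, \<nu>' k, axis k 1) \<in> extension \<mu> h \<nu> p" for k by simp
  then show ?thesis
    unfolding lift_sum by (intro image_subsetI span_sum span_scale)
qed

lemma reflected_unique:
  "reflected \<mu> p h \<nu> h1 \<nu>1 \<Longrightarrow> reflected \<mu> p h \<nu> h2 \<nu>2 \<Longrightarrow> h1 = h2 \<and> \<nu>1 = \<nu>2"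
  by (auto simp: reflected_def Let_def fun_eq_iff)

lemma unit_direction_mirror:
  assumes "unit_direction \<nu> w" and "reflected \<mu> p h \<nu> h' \<nu>'"
  shows "unit_direction \<nu>' (mirror (quadric_normal a \<mu> p) w)"
  using assms by (auto simp: unit_direction_def reflected_def norm_mirror mirror_inner Let_def)

lemma normal_det_reflected:
  assumes "quadric_normal a \<mu> p \<noteq> 0" and "reflected \<mu> p h \<nu> h' \<nu>'"
  shows "normal_det \<nu>' (mirror (quadric_normal a \<mu> p) w) = - normal_det \<nu> w"
proof -
  have "\<nu>' = (\<lambda>k. mirror (quadric_normal a \<mu> p) (\<nu> k))"
    using assms(2) by (simp add: reflected_def fun_eq_iff Let_def)
  then show ?thesis using normal_det_mirror[OF assms(1)] by simp
qed

lemma unit_direction_determined: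
  assumes "normal_frame h \<nu>" and "unit_direction \<nu> w" and "unit_direction \<nu> w'"
    and "normal_det \<nu> w' = normal_det \<nu> w"
  shows "w' = w"
proof -
  have "(w' \<bullet> w) * normal_det \<nu> w = 1 * normal_det \<nu> w"
    using normal_det_replace[OF assms(1,2), of w'] assms(4) by simp
  then have "w' \<bullet> w = 1" using normal_det_nonzero[OF assms(1,2)] by simp
  then show ?thesis using unit_direction_unique(1)[OF assms(1-3)] by simp
qed

lemma line_direction_unit: "unit_direction \<nu> w \<Longrightarrow> line_direction (normals_line h \<nu>) w"
  using direction_in_line by (auto simp: line_direction_def unit_direction_def)

lemma reflection_law_reflected:
  assumes nf: "normal_frame h \<nu>" and nf': "normal_frame h' \<nu>'" and r: "reflected \<mu> p h \<nu> h' \<nu>'"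
  shows "reflection_law a \<mu> p (normals_line h \<nu>) (normals_line h' \<nu>')"
proof -
  define N where "N = quadric_normal a \<mu> p"
  obtain w where w: "unit_direction \<nu> w" using unit_direction_exists[OF nf, of 1] by auto
  have w': "unit_direction \<nu>' (mirror N w)"
    unfolding N_def by (rule unit_direction_mirror[OF w r])
  have r': "\<nu>' k = mirror N (\<nu> k)" "h' k = h k + 2 * (\<nu> k \<bullet> N) / (N \<bullet> N) * fst p" for k
    using r by (simp_all add: reflected_def N_def Let_def)
  show ?thesis
  proof (cases "fst p = 0")
    case False
    have in_span: "mirror N w \<in> span {N, w}"
      unfolding mirror_def by (intro span_diff span_scale span_base) auto
    have "dim {N, w, mirror N w} \<le> card {N, w}"
      using in_span by (intro dim_le_card) (auto intro: span_base)
    also have "\<dots> \<le> 2" by (simp add: card_insert_if)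
    finally have 1: "dim {N, w, mirror N w} \<le> 2" .
    have "mirror N w \<bullet> N = - (w \<bullet> N)"
      by (cases "N = 0") (simp_all add: mirror_def inner_diff_left)
    then have 2: "\<bar>w \<bullet> N\<bar> / norm w = \<bar>mirror N w \<bullet> N\<bar> / norm (mirror N w)"
      by (simp add: norm_mirror)
    \<comment> \<open>If the line is mapped to itself, its direction is an eigenvector of the
      mirror: the eigenvalue 1 means tangent, -1 means normal to the quadric.\<close>
    have 3: "w \<in> span {N} \<or> w \<bullet> N = 0" if eq: "normals_line h \<nu> = normals_line h' \<nu>'"
    proof -
      have "(0, mirror N w) \<in> normals_line h \<nu>" using direction_in_line[OF w'] eq by simp
      then have uw: "unit_direction \<nu> (mirror N w)"
        using w by (simp add: normals_line_def unit_direction_def norm_mirror)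
      consider "mirror N w = w" | "mirror N w = - w"
        using unit_direction_unique[OF nf w uw] by (metis scaleR_minus1_left scaleR_one)
      then show ?thesis
      proof cases
        case 1
        then have "2 * (w \<bullet> N) / (N \<bullet> N) = 0 \<or> N = 0" by (simp add: mirror_def)
        then show ?thesis by auto
      next
        case 2
        then have "(w + w) = (2 * (w \<bullet> N) / (N \<bullet> N)) *\<^sub>R N"
          by (simp add: mirror_def diff_eq_eq)
        then have "2 *\<^sub>R w = (2 * (w \<bullet> N) / (N \<bullet> N)) *\<^sub>R N"
          by (simp only: scaleR_2)
        then have "w = (1 / 2) *\<^sub>R ((2 * (w \<bullet> N) / (N \<bullet> N)) *\<^sub>R N)"
          by (metis (no_types) scaleR_scaleR scaleR_one nonzero_divide_eq_eq zero_neq_numeral)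
        then show ?thesis by (metis span_base span_scale singletonI)
      qed
    qed
    show ?thesis
      unfolding reflection_law_def Let_def N_def[symmetric]
      using False 1 2 3 line_direction_unit[OF w, of h] line_direction_unit[OF w', of h'] by auto
  next
    case True
    \<comment> \<open>With unchanged offsets, any affine point of the first line has its mirror
      image on the second; the foot point is taken.\<close>
    define x where "x = - (\<Sum>k\<in>UNIV. h k *\<^sub>R \<nu> k)"
    have x: "(1, x) \<in> normals_line h \<nu>" unfolding x_def by (rule foot_in_line[OF nf])
    then have "(1, mirror N x) \<in> normals_line h' \<nu>'"
      by (simp add: normals_line_def r' True mirror_inner)
    with x True show ?thesis
      unfolding reflection_law_def Let_def N_def[symmetric] by auto
  qed
qed

text \<open>The offsets of the tangent hyperplanes follow from incidence with the common
  vertex, except at infinity, where the reflection law supplies a pair of mirror points.\<close>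

lemma reflected_of_reflection_law:
  assumes p: "vertex_of \<mu> h \<nu> p" and p': "vertex_of \<mu> h' \<nu>' p"
    and \<nu>': "\<And>k. \<nu>' k = mirror (quadric_normal a \<mu> p) (\<nu> k)"
    and law: "reflection_law a \<mu> p (normals_line h \<nu>) (normals_line h' \<nu>')"
  shows "reflected \<mu> p h \<nu> h' \<nu>'"
proof -
  define N where "N = quadric_normal a \<mu> p"
  have "h' k = h k + 2 * (\<nu> k \<bullet> N) / (N \<bullet> N) * fst p" for k
  proof (cases "fst p = 0")
    case False
    have Np: "N \<bullet> snd p = fst p * fst p"
      using p by (simp add: vertex_of_def confocal_quadric_iff confocal_bilinear_normal N_def)
    have "fst p * h k + snd p \<bullet> \<nu> k = 0" "fst p * h' k + snd p \<bullet> mirror N (\<nu> k) = 0"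
      using p p' by (simp_all add: vertex_of_def normals_line_def \<nu>' N_def)
    then have "fst p * h' k = fst p * h k + 2 * (\<nu> k \<bullet> N) / (N \<bullet> N) * (N \<bullet> snd p)"
      by (simp add: mirror_def inner_diff_right inner_commute[of "snd p"])
    then have "fst p * h' k = fst p * (h k + 2 * (\<nu> k \<bullet> N) / (N \<bullet> N) * fst p)"
      unfolding Np by (simp add: algebra_simps)
    then show ?thesis using False by simp
  next
    case True
    then obtain x where "(1, x) \<in> normals_line h \<nu>" "(1, mirror N x) \<in> normals_line h' \<nu>'"
      using law unfolding reflection_law_def Let_def N_def by auto
    then have "h k + x \<bullet> \<nu> k = 0" "h' k + mirror N x \<bullet> mirror N (\<nu> k) = 0"
      by (simp_all add: normals_line_def \<nu>' N_def)
    then show ?thesis using True by (simp add: mirror_inner)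
  qed
  with \<nu>' show ?thesis by (simp add: reflected_def N_def Let_def)
qed

section \<open>Chains and polygons\<close>

lemma weyr_chain_projects:
  assumes \<mu>1: "\<mu>1 \<notin> range (($) a)" and \<mu>2: "\<mu>2 \<notin> range (($) a)" and n: "2 \<le> n"
    and R1: "ruling (pencil_quadric a \<alpha> \<mu>1) R1" and R2: "ruling (pencil_quadric a \<alpha> \<mu>2) R2"
    and chain: "weyr_chain a \<alpha> R1 R2 n L"
  shows "\<exists>p. poncelet_polygon a \<alpha> \<mu>1 \<mu>2 n (chain_side n L) p \<and>
     coherent a \<alpha> \<mu>1 \<mu>2 n (chain_side n L) p"
proof -
  define I where "I = {1..2 * n}"
  define s where "s = cyc_succ n"
  define \<mu> where "\<mu> = alternate \<mu>1 \<mu>2"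
  define R where "R = alternate R1 R2"
  have sI: "s j \<in> I" if "j \<in> I" for j using cyc_succ_in that by (simp add: s_def I_def)
  have ss: "s (s j) \<noteq> j" if "j \<in> I" for j using cyc_succ_twice[OF n] that by (simp add: s_def I_def)
  have parity: "odd (s j) \<longleftrightarrow> even j" for j by (simp add: s_def cyc_succ_parity)
  have \<mu>: "\<mu> j \<notin> range (($) a)" for j using \<mu>1 \<mu>2 by (simp add: \<mu>_def alternate_def)
  have R: "ruling (pencil_quadric a \<alpha> (\<mu> j)) (R j)" for j
    using R1 R2 by (simp add: \<mu>_def R_def alternate_def)
  have same: "R i = R j" "\<mu> i = \<mu> j" if "odd i \<longleftrightarrow> odd j" for i j
    using that by (simp_all add: R_def \<mu>_def alternate_def)
  have injL: "i = j" if "L i = L j" "i \<in> I" "j \<in> I" for i j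
    using chain that by (auto simp: weyr_chain_def I_def dest: inj_onD)
  have LR: "L j \<in> R j" if "j \<in> I" for j
  proof (cases "odd j")
    case True
    then obtain i where "j = 2 * i + 1" by (rule oddE)
    then have "j = 2 * (i + 1) - 1" "i + 1 \<in> {1..n}" using that by (auto simp: I_def)
    then show ?thesis using chain True unfolding weyr_chain_def R_def alternate_def by metis
  next
    case False
    then obtain i where "j = 2 * i" by blast
    then have "j = 2 * i" "i \<in> {1..n}" using that by (auto simp: I_def)
    then show ?thesis using chain False unfolding weyr_chain_def R_def alternate_def by metis
  qed
  define M where "M j = L j \<inter> L (s j)" for j
  have "\<forall>j. \<exists>h \<nu>. j \<in> I \<longrightarrow> normal_frame h \<nu> \<and> M j = range (lift h \<nu>)"
    using chain FV_normal_frame by (auto simp: weyr_chain_def I_def M_def s_def)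
  then obtain h \<nu> where frames: "\<forall>j. j \<in> I \<longrightarrow> normal_frame (h j) (\<nu> j) \<and> M j = range (lift (h j) (\<nu> j))"
    by metis
  have nf: "normal_frame (h j) (\<nu> j)" and M: "M j = range (lift (h j) (\<nu> j))" if "j \<in> I" for j
    using frames that by auto
  have M_sub: "range (lift (h j) (\<nu> j)) \<subseteq> L j" "range (lift (h j) (\<nu> j)) \<subseteq> L (s j)" if "j \<in> I" for j
    unfolding M[OF that, symmetric] by (auto simp: M_def)
  have isoL: "isotropic (Sp (\<mu> j)) (L j)" "dim (L j) = CARD('d)" if "j \<in> I" for j
    using ruling_isotropic[OF R LR[OF that]] by auto
  have "\<forall>j. \<exists>p. j \<in> I \<longrightarrow> vertex_of (\<mu> j) (h j) (\<nu> j) p \<and> L j = extension (\<mu> j) (h j) (\<nu> j) p"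
    using vertex_exists[OF \<mu> nf isoL M_sub(1)] by (auto simp: vertex_of_def)
  then obtain p where "\<forall>j. j \<in> I \<longrightarrow> vertex_of (\<mu> j) (h j) (\<nu> j) (p j) \<and> L j = extension (\<mu> j) (h j) (\<nu> j) (p j)"
    by metis
  then have p: "vertex_of (\<mu> j) (h j) (\<nu> j) (p j)" and L: "L j = extension (\<mu> j) (h j) (\<nu> j) (p j)"
    if "j \<in> I" for j using that by auto
  have pnz: "p j \<noteq> 0" if "j \<in> I" for j using p[OF that] by (simp add: vertex_of_def)
  \<comment> \<open>The link \<open>L (s j)\<close> contains the intersections on both of its sides,
    so its vertex lies on side \<open>j\<close> as well as on side \<open>s j\<close>.\<close>
  have next_vertex: "vertex_of (\<mu> (s j)) (h j) (\<nu> j) (p (s j))" "extension (\<mu> (s j)) (h j) (\<nu> j) (p (s j)) = L (s j)"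
    if "j \<in> I" for j
    using vertex_transfer[OF \<mu> pnz[OF sI[OF that]] _ M_sub(2)[OF that, unfolded L[OF sI[OF that]]]]
      isoL(1)[OF sI[OF that]] L[OF sI[OF that]] by auto
  \<comment> \<open>Distinct links could still meet in the same subspace. A ruling has only one
    member through it, so equal parity of \<open>i\<close> and \<open>j\<close> gives equal links;
    unequal parity would make \<open>i\<close> and \<open>j\<close> successors of each other,
    impossible in a cycle of length at least four.\<close>
  have M_inj: "i = j" if ij: "i \<in> I" "j \<in> I" and eq: "M i = M j" for i j
  proof -
    have sub: "range (lift (h i) (\<nu> i)) \<subseteq> L i" "range (lift (h i) (\<nu> i)) \<subseteq> L (s i)"
      "range (lift (h i) (\<nu> i)) \<subseteq> L j" "range (lift (h i) (\<nu> i)) \<subseteq> L (s j)"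
      unfolding M[OF ij(1), symmetric] by (auto simp: M_def) (use eq in \<open>auto simp: M_def\<close>)
    have unique: "x = y" if "x \<in> I" "y \<in> I" "odd x \<longleftrightarrow> odd y"
      "range (lift (h i) (\<nu> i)) \<subseteq> L x" "range (lift (h i) (\<nu> i)) \<subseteq> L y" for x y
      using ruling_unique[OF \<mu> R nf[OF ij(1)], of "L x" x "L y"] LR[OF that(1)] LR[OF that(2)] same(1)[OF that(3)]
        injL that by auto
    show ?thesis
    proof (cases "odd i \<longleftrightarrow> odd j")
      case True
      then show ?thesis using unique ij sub by blast
    next
      case False
      have "i = s j" "s i = j"
        using unique[OF ij(1) sI[OF ij(2)] _ sub(1) sub(4)] unique[OF sI[OF ij(1)] ij(2) _ sub(2) sub(3)]
          False parity by auto
      then show ?thesis using ss ij by auto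
    qed
  qed
  have refl: "reflected (\<mu> (s j)) (p (s j)) (h j) (\<nu> j) (h (s j)) (\<nu> (s j))" if "j \<in> I" for j
  proof (rule frames_in_extension[OF \<mu> p[OF sI[OF that]] nf[OF that] nf[OF sI[OF that]]])
    show "range (lift (h (s j)) (\<nu> (s j))) \<subseteq> extension (\<mu> (s j)) (h j) (\<nu> j) (p (s j))"
      unfolding next_vertex(2)[OF that] by (rule M_sub(1)[OF sI[OF that]])
    have "s j \<noteq> j" using parity[of j] by auto
    then show "range (lift (h (s j)) (\<nu> (s j))) \<noteq> range (lift (h j) (\<nu> j))"
      using M_inj[OF sI[OF that] that] M[OF that] M[OF sI[OF that]] by auto
  qed
  \<comment> \<open>An alternating orientation selects one of the two unit directions. It agrees
    with the reflections, which reverse the determinant, and also at the step from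
    \<open>2 * n\<close> to 1.\<close>
  have "\<forall>j. \<exists>w. j \<in> I \<longrightarrow> unit_direction (\<nu> j) w \<and> normal_det (\<nu> j) w = (if odd j then 1 else - 1)"
    using unit_direction_exists[OF nf] by auto
  then obtain w where "\<forall>j. j \<in> I \<longrightarrow> unit_direction (\<nu> j) (w j) \<and> normal_det (\<nu> j) (w j) = (if odd j then 1 else - 1)"
    by metis
  then have w: "unit_direction (\<nu> j) (w j)" and det_w: "normal_det (\<nu> j) (w j) = (if odd j then 1 else - 1)"
    if "j \<in> I" for j using that by auto
  have w_refl: "w (s j) = mirror (quadric_normal a (\<mu> (s j)) (p (s j))) (w j)" if "j \<in> I" for j
  proof -
    let ?N = "quadric_normal a (\<mu> (s j)) (p (s j))"
    have N: "?N \<noteq> 0"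
      using p[OF sI[OF that]] by (intro quadric_normal_nonzero[OF \<mu>]) (auto simp: vertex_of_def)
    have "mirror ?N (w j) = w (s j)"
    proof (rule unit_direction_determined[OF nf[OF sI[OF that]] w[OF sI[OF that]]])
      show "unit_direction (\<nu> (s j)) (mirror ?N (w j))"
        by (rule unit_direction_mirror[OF w[OF that] refl[OF that]])
      show "normal_det (\<nu> (s j)) (mirror ?N (w j)) = normal_det (\<nu> (s j)) (w (s j))"
        using normal_det_reflected[OF N refl[OF that], of "w j"] det_w[OF that] det_w[OF sI[OF that]] parity[of j]
        by auto
    qed
    then show ?thesis by simp
  qed
  have "\<forall>j. \<exists>c. j \<in> I \<longrightarrow> joachimsthal (\<mu> j) (h j) (\<nu> j) (w j) (p j) c"
    using joachimsthal_exists[OF nf w p] by auto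
  then obtain c where "\<forall>j. j \<in> I \<longrightarrow> joachimsthal (\<mu> j) (h j) (\<nu> j) (w j) (p j) (c j)"
    by metis
  then have c: "joachimsthal (\<mu> j) (h j) (\<nu> j) (w j) (p j) (c j)" if "j \<in> I" for j using that by auto
  \<comment> \<open>Within one parity class both the ruling and the orientation are the same, so the
    constant itself is.\<close>
  have c_same: "c i = c j" if ij: "i \<in> I" "j \<in> I" "odd i \<longleftrightarrow> odd j" for i j
  proof -
    have e: "\<mu> j = \<mu> i" "R j = R i" using same[of j i] ij(3) by auto
    have "c j * normal_det (\<nu> j) (w j) = c i * normal_det (\<nu> i) (w i)"
      using LR[OF ij(1)] LR[OF ij(2)] L[OF ij(1)] L[OF ij(2)] e
      by (intro ruling_coefficient[OF \<mu> R nf[OF ij(1)] w[OF ij(1)] p[OF ij(1)] c[OF ij(1)]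
            nf[OF ij(2)] w[OF ij(2)] p[OF ij(2), unfolded e] c[OF ij(2), unfolded e]]) simp_all
    then show ?thesis using det_w[OF ij(1)] det_w[OF ij(2)] ij(3) by (auto split: if_splits)
  qed
  have c_alt: "c j = alternate (c 1) (c 2) j" if "j \<in> I" for j
    using c_same[OF that, of 1] c_same[OF that, of 2] n by (auto simp: alternate_def I_def)
  have side: "chain_side n L j = normals_line (h j) (\<nu> j)" if "j \<in> I" for j
    using M[OF that] dual_line_lift by (simp add: chain_side_def M_def s_def)
  have "poncelet_polygon a \<alpha> \<mu>1 \<mu>2 n (chain_side n L) p"
    unfolding poncelet_polygon_def I_def[symmetric] s_def[symmetric] \<mu>_def[symmetric]
  proof (intro ballI)
    fix j assume j: "j \<in> I"
    show "euclidean_line (chain_side n L j) \<and> (\<forall>k. tangent_to a (\<alpha> $ k) (chain_side n L j)) \<and>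
        p j \<noteq> 0 \<and> p j \<in> confocal_quadric a (\<mu> j) \<and> p j \<in> chain_side n L j \<and> p (s j) \<in> chain_side n L j \<and>
        reflection_law a (\<mu> (s j)) (p (s j)) (chain_side n L j) (chain_side n L (s j))"
      unfolding side[OF j] side[OF sI[OF j]]
      using p[OF j] next_vertex(1)[OF j] euclidean_normals_line[OF nf[OF j]] tangent_normals_line[OF nf[OF j]]
        reflection_law_reflected[OF nf[OF j] nf[OF sI[OF j]] refl[OF j]]
      by (simp add: vertex_of_def)
  qed
  moreover have "coherent a \<alpha> \<mu>1 \<mu>2 n (chain_side n L) p"
    unfolding coherent_def I_def[symmetric] s_def[symmetric] \<mu>_def[symmetric]
  proof (intro exI conjI ballI)
    \<comment> \<open>Line and normals determine the offsets, hence the intersection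
      \<open>M j\<close>.\<close>
    show "inj_on (\<lambda>j. (chain_side n L j, \<nu> j)) I"
    proof (rule inj_onI)
      fix i j assume ij: "i \<in> I" "j \<in> I" "(chain_side n L i, \<nu> i) = (chain_side n L j, \<nu> j)"
      then have "\<nu> i = \<nu> j" "normals_line (h i) (\<nu> i) = normals_line (h j) (\<nu> i)"
        using side by auto
      then have "M i = M j" using normals_line_determines[OF nf[OF ij(1)]] M ij by auto
      with ij show "i = j" using M_inj by blast
    qed
    fix j assume j: "j \<in> I"
    have "\<nu> (s j) k = mirror (quadric_normal a (\<mu> (s j)) (p (s j))) (\<nu> j k)" for k
      using refl[OF j] by (simp add: reflected_def Let_def)
    moreover have "confocal_bilinear a (\<mu> j) (p j) z = alternate (c 1) (c 2) j * ((fst (p j) *\<^sub>R snd z - fst z *\<^sub>R snd (p j)) \<bullet> w j)"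
      if "z \<in> normals_line (h j) (\<nu> j)" for z
      using c[OF j] c_alt[OF j] that by (simp add: joachimsthal_def)
    ultimately show "let j' = s j; N' = quadric_normal a (\<mu> j') (p j')
       in norm (w j) = 1 \<and> line_direction (chain_side n L j) (w j) \<and> w j' = mirror N' (w j) \<and>
          (\<forall>k. contact_normal a (\<alpha> $ k) (chain_side n L j) (\<nu> j k) \<and> \<nu> j' k = mirror N' (\<nu> j k)) \<and>
          (\<forall>z\<in>chain_side n L j. confocal_bilinear a (\<mu> j) (p j) z =
              alternate (c 1) (c 2) j * ((fst (p j) *\<^sub>R snd z - fst z *\<^sub>R snd (p j)) \<bullet> w j))"
      unfolding Let_def side[OF j]
      using w[OF j] line_direction_unit[OF w[OF j]] w_refl[OF j] contact_normal_line[OF nf[OF j]]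
      by (simp add: unit_direction_def del: split_paired_All)
  qed
  ultimately show ?thesis by blast
qed

text \<open>The transported normals in \<open>coherent\<close> supply the frames and make
  consecutive lifts reflections of each other; the common constants place all extensions of one
  parity in a single ruling.\<close>

lemma poncelet_polygon_lifts:
  assumes \<mu>1: "\<mu>1 \<notin> range (($) a)" and \<mu>2: "\<mu>2 \<notin> range (($) a)" and \<mu>12: "\<mu>1 \<noteq> \<mu>2" and n: "2 \<le> n"
    and poly: "poncelet_polygon a \<alpha> \<mu>1 \<mu>2 n l p" and coh: "coherent a \<alpha> \<mu>1 \<mu>2 n l p"
  shows "\<exists>R1 R2 L. ruling (pencil_quadric a \<alpha> \<mu>1) R1 \<and> ruling (pencil_quadric a \<alpha> \<mu>2) R2 \<and>
     weyr_chain a \<alpha> R1 R2 n L \<and> (\<forall>j\<in>{1..2*n}. l j = chain_side n L j)"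
proof -
  define I where "I = {1..2 * n}"
  define s where "s = cyc_succ n"
  define \<mu> where "\<mu> = alternate \<mu>1 \<mu>2"
  have sI: "s j \<in> I" if "j \<in> I" for j using cyc_succ_in that by (simp add: s_def I_def)
  have parity: "odd (s j) \<longleftrightarrow> even j" for j by (simp add: s_def cyc_succ_parity)
  have \<mu>: "\<mu> j \<notin> range (($) a)" for j using \<mu>1 \<mu>2 by (simp add: \<mu>_def alternate_def)
  have \<mu>_ne: "\<mu> i \<noteq> \<mu> j" if "odd i \<longleftrightarrow> even j" for i j using \<mu>12 that by (auto simp: \<mu>_def alternate_def)
  obtain w \<nu> c1 c2 where inj: "inj_on (\<lambda>j. (l j, \<nu> j)) I"
    and coh': "\<forall>j\<in>I.
           (let j' = s j; N' = quadric_normal a (\<mu> j') (p j') in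
             norm (w j) = 1 \<and> line_direction (l j) (w j) \<and> w j' = mirror N' (w j) \<and>
             (\<forall>k. contact_normal a (\<alpha> $ k) (l j) (\<nu> j k) \<and> \<nu> j' k = mirror N' (\<nu> j k)) \<and>
             (\<forall>z\<in>l j. confocal_bilinear a (\<mu> j) (p j) z =
                alternate c1 c2 j * ((fst (p j) *\<^sub>R snd z - fst z *\<^sub>R snd (p j)) \<bullet> w j)))"
    using coh unfolding coherent_def I_def[symmetric] s_def[symmetric] \<mu>_def[symmetric] by (elim exE conjE) (rule that)
  define c where "c = alternate c1 c2"
  have coh_j: "norm (w j) = 1" "line_direction (l j) (w j)"
      "w (s j) = mirror (quadric_normal a (\<mu> (s j)) (p (s j))) (w j)"
      "\<And>k. contact_normal a (\<alpha> $ k) (l j) (\<nu> j k)"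
      "\<And>k. \<nu> (s j) k = mirror (quadric_normal a (\<mu> (s j)) (p (s j))) (\<nu> j k)"
      "\<forall>z\<in>l j. confocal_bilinear a (\<mu> j) (p j) z = c j * ((fst (p j) *\<^sub>R snd z - fst z *\<^sub>R snd (p j)) \<bullet> w j)"
    if "j \<in> I" for j
    using bspec[OF coh' that] unfolding Let_def c_def by blast+
  have poly_j: "euclidean_line (l j)" "p j \<noteq> 0" "p j \<in> confocal_quadric a (\<mu> j)" "p j \<in> l j" "p (s j) \<in> l j"
      "reflection_law a (\<mu> (s j)) (p (s j)) (l j) (l (s j))" if "j \<in> I" for j
    using poly that unfolding poncelet_polygon_def I_def s_def \<mu>_def by blast+
  have "\<forall>j. \<exists>h. j \<in> I \<longrightarrow> normal_frame h (\<nu> j) \<and> l j = normals_line h (\<nu> j)"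
    using normal_frame_of_tangent_line[OF poly_j(1) coh_j(4)] by auto
  then obtain h where "\<forall>j. j \<in> I \<longrightarrow> normal_frame (h j) (\<nu> j) \<and> l j = normals_line (h j) (\<nu> j)" by metis
  then have nf: "normal_frame (h j) (\<nu> j)" and l: "l j = normals_line (h j) (\<nu> j)" if "j \<in> I" for j
    using that by auto
  have w: "unit_direction (\<nu> j) (w j)" if "j \<in> I" for j
    using coh_j(1,2)[OF that] by (simp add: unit_direction_def line_direction_def l[OF that] normals_line_def)
  have p: "vertex_of (\<mu> j) (h j) (\<nu> j) (p j)" if "j \<in> I" for j
    using poly_j[OF that] by (simp add: vertex_of_def l[OF that])
  have p_next: "vertex_of (\<mu> (s j)) (h j) (\<nu> j) (p (s j))" if "j \<in> I" for j
    using poly_j[OF that] poly_j[OF sI[OF that]] by (simp add: vertex_of_def l[OF that])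
  have c: "joachimsthal (\<mu> j) (h j) (\<nu> j) (w j) (p j) (c j)" if "j \<in> I" for j
    using coh_j(6)[OF that] by (simp add: joachimsthal_def l[OF that])
  have refl: "reflected (\<mu> (s j)) (p (s j)) (h j) (\<nu> j) (h (s j)) (\<nu> (s j))" if "j \<in> I" for j
    using poly_j(6)[OF that] unfolding l[OF that] l[OF sI[OF that]]
    by (intro reflected_of_reflection_law p_next[OF that] p[OF sI[OF that]] coh_j(5)[OF that])
  define L where "L j = extension (\<mu> j) (h j) (\<nu> j) (p j)" for j
  define M where "M j = range (lift (h j) (\<nu> j))" for j
  have pnz: "p j \<noteq> 0" if "j \<in> I" for j by (rule poly_j(2)[OF that])
  have isoL: "isotropic (Sp (\<mu> j)) (L j)" "dim (L j) = CARD('d)" if "j \<in> I" for j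
    using isotropic_ext[OF \<mu> nf[OF that]] dim_ext[OF \<mu>] p[OF that] unfolding vertex_of_def L_def by auto
  \<comment> \<open>The extension at a vertex can be built from either adjacent side, because their
    lifts are reflected into each other.\<close>
  have L_next: "L (s j) = extension (\<mu> (s j)) (h j) (\<nu> j) (p (s j))" if "j \<in> I" for j
  proof -
    have "isotropic (Sp (\<mu> (s j))) (extension (\<mu> (s j)) (h j) (\<nu> j) (p (s j)))"
      using isotropic_ext[OF \<mu> nf[OF that]] p_next[OF that] unfolding vertex_of_def by auto
    from vertex_transfer(2)[OF \<mu> pnz[OF sI[OF that]] this reflected_in_extension[OF refl[OF that]]]
    show ?thesis by (simp add: L_def)
  qed
  have M_sub: "M j \<subseteq> L j" "M j \<subseteq> L (s j)" if "j \<in> I" for j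
    unfolding L_next[OF that] by (auto simp: L_def M_def span_base)
  \<comment> \<open>Extensions of opposite parity are isotropic for different members of the pencil,
    so they meet inside the base locus, where dimensions are at most \<open>d - 1\<close>.\<close>
  have sub_int: "dim (L i \<inter> L j) \<le> CARD('c)" if "i \<in> I" "j \<in> I" "odd i \<longleftrightarrow> even j" for i j
  proof (rule dim_in_base_locus)
    have sub: "subspace (L i)" "subspace (L j)" using isoL that by (auto simp: isotropic_def)
    then show "subspace (L i \<inter> L j)" by (rule subspace_inter)
    show "L i \<inter> L j \<subseteq> base_locus a \<alpha>"
      using pencil_inter_subset_base_locus[OF \<mu>_ne[OF that(3)], of a \<alpha>]
        isotropic_pencil_iff[OF sub(1), of a \<alpha> "\<mu> i"] isotropic_pencil_iff[OF sub(2), of a \<alpha> "\<mu> j"]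
        isoL(1)[OF that(1)] isoL(1)[OF that(2)] by blast
  qed
  have LL: "L j \<inter> L (s j) = M j" if "j \<in> I" for j
  proof -
    have "M j = L j \<inter> L (s j)"
    proof (rule subspace_dim_equal)
      show "subspace (M j)" unfolding M_def by (rule subspace_range_lift)
      show "subspace (L j \<inter> L (s j))"
        unfolding L_def by (intro subspace_inter subspace_span)
      show "M j \<subseteq> L j \<inter> L (s j)" using M_sub[OF that] by blast
      show "dim (L j \<inter> L (s j)) \<le> dim (M j)"
        using sub_int[OF that sI[OF that]] parity[of j] unfolding M_def dim_range_lift by auto
    qed
    then show ?thesis ..
  qed
  have M_inj: "i = j" if "i \<in> I" "j \<in> I" "M i = M j" for i j
    using range_lift_determines[OF that(3)[unfolded M_def]] l[OF that(1)] l[OF that(2)] inj_onD[OF inj _ that(1,2)]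
    by auto
  have M_choice: "M j = M i \<or> reflected (\<mu> (s i)) (p (s i)) (h i) (\<nu> i) (h j) (\<nu> j)"
    if ij: "i \<in> I" "j \<in> I" and sub: "M j \<subseteq> L (s i)" for i j
    using frames_in_extension[OF \<mu> p[OF sI[OF ij(1)]] nf[OF ij(1)] nf[OF ij(2)]] sub
    unfolding M_def L_next[OF ij(1)] by blast
  \<comment> \<open>Equal extensions have equal parity by dimension. By \<open>M_choice\<close> the
    only lifts of sides inside \<open>L i\<close> are those of the preceding side and of side
    \<open>i\<close>; for \<open>M j\<close> the first contradicts the parity, the second
    \<open>i \<noteq> j\<close>.\<close>
  have L_inj: "i = j" if ij: "i \<in> I" "j \<in> I" and eq: "L i = L j" for i j
  proof (rule ccontr)
    assume ne: "i \<noteq> j"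
    have "dim (L i \<inter> L j) = CARD('d)" using isoL(2)[OF ij(1)] eq by simp
    then have par: "odd i \<longleftrightarrow> odd j" using sub_int[OF ij] card_d by auto
    obtain i' where i': "i' \<in> I" "s i' = i" using cyc_succ_surj ij(1) unfolding I_def s_def by metis
    have "M j \<subseteq> L (s i')" using M_sub(1)[OF ij(2)] eq i'(2) by simp
    then consider "M j = M i'" | "reflected (\<mu> i) (p i) (h i') (\<nu> i') (h j) (\<nu> j)"
      using M_choice[OF i'(1) ij(2)] i'(2) by auto
    then show False
    proof cases
      case 1
      then have "j = i'" using M_inj[OF ij(2) i'(1)] by simp
      then show False using par parity[of i'] i'(2) by auto
    next
      case 2
      have "reflected (\<mu> i) (p i) (h i') (\<nu> i') (h i) (\<nu> i)" using refl[OF i'(1)] i'(2) by simp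
      from reflected_unique[OF 2 this] have "M j = M i" by (simp add: M_def)
      then show False using M_inj[OF ij(2,1)] ne by simp
    qed
  qed
  have det_next: "normal_det (\<nu> (s j)) (w (s j)) = - normal_det (\<nu> j) (w j)" if "j \<in> I" for j
  proof -
    have "quadric_normal a (\<mu> (s j)) (p (s j)) \<noteq> 0"
      using p[OF sI[OF that]] by (intro quadric_normal_nonzero[OF \<mu>]) (auto simp: vertex_of_def)
    from normal_det_reflected[OF this refl[OF that]] show ?thesis unfolding coh_j(3)[OF that] .
  qed
  have det_alt: "normal_det (\<nu> j) (w j) = (if odd j then normal_det (\<nu> 1) (w 1) else - normal_det (\<nu> 1) (w 1))"
    if "j \<in> I" for j
  proof -
    have "1 \<le> j" using that by (simp add: I_def)
    then show ?thesis using that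
    proof (induction j rule: dec_induct)
      case (step m)
      have m: "m \<in> I" using step by (simp add: I_def)
      have "s m = Suc m" using step by (auto simp: s_def cyc_succ_def I_def)
      then show ?case using step.IH[OF m] det_next[OF m] by auto
    qed simp
  qed
  have I12: "1 \<in> I" "2 \<in> I" using n by (auto simp: I_def)
  \<comment> \<open>Orientation and constant agree within a parity class, so
    \<open>c j * normal_det (\<nu> j) (w j)\<close> has one value there, which selects one
    ruling.\<close>
  have rulings: "\<exists>R. ruling (pencil_quadric a \<alpha> (\<mu> i)) R \<and> (\<forall>j\<in>I. (odd i \<longleftrightarrow> odd j) \<longrightarrow> L j \<in> R)" if i: "i \<in> I" for i
  proof -
    obtain R where R: "ruling (pencil_quadric a \<alpha> (\<mu> i)) R"
      "\<forall>h' \<nu>' w' p' c'. normal_frame h' \<nu>' \<and> unit_direction \<nu>' w' \<and> vertex_of (\<mu> i) h' \<nu>' p' \<and>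
        joachimsthal (\<mu> i) h' \<nu>' w' p' c' \<and> c' * normal_det \<nu>' w' = c i * normal_det (\<nu> i) (w i)
        \<longrightarrow> extension (\<mu> i) h' \<nu>' p' \<in> R"
      using exists_ruling[OF \<mu> nf[OF i] w[OF i] p[OF i] c[OF i]] by blast
    have "L j \<in> R" if j: "j \<in> I" and par: "odd i \<longleftrightarrow> odd j" for j
    proof -
      have e: "\<mu> i = \<mu> j" "c i = c j" using par by (simp_all add: \<mu>_def c_def alternate_def)
      have "c j * normal_det (\<nu> j) (w j) = c i * normal_det (\<nu> i) (w i)"
        using det_alt[OF i] det_alt[OF j] par e by auto
      then show ?thesis unfolding L_def
        using R(2)[unfolded e(1)] nf[OF j] w[OF j] p[OF j] c[OF j] e by blast
    qed
    with R(1) show ?thesis by blast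
  qed
  have \<mu>12': "\<mu> 1 = \<mu>1" "\<mu> 2 = \<mu>2" by (simp_all add: \<mu>_def alternate_def)
  obtain R1 where R1: "ruling (pencil_quadric a \<alpha> \<mu>1) R1" "\<And>j. j \<in> I \<Longrightarrow> odd j \<Longrightarrow> L j \<in> R1"
    using rulings[OF I12(1)] \<mu>12' by auto
  obtain R2 where R2: "ruling (pencil_quadric a \<alpha> \<mu>2) R2" "\<And>j. j \<in> I \<Longrightarrow> even j \<Longrightarrow> L j \<in> R2"
    using rulings[OF I12(2)] \<mu>12' by auto
  have "weyr_chain a \<alpha> R1 R2 n L"
    unfolding weyr_chain_def I_def[symmetric] s_def[symmetric]
  proof (intro conjI ballI)
    show "inj_on L I" using L_inj by (auto intro: inj_onI)
    show "L (2 * i - 1) \<in> R1" "L (2 * i) \<in> R2" if "i \<in> {1..n}" for i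
      using that by (auto intro!: R1(2) R2(2) simp: I_def)
    show "L j \<inter> L (s j) \<in> FV a \<alpha>" if "j \<in> I" for j
      unfolding LL[OF that] M_def by (rule range_lift_in_FV[OF nf[OF that]])
  qed
  moreover have "l j = chain_side n L j" if "j \<in> I" for j
    unfolding chain_side_def s_def[symmetric] LL[OF that] M_def dual_line_lift by (rule l[OF that])
  ultimately show ?thesis using R1(1) R2(1) unfolding I_def by blast
qed

end

theorem proposition10:
  fixes a :: "real^'d::finite" and \<alpha> :: "real^'c::finite"
    and \<mu>1 \<mu>2 :: real and n :: nat
  assumes "CARD('d) = CARD('c) + 1"
    and "inj (($) a)" and "inj (($) \<alpha>)" and "range (($) a) \<inter> range (($) \<alpha>) = {}"
    and "\<mu>1 \<notin> range (($) a)" and "\<mu>2 \<notin> range (($) a)" and "\<mu>1 \<noteq> \<mu>2"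
    and "2 \<le> n"
  shows
    "(\<forall>R1 R2 L.
        ruling (pencil_quadric a \<alpha> \<mu>1) R1 \<and> ruling (pencil_quadric a \<alpha> \<mu>2) R2 \<and>
        weyr_chain a \<alpha> R1 R2 n L \<longrightarrow>
        (\<exists>p. poncelet_polygon a \<alpha> \<mu>1 \<mu>2 n (chain_side n L) p \<and>
             coherent a \<alpha> \<mu>1 \<mu>2 n (chain_side n L) p)) \<and>
     (\<forall>l p.
        poncelet_polygon a \<alpha> \<mu>1 \<mu>2 n l p \<and> coherent a \<alpha> \<mu>1 \<mu>2 n l p \<longrightarrow>
        (\<exists>R1 R2 L.
           ruling (pencil_quadric a \<alpha> \<mu>1) R1 \<and> ruling (pencil_quadric a \<alpha> \<mu>2) R2 \<and>
           weyr_chain a \<alpha> R1 R2 n L \<and>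
           (\<forall>j\<in>{1..2*n}. l j = chain_side n L j)))"
proof -
  have "card (UNIV :: 'd set) = card (UNIV :: 'c option set)" using assms(1) by simp
  \<comment> \<open>The additional value \<open>None\<close> is the place of
    \<open>x\<^sub>0\<close> beside the \<open>y\<close>-coordinates.\<close>
  then obtain g :: "'d \<Rightarrow> 'c option" where "bij g"
    using finite_same_card_bij[OF finite finite] by blast
  then interpret confocal a \<alpha> g using assms(3,4) by (intro confocal.intro)
  show ?thesis
    using weyr_chain_projects[OF assms(5,6,8)] poncelet_polygon_lifts[OF assms(5,6,7,8)] by blast
qed

end
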